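(* The maximal operator defined for $f\in L^1(\gamma_\infty)$ by $$S_0^{\mathrm{glob}}f(x)=\int_{\mathbb R^n}\ \sup_{0<t\le1}K_t(x,u)\,\big(1-\eta(x,u)\big)\,|f(u)|\,d\gamma_\infty(u)$$ is of weak type $(1,1)$ with respect to the invariant measure $\gamma_\infty$; that is, there is a constant $C<\infty$ such that $\gamma_\infty\{x\in\mathbb R^n:S_0^{\mathrm{glob}}f(x)>\alpha\}\le\frac C\alpha\|f\|_{L^1(\gamma_\infty)}$ for all $\alpha>0$ and all $f\in L^1(\gamma_\infty)$.
   Context: Setting. $Q$ is a real symmetric positive definite $n\times n$ matrix and $B$ a real $n\times n$ matrix all of whose eigenvalues have negative real parts. For $t\in(0,+\infty]$ put $Q_t=\int_0^t e^{sB}Qe^{sB^*}\,ds$. Let $R(x)=\frac12\langle Q_\infty^{-1}x,x\rangle$ and $d\gamma_\infty(x)=(2\pi)^{-n/2}(\det Q_\infty)^{-1/2}e^{-R(x)}\,dx$, a probability measure. Let $D_t=Q_\infty e^{-tB^*}Q_\infty^{-1}$, $t\in\mathbb R$. The Mehler kernel is, for $x,u\in\mathbb R^n$, $t>0$, $$K_t(x,u)=\Big(\frac{\det Q_\infty}{\det Q_t}\Big)^{1/2}e^{R(x)}\exp\Big[-\tfrac12\big\langle (Q_t^{-1}-Q_\infty^{-1})(u-D_tx),u-D_tx\big\rangle\Big].$$ The localizing function $\eta$. Let $x_0=0$ and let $(x_j)_{j\ge0}$ be a sequence of points in $\mathbb R^n$ such that the open balls $B_j=B(x_j,1/(1+|x_j|))$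 are pairwise disjoint and the family $(B_j)$ is maximal with this property; $\kappa B_j$ denotes the concentric ball scaled by $\kappa$. Then the balls $3B_j$ cover $\mathbb R^n$ and the balls $6B_j$ have bounded overlap. Let $\rho_j\ge0$ be smooth, supported in $4B_j$, equal to $1$ on $3B_j$, uniformly bounded, with $|\nabla\rho_j(x)|\le C(1+|x|)$ uniformly in $j$, and set $r_j=\rho_j/\sum_i\rho_i$. Let $\widetilde r_j$ be smooth with values in $[0,1]$, equal to $1$ on $5B_j$, supported in $6B_j$, with $|\nabla\widetilde r_j(x)|\le C(1+|x|)$ uniformly in $j$. These choices are fixed, and $\eta(x,u)=\sum_{j=0}^\infty\widetilde r_j(x)\,r_j(u)$, so $0\le\eta\le1$. *)

theory Defs
  imports "HOL-Analysis.Analysis"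
begin

definition pos_def_matrix :: "real^'n^'n \<Rightarrow> bool" where
  "pos_def_matrix A \<longleftrightarrow> transpose A = A \<and> (\<forall>x. x \<noteq> 0 \<longrightarrow> (A *v x) \<bullet> x > 0)"

text \<open>Eigenvalues of a real matrix are understood over the complex numbers.\<close>

definition complex_eigenvalue :: "real^'n^'n \<Rightarrow> complex \<Rightarrow> bool" where
  "complex_eigenvalue A z \<longleftrightarrow>
     (\<exists>v :: complex^'n. v \<noteq> 0 \<and> map_matrix complex_of_real A *v v = z *s v)"

text \<open>The multiplication of the type class structure on \<open>real^'n^'n\<close> is componentwise, so neither
  \<open>(^)\<close> nor \<open>exp\<close> is the matrix version.\<close>

definition matrix_exp :: "real^'n^'n \<Rightarrow> real^'n^'n" where
  "matrix_exp A = (\<Sum>k. (1 / fact k) *\<^sub>R (((**) A ^^ k) (mat 1)))"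

definition Qt :: "real^'n^'n \<Rightarrow> real^'n^'n \<Rightarrow> ereal \<Rightarrow> real^'n^'n" where
  "Qt Q B t = (LINT s:{s. 0 \<le> s \<and> ereal s \<le> t}|lborel.
     matrix_exp (s *\<^sub>R B) ** Q ** matrix_exp (s *\<^sub>R transpose B))"

abbreviation Qinf :: "real^'n^'n \<Rightarrow> real^'n^'n \<Rightarrow> real^'n^'n" where
  "Qinf Q B \<equiv> Qt Q B \<infinity>"

definition quad_R :: "real^'n^'n \<Rightarrow> real^'n^'n \<Rightarrow> real^'n \<Rightarrow> real" where
  "quad_R Q B x = 1 / 2 * ((matrix_inv (Qinf Q B) *v x) \<bullet> x)"

definition gamma_inf :: "real^'n^'n \<Rightarrow> real^'n^'n \<Rightarrow> (real^'n) measure" where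
  "gamma_inf Q B = density lborel (\<lambda>x. ennreal
     ((2 * pi) powr (- real CARD('n) / 2) * det (Qinf Q B) powr (- 1 / 2) * exp (- quad_R Q B x)))"

definition Dt :: "real^'n^'n \<Rightarrow> real^'n^'n \<Rightarrow> real \<Rightarrow> real^'n^'n" where
  "Dt Q B t = Qinf Q B ** matrix_exp ((- t) *\<^sub>R transpose B) ** matrix_inv (Qinf Q B)"

definition mehler_kernel ::
  "real^'n^'n \<Rightarrow> real^'n^'n \<Rightarrow> real \<Rightarrow> real^'n \<Rightarrow> real^'n \<Rightarrow> real" where
  "mehler_kernel Q B t x u =
     sqrt (det (Qinf Q B) / det (Qt Q B (ereal t))) * exp (quad_R Q B x) *
     exp (- 1 / 2 * (((matrix_inv (Qt Q B (ereal t)) - matrix_inv (Qinf Q B)) *v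
                      (u - Dt Q B t *v x)) \<bullet> (u - Dt Q B t *v x)))"

text \<open>\<open>scaled_ball \<kappa> a\<close> is the ball with centre \<open>a\<close> and radius \<open>\<kappa> / (1 + \<bar>a\<bar>)\<close>.\<close>

definition scaled_ball :: "real \<Rightarrow> real^'n \<Rightarrow> (real^'n) set" where
  "scaled_ball \<kappa> a = ball a (\<kappa> * (1 / (1 + norm a)))"

definition maximal_ball_centres :: "(nat \<Rightarrow> real^'n) \<Rightarrow> bool" where
  "maximal_ball_centres c \<longleftrightarrow>
     disjoint_family (\<lambda>j. scaled_ball 1 (c j)) \<and>
     (\<forall>Y. range c \<subseteq> Y \<and> disjoint_family_on (scaled_ball 1) Y \<longrightarrow> Y = range c)"

fun k_smooth :: "nat \<Rightarrow> (real^'n \<Rightarrow> real) \<Rightarrow> bool" where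
  "k_smooth 0 f \<longleftrightarrow> continuous_on UNIV f"
| "k_smooth (Suc k) f \<longleftrightarrow>
     (\<forall>x. f differentiable (at x)) \<and> (\<forall>v. k_smooth k (\<lambda>x. frechet_derivative f (at x) v))"

definition smooth :: "(real^'n \<Rightarrow> real) \<Rightarrow> bool" where
  "smooth f \<longleftrightarrow> (\<forall>k. k_smooth k f)"

text \<open>Since the functions are continuous, it makes no difference whether ``supported in'' a ball
  refers to the open or the closed ball, if it is read as vanishing outside that ball.\<close>

definition localizing_functions ::
  "(nat \<Rightarrow> real^'n) \<Rightarrow> (nat \<Rightarrow> real^'n \<Rightarrow> real) \<Rightarrow> (nat \<Rightarrow> real^'n \<Rightarrow> real) \<Rightarrow> bool" where
  "localizing_functions c \<rho> rt \<longleftrightarrow>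
     (\<forall>j. smooth (\<rho> j) \<and> (\<forall>x. \<rho> j x \<ge> 0) \<and>
          support_on UNIV (\<rho> j) \<subseteq> scaled_ball 4 (c j) \<and>
          (\<forall>x\<in>scaled_ball 3 (c j). \<rho> j x = 1)) \<and>
     (\<exists>M. \<forall>j x. \<rho> j x \<le> M) \<and>
     (\<exists>C. \<forall>j x. \<exists>D. GDERIV (\<rho> j) x :> D \<and> norm D \<le> C * (1 + norm x)) \<and>
     (\<forall>j. smooth (rt j) \<and> (\<forall>x. rt j x \<in> {0..1}) \<and>
          support_on UNIV (rt j) \<subseteq> scaled_ball 6 (c j) \<and>
          (\<forall>x\<in>scaled_ball 5 (c j). rt j x = 1)) \<and>
     (\<exists>C. \<forall>j x. \<exists>D. GDERIV (rt j) x :> D \<and> norm D \<le> C * (1 + norm x))"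

text \<open>The two series below are locally finite sums, by the bounded overlap of the balls.\<close>

definition partition_fun :: "(nat \<Rightarrow> real^'n \<Rightarrow> real) \<Rightarrow> nat \<Rightarrow> real^'n \<Rightarrow> real" where
  "partition_fun \<rho> j u = \<rho> j u / (\<Sum>i. \<rho> i u)"

definition eta ::
  "(nat \<Rightarrow> real^'n \<Rightarrow> real) \<Rightarrow> (nat \<Rightarrow> real^'n \<Rightarrow> real) \<Rightarrow> real^'n \<Rightarrow> real^'n \<Rightarrow> real" where
  "eta \<rho> rt x u = (\<Sum>j. rt j x * partition_fun \<rho> j u)"

text \<open>The supremum may be infinite (when \<open>u = x\<close>), so it is taken in \<open>ennreal\<close>, where
  \<open>\<infinity> * 0 = 0\<close>.\<close>

definition S0_glob ::
  "real^'n^'n \<Rightarrow> real^'n^'n \<Rightarrow> (real^'n \<Rightarrow> real^'n \<Rightarrow> real) \<Rightarrow> (real^'n \<Rightarrow> real) \<Rightarrow> real^'n \<Rightarrow> ennreal"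
where
  "S0_glob Q B \<eta> f x =
     (\<integral>\<^sup>+ u. (SUP t\<in>{0<..1}. ennreal (mehler_kernel Q B t x u)) *
             ennreal (1 - \<eta> x u) * ennreal \<bar>f u\<bar> \<partial>gamma_inf Q B)"

text \<open>Measurability of the level sets is part of the property, as \<open>emeasure\<close> is \<open>0\<close> on
  non-measurable sets.\<close>

definition weak_type_1_1 :: "'a measure \<Rightarrow> (('a \<Rightarrow> real) \<Rightarrow> 'a \<Rightarrow> ennreal) \<Rightarrow> bool" where
  "weak_type_1_1 M T \<longleftrightarrow>
     (\<exists>C::real. \<forall>f. integrable M f \<longrightarrow> (\<forall>\<alpha>>0.
        {x \<in> space M. T f x > ennreal \<alpha>} \<in> sets M \<and>
        emeasure M {x \<in> space M. T f x > ennreal \<alpha>} \<le> ennreal (C / \<alpha> * (LINT u|M. \<bar>f u\<bar>))))"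

end

theory Submission
  imports Defs "HOL-Computational_Algebra.Fundamental_Theorem_Algebra"
begin

text \<open>The linear flow \<open>D\<^sub>t\<close> expands the quadratic form \<open>R\<close>, and for \<open>t \<le> 1\<close> the Mehler kernel is at most a
  constant times \<open>exp (R x) t\<^sup>-\<^sup>n\<^sup>/\<^sup>2 exp (- b \<bar>u - D\<^sub>t x\<bar>\<^sup>2 / t)\<close>. Let \<open>\<bar>x\<bar>\<close> be of size \<open>L\<close>. The global region is contained
  in \<open>\<bar>x - u\<bar> \<ge> \<delta> / L\<close>, and the flow needs a time of order \<open>1 / L\<^sup>2\<close> to cover this distance; so the supremum
  over \<open>t\<close> is at most \<open>exp (R x) min L (1 / d) ^ n\<close>, up to a constant, where \<open>d\<close> is the distance from \<open>u\<close> to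
  the flow line of \<open>x\<close>. As the flow moves with speed of order \<open>L\<close>, this is dominated by \<open>exp (R x)\<close> times
  the integral along that flow line of a kernel \<open>\<psi> z u\<close> with \<open>\<integral> \<psi> z u dz\<close> of order \<open>L\<^sup>2\<close>. Such an integral \<open>g\<close> is
  constant along flow lines. Where the operator exceeds \<open>\<alpha>\<close> one has \<open>exp (- R) \<le> C g / \<alpha>\<close>, and
  \<open>exp (- R)\<close> decays at a rate of order \<open>L\<^sup>2\<close> along the flow, so integrating over flow lines bounds the measure
  of the level set by \<open>C / \<alpha>\<close> times the norm. The contributions of the dyadic values of \<open>L\<close> are summable.\<close>

section \<open>The matrix exponential\<close>

text \<open>On the shell of size \<open>L = 2^k\<close> the gain \<open>1 / L^2\<close> from the
  decay of \<open>exp (- R)\<close> exactly cancels the \<open>L^2\<close> in the integral of the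
  kernel. Nothing is left that decays in \<open>k\<close>, so bounding the shells one at a time by
  the norm of \<open>f\<close> would not sum. The weight \<open>1 / 4^k\<close> is therefore kept
  inside the integral in \<open>u\<close>. For a fixed \<open>u\<close>, the balls about
  \<open>u\<close> of radius of order \<open>2^j / L\<close> meet the annuli of only
  \<open>j + O(1)\<close> values of \<open>k\<close>, while the scale \<open>j\<close> carries the
  weight \<open>2^-j\<close>, so the double sum converges uniformly in \<open>u\<close>. That weight
  has its price at distances \<rho> > 1: there a flow line is averaged only over a time of order
  \<open>1 / L\<close> instead of \<open>\<rho> / L\<close>, and the heat factor must supply one
  more power of \<open>1 / \<rho>\<close>. It can, because the times are at most 1. The region where
  \<open>R < 1\<close>, in which the growth of \<open>R\<close> is of no help, is treated
  separately: it is bounded, and the kernel is bounded there away from the diagonal.\<close>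

lemma bounded_bilinear_matrix_matrix_mult:
  "bounded_bilinear ((**) :: real^'n^'m \<Rightarrow> real^'p^'n \<Rightarrow> real^'p^'m)"
  unfolding bilinear_conv_bounded_bilinear[symmetric] bilinear_def
  by (auto intro!: linearI simp: matrix_matrix_mult_def vec_eq_iff sum.distrib sum_distrib_left
      algebra_simps)

lemma bounded_bilinear_matrix_vector_mult:
  "bounded_bilinear ((*v) :: real^'n^'m \<Rightarrow> real^'n \<Rightarrow> real^'m)"
  unfolding bilinear_conv_bounded_bilinear[symmetric] bilinear_def
  by (auto intro!: linearI simp: matrix_vector_mult_def vec_eq_iff sum.distrib sum_distrib_left
      algebra_simps)

lemma bounded_linear_transpose: "bounded_linear (transpose :: real^'n^'m \<Rightarrow> real^'m^'n)"
  unfolding linear_conv_bounded_linear[symmetric]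
  by (auto intro!: linearI simp: transpose_def vec_eq_iff)

lemmas matrix_matrix_mult_simps =
  bounded_bilinear.add_left[OF bounded_bilinear_matrix_matrix_mult]
  bounded_bilinear.add_right[OF bounded_bilinear_matrix_matrix_mult]
  bounded_bilinear.diff_left[OF bounded_bilinear_matrix_matrix_mult]
  bounded_bilinear.diff_right[OF bounded_bilinear_matrix_matrix_mult]
  bounded_bilinear.minus_left[OF bounded_bilinear_matrix_matrix_mult]
  bounded_bilinear.minus_right[OF bounded_bilinear_matrix_matrix_mult]
  bounded_bilinear.scaleR_left[OF bounded_bilinear_matrix_matrix_mult]
  bounded_bilinear.scaleR_right[OF bounded_bilinear_matrix_matrix_mult]

lemma matrix_pow_scaleR:
  fixes A :: "real^'n^'n"
  shows "((**) (s *\<^sub>R A) ^^ k) (mat 1) = s ^ k *\<^sub>R (((**) A ^^ k) (mat 1))"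
  by (induction k) (simp_all add: matrix_matrix_mult_simps)

lemma matrix_pow_commute:
  fixes A :: "real^'n^'n"
  shows "((**) A ^^ k) (mat 1) ** A = A ** ((**) A ^^ k) (mat 1)"
  by (induction k) (simp_all add: matrix_mul_assoc[symmetric])

lemma transpose_matrix_pow:
  fixes A :: "real^'n^'n"
  shows "transpose (((**) A ^^ k) (mat 1)) = ((**) (transpose A) ^^ k) (mat 1)"
proof (induction k)
  case (Suc k)
  have "transpose (((**) A ^^ Suc k) (mat 1)) = transpose (((**) A ^^ k) (mat 1) ** A)"
    by (simp add: matrix_pow_commute)
  then show ?case by (simp add: matrix_transpose_mul Suc)
qed (simp add: transpose_mat)

text \<open>Of the matrix norm only a constant \<open>K\<close> with
  \<open>norm (X ** Y) \<le> norm X * norm Y * K\<close> is used, so the geometric rate is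
  \<open>norm A * K\<close>.\<close>

lemma norm_matrix_pow_le:
  fixes A :: "real^'n^'n"
  obtains M where "M \<ge> 0" "\<And>k. norm (((**) A ^^ k) (mat 1)) \<le> norm (mat 1 :: real^'n^'n) * M ^ k"
proof -
  obtain K where K: "K > 0" "\<And>(X :: real^'n^'n) (Y :: real^'n^'n). norm (X ** Y) \<le> norm X * norm Y * K"
    using bounded_bilinear.pos_bounded[OF bounded_bilinear_matrix_matrix_mult] by blast
  have "norm (((**) A ^^ k) (mat 1)) \<le> norm (mat 1 :: real^'n^'n) * (norm A * K) ^ k" for k
  proof (induction k)
    case (Suc k)
    have "norm (((**) A ^^ Suc k) (mat 1)) \<le> norm A * norm (((**) A ^^ k) (mat 1)) * K"
      using K(2)[of A "((**) A ^^ k) (mat 1)"] by (simp add: mult_ac)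
    also have "\<dots> \<le> norm A * (norm (mat 1 :: real^'n^'n) * (norm A * K) ^ k) * K"
      using K by (intro mult_right_mono mult_left_mono Suc) auto
    finally show ?case by (simp add: algebra_simps)
  qed simp
  then show ?thesis using that[of "norm A * K"] K by simp
qed

lemma summable_matrix_exp:
  fixes A :: "real^'n^'n"
  shows "summable (\<lambda>k. (1 / fact k) *\<^sub>R (((**) A ^^ k) (mat 1)))"
proof -
  obtain M where M: "M \<ge> 0" "\<And>k. norm (((**) A ^^ k) (mat 1)) \<le> norm (mat 1 :: real^'n^'n) * M ^ k"
    using norm_matrix_pow_le[of A] by blast
  show ?thesis
  proof (rule summable_comparison_test')
    show "summable (\<lambda>k. norm (mat 1 :: real^'n^'n) * (inverse (fact k) * M ^ k))"
      by (intro summable_mult summable_exp)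
    show "norm ((1 / fact k) *\<^sub>R (((**) A ^^ k) (mat 1)))
      \<le> norm (mat 1 :: real^'n^'n) * (inverse (fact k) * M ^ k)" for k
      using mult_left_mono[OF M(2)[of k], of "inverse (fact k)"]
      by (simp add: divide_inverse mult_ac)
  qed
qed

lemma matrix_exp_sums:
  fixes A :: "real^'n^'n"
  shows "(\<lambda>k. (1 / fact k) *\<^sub>R (((**) A ^^ k) (mat 1))) sums matrix_exp A"
  unfolding matrix_exp_def by (rule summable_sums[OF summable_matrix_exp])

lemma matrix_exp_0 [simp]: "matrix_exp (0 :: real^'n^'n) = mat 1"
proof -
  have "(\<lambda>k. (1 / fact k) *\<^sub>R (((**) (0 :: real^'n^'n) ^^ k) (mat 1))) sums
    (\<Sum>k\<in>{0}. (1 / fact k) *\<^sub>R (((**) (0 :: real^'n^'n) ^^ k) (mat 1)))"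
  proof (rule sums_finite)
    fix k :: nat assume "k \<notin> {0}"
    then show "(1 / fact k) *\<^sub>R (((**) (0 :: real^'n^'n) ^^ k) (mat 1)) = 0"
      by (cases k) auto
  qed simp
  then show ?thesis using sums_unique2[OF matrix_exp_sums] by force
qed

lemma matrix_exp_transpose: "matrix_exp (transpose A) = transpose (matrix_exp (A :: real^'n^'n))"
proof -
  from bounded_linear.sums[OF bounded_linear_transpose matrix_exp_sums[of A]]
  have "(\<lambda>k. (1 / fact k) *\<^sub>R (((**) (transpose A) ^^ k) (mat 1))) sums transpose (matrix_exp A)"
    by (simp add: transpose_scalar transpose_matrix_pow)
  then show ?thesis using sums_unique2[OF matrix_exp_sums] by blast
qed

lemma matrix_exp_commute: "matrix_exp (s *\<^sub>R A) ** A = A ** matrix_exp (s *\<^sub>R (A :: real^'n^'n))"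
proof -
  have "(\<lambda>k. ((1 / fact k) *\<^sub>R (((**) (s *\<^sub>R A) ^^ k) (mat 1))) ** A) sums (matrix_exp (s *\<^sub>R A) ** A)"
    by (rule bounded_linear.sums[OF bounded_bilinear.bounded_linear_left
          [OF bounded_bilinear_matrix_matrix_mult] matrix_exp_sums])
  moreover have "(\<lambda>k. A ** ((1 / fact k) *\<^sub>R (((**) (s *\<^sub>R A) ^^ k) (mat 1)))) sums (A ** matrix_exp (s *\<^sub>R A))"
    by (rule bounded_linear.sums[OF bounded_bilinear.bounded_linear_right
          [OF bounded_bilinear_matrix_matrix_mult] matrix_exp_sums])
  ultimately show ?thesis
    by (simp add: matrix_matrix_mult_simps matrix_pow_scaleR matrix_pow_commute sums_unique2)
qed

text \<open>Each entry of the exponential is a real power series in \<open>s\<close> that converges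
  everywhere, so it may be differentiated term by term. The shifted coefficients
  \<open>diffs c\<close> lose one factor of the factorial and contain the next power of
  \<open>A\<close>.\<close>

lemma has_vector_derivative_matrix_exp:
  fixes A :: "real^'n^'n"
  shows "((\<lambda>s. matrix_exp (s *\<^sub>R A)) has_vector_derivative A ** matrix_exp (t *\<^sub>R A)) (at t)"
proof -
  have entry: "((\<lambda>s. matrix_exp (s *\<^sub>R A) $ i $ j) has_real_derivative
      (A ** matrix_exp (t *\<^sub>R A)) $ i $ j) (at t)" for i j
  proof -
    define c where "c k = (1 / fact k) * ((((**) A ^^ k) (mat 1)) $ i $ j)" for k
    have lin: "bounded_linear (\<lambda>X :: real^'n^'n. X $ i $ j)"
      by (simp add: bounded_linear_vec_nth bounded_linear_compose[OF bounded_linear_vec_nth])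
    have sums: "(\<lambda>k. c k * s ^ k) sums (matrix_exp (s *\<^sub>R A) $ i $ j)" for s
      using bounded_linear.sums[OF lin matrix_exp_sums[of "s *\<^sub>R A"]]
      by (simp add: c_def matrix_pow_scaleR mult_ac)
    have "((\<lambda>s. suminf (\<lambda>k. c k * s ^ k)) has_real_derivative (\<Sum>k. diffs c k * t ^ k)) (at t)"
      by (rule termdiffs_strong_converges_everywhere) (rule sums_summable[OF sums])
    moreover have "(\<lambda>k. diffs c k * t ^ k) sums ((A ** matrix_exp (t *\<^sub>R A)) $ i $ j)"
    proof -
      have "(\<lambda>k. (A ** ((1 / fact k) *\<^sub>R (((**) (t *\<^sub>R A) ^^ k) (mat 1)))) $ i $ j)
          sums ((A ** matrix_exp (t *\<^sub>R A)) $ i $ j)"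
        by (intro bounded_linear.sums[OF lin] bounded_linear.sums[OF
            bounded_bilinear.bounded_linear_right[OF bounded_bilinear_matrix_matrix_mult]]
            matrix_exp_sums)
      moreover have "(A ** ((1 / fact k) *\<^sub>R (((**) (t *\<^sub>R A) ^^ k) (mat 1)))) $ i $ j
          = diffs c k * t ^ k" for k
      proof -
        have "diffs c k = (1 / fact k) * ((((**) A ^^ Suc k) (mat 1)) $ i $ j)"
          unfolding diffs_def c_def fact_Suc by (simp add: field_simps del: funpow.simps of_nat_Suc)
        then show ?thesis by (simp add: matrix_pow_scaleR matrix_matrix_mult_simps)
      qed
      ultimately show ?thesis by simp
    qed
    moreover have "(\<lambda>s. suminf (\<lambda>k. c k * s ^ k)) = (\<lambda>s. matrix_exp (s *\<^sub>R A) $ i $ j)"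
      using sums by (auto simp: sums_iff)
    ultimately show ?thesis by (simp add: sums_iff)
  qed
  show ?thesis
    unfolding has_vector_derivative_def
  proof (subst has_derivative_componentwise_within, intro ballI)
    fix b :: "real^'n^'n" assume "b \<in> Basis"
    then obtain i j where b: "b = axis i (axis j 1)" by (auto simp: Basis_vec_def)
    show "((\<lambda>s. matrix_exp (s *\<^sub>R A) \<bullet> b) has_derivative
        (\<lambda>h. h *\<^sub>R (A ** matrix_exp (t *\<^sub>R A)) \<bullet> b)) (at t)"
      using entry[of i j] unfolding has_field_derivative_def
      by (simp add: b inner_axis mult.commute[of _ "_ $ _ $ _"])
  qed
qed

lemma continuous_on_matrix_exp: "continuous_on S (\<lambda>s. matrix_exp (s *\<^sub>R (A :: real^'n^'n)))"
  using has_vector_derivative_continuous[OF has_vector_derivative_matrix_exp]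
  by (intro continuous_at_imp_continuous_on ballI)

text \<open>Since \<open>A\<close> commutes with its exponentials,
  \<open>?E (r + t) ** ?E (- r)\<close> has derivative zero in \<open>r\<close> and equals its value
  \<open>?E t\<close> at \<open>r = 0\<close>. Taking \<open>t = 0\<close> yields the inverse of
  \<open>?E r\<close>, and the addition law follows.\<close>

lemma matrix_exp_add:
  fixes A :: "real^'n^'n"
  shows "matrix_exp ((s + t) *\<^sub>R A) = matrix_exp (s *\<^sub>R A) ** matrix_exp (t *\<^sub>R A)"
proof -
  let ?E = "\<lambda>s. matrix_exp (s *\<^sub>R A)"
  have const: "?E (s + t) ** ?E (- s) = ?E t" for s t
  proof -
    define F where "F r = ?E (r + t) ** ?E (- r)" for r
    have "(F has_vector_derivative 0) (at r)" for r
    proof -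
      have 1: "((\<lambda>r. ?E (r + t)) has_vector_derivative (A ** ?E (r + t))) (at r)"
        using vector_diff_chain_at[where f = "\<lambda>r. r + t" and f' = 1, OF _ has_vector_derivative_matrix_exp, of r A]
        by (simp add: o_def has_vector_derivative_add_const has_vector_derivative_id)
      have 2: "((\<lambda>r. ?E (- r)) has_vector_derivative - (A ** ?E (- r))) (at r)"
        using vector_diff_chain_at[where f = "\<lambda>r. - r" and f' = "-1", OF _ has_vector_derivative_matrix_exp, of r A]
        by (simp add: o_def has_vector_derivative_minus has_vector_derivative_id)
      have "(F has_vector_derivative (?E (r + t) ** (- (A ** ?E (- r))) + (A ** ?E (r + t)) ** ?E (- r))) (at r)"
        unfolding F_def[abs_def]
        by (rule bounded_bilinear.has_vector_derivative[OF bounded_bilinear_matrix_matrix_mult 1 2])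
      then show ?thesis
        by (simp add: matrix_matrix_mult_simps matrix_mul_assoc matrix_exp_commute)
    qed
    then have "F s = F 0"
      using has_vector_derivative_zero_constant[of UNIV F] by fastforce
    then show ?thesis by (simp add: F_def)
  qed
  show ?thesis
  proof -
    have "?E (t + s) = ?E (t + s) ** (?E (- t) ** ?E t)"
      using const[of "- t" 0] by simp
    also have "\<dots> = (?E (t + s) ** ?E (- t)) ** ?E t"
      by (simp only: matrix_mul_assoc)
    also have "\<dots> = ?E s ** ?E t"
      by (simp only: const)
    finally show ?thesis by (simp only: add.commute)
  qed
qed

section \<open>Exponential decay of stable linear flows\<close>

definition poly_orbit :: "complex^'n^'n \<Rightarrow> complex poly \<Rightarrow> complex^'n \<Rightarrow> complex^'n" where
  "poly_orbit A p v = (\<Sum>i\<le>degree p. coeff p i *s (((*v) A ^^ i) v))"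

lemma poly_orbit_altdef:
  assumes "degree p \<le> N"
  shows "poly_orbit A p v = (\<Sum>i\<le>N. coeff p i *s (((*v) A ^^ i) v))"
  unfolding poly_orbit_def using assms
  by (intro sum.mono_neutral_left) (auto simp: coeff_eq_0)

lemma poly_orbit_add: "poly_orbit A (p + q) v = poly_orbit A p v + poly_orbit A q v"
  using poly_orbit_altdef[of p "max (degree p) (degree q)" A v]
    poly_orbit_altdef[of q "max (degree p) (degree q)" A v]
    poly_orbit_altdef[of "p + q" "max (degree p) (degree q)" A v]
  by (simp add: degree_add_le_max sum.distrib vec.scale_left_distrib)

lemma poly_orbit_smult: "poly_orbit A (smult a p) v = a *s poly_orbit A p v"
  using poly_orbit_altdef[of "smult a p" "degree p"]
  by (simp add: poly_orbit_def vec.scale_sum_right)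

lemma poly_orbit_pCons_0: "poly_orbit A (pCons 0 p) v = A *v poly_orbit A p v"
proof -
  have "poly_orbit A (pCons 0 p) v
      = (\<Sum>i\<le>Suc (degree p). coeff (pCons 0 p) i *s (((*v) A ^^ i) v))"
    by (rule poly_orbit_altdef) (simp add: degree_pCons_le)
  also have "\<dots> = (\<Sum>i\<le>degree p. coeff p i *s (A *v (((*v) A ^^ i) v)))"
    by (subst sum.atMost_Suc_shift) simp
  also have "\<dots> = A *v poly_orbit A p v"
    by (simp add: poly_orbit_def vec.sum vec.scale)
  finally show ?thesis .
qed

lemma poly_orbit_linear_factor:
  "poly_orbit A ([:- l, 1:] * p) v = A *v poly_orbit A p v - l *s poly_orbit A p v"
proof -
  have "[:- l, 1:] * p = pCons 0 p + smult (- l) p" by simp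
  then show ?thesis
    by (simp only: poly_orbit_add poly_orbit_smult poly_orbit_pCons_0) simp
qed

lemma poly_orbit_linear_factor':
  "poly_orbit A ([:- l, 1:] * p) v = poly_orbit A p (A *v v - l *s v)"
proof -
  have "((*v) A ^^ i) (A *v v - l *s v) = A *v ((*v) A ^^ i) v - l *s ((*v) A ^^ i) v" for i
    by (induction i) (simp_all add: matrix_vector_mult_diff_distrib vec.scale)
  then have "poly_orbit A p (A *v v - l *s v) = A *v poly_orbit A p v - l *s poly_orbit A p v"
    by (simp add: poly_orbit_def vec.scale_right_diff_distrib sum_subtractf vec.scale
        vec.sum vec.scale_sum_right mult.commute)
  then show ?thesis by (simp only: poly_orbit_linear_factor)
qed

text \<open>The vectors \<open>A^i v\<close> for \<open>i \<le> N\<close>, where \<open>N\<close> is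
  the real dimension of the space, are one too many to be independent over the reals; a dependence
  gives the coefficients. If two of them coincide, the set is smaller, but then the difference of
  two monomials annihilates \<open>v\<close>.\<close>

lemma exists_annihilating_poly:
  fixes A :: "complex^'n^'n"
  obtains p where "p \<noteq> 0" "poly_orbit A p v = 0"
proof -
  define N where "N = DIM(complex^'n)"
  define w where "w i = ((*v) A ^^ i) v" for i
  show ?thesis
  proof (cases "inj_on w {..N}")
    case True
    then have "card (w ` {..N}) = Suc N" by (simp add: card_image)
    then have "dependent (w ` {..N})"
      using independent_bound[of "w ` {..N}"] by (auto simp: N_def)
    then obtain c where c: "(\<Sum>x\<in>w ` {..N}. c x *\<^sub>R x) = 0" "\<exists>x\<in>w ` {..N}. c x \<noteq> 0"
      by (auto simp: dependent_finite)
    define p where "p = Poly (map (\<lambda>i. complex_of_real (c (w i))) [0..<Suc N])"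
    have coeff: "coeff p i = (if i \<le> N then complex_of_real (c (w i)) else 0)" for i
      unfolding p_def by (simp add: nth_default_def del: upt_Suc)
    have "p \<noteq> 0" using c(2) coeff by (auto simp: poly_eq_iff)
    moreover have "degree p \<le> N" by (rule degree_le) (auto simp: coeff)
    then have "poly_orbit A p v = (\<Sum>i\<le>N. c (w i) *\<^sub>R w i)"
      by (simp add: poly_orbit_altdef coeff w_def[symmetric] vec_eq_iff scaleR_conv_of_real[where 'a = complex])
    then have "poly_orbit A p v = 0"
      using c(1) True by (simp add: sum.reindex)
    ultimately show ?thesis using that by blast
  next
    case False
    then obtain i j where ij: "i < j" "w i = w j"
      by (metis (mono_tags) inj_on_def linorder_neqE_nat)
    define p where "p = monom 1 j - monom (1 :: complex) i"
    have "coeff p j = 1" using ij by (simp add: p_def)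
    then have "p \<noteq> 0" by auto
    moreover have "degree p \<le> j" using ij by (intro degree_le) (auto simp: p_def)
    then have "poly_orbit A p v = (\<Sum>k\<le>j. (if k = j then w k else 0) - (if k = i then w k else 0))"
      by (simp add: poly_orbit_altdef w_def[symmetric]) (intro sum.cong, auto simp: p_def)
    then have "poly_orbit A p v = 0" using ij by (simp add: sum_subtractf)
    ultimately show ?thesis using that by blast
  qed
qed

text \<open>Take an annihilating polynomial of least degree. If it is \<open>(X - l) q\<close>, then
  \<open>q(A) v\<close> is nonzero by minimality and is killed by \<open>A - l\<close>, so it is an
  eigenvector for \<open>l\<close>.\<close>

lemma exists_annihilating_poly_eigenvalue_roots:
  fixes A :: "complex^'n^'n"
  obtains p where "p \<noteq> 0" "poly_orbit A p v = 0"
    "\<And>l. poly p l = 0 \<Longrightarrow> \<exists>w. w \<noteq> 0 \<and> A *v w = l *s w"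
proof -
  define P where "P p \<longleftrightarrow> p \<noteq> 0 \<and> poly_orbit A p v = 0" for p
  obtain p where p: "P p" "\<And>q. P q \<Longrightarrow> degree p \<le> degree q"
    using exists_annihilating_poly[of A v] ex_has_least_nat[of P _ degree] unfolding P_def by metis
  show ?thesis
  proof (rule that[of p])
    fix l assume "poly p l = 0"
    then obtain q where q: "p = [:- l, 1:] * q" by (auto simp: poly_eq_0_iff_dvd dvd_def)
    then have "q \<noteq> 0" using p(1) by (auto simp: P_def)
    then have "degree q < degree p" by (simp add: q degree_mult_eq del: mult_pCons_left)
    then have "poly_orbit A q v \<noteq> 0" using p(2)[of q] \<open>q \<noteq> 0\<close> by (auto simp: P_def)
    moreover have "A *v poly_orbit A q v = l *s poly_orbit A q v"
      using p(1) by (simp add: P_def q poly_orbit_linear_factor del: mult_pCons_left)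
    ultimately show "\<exists>w. w \<noteq> 0 \<and> A *v w = l *s w" by blast
  qed (use p in \<open>auto simp: P_def\<close>)
qed

text \<open>Duhamel along a factorisation of the annihilating polynomial: removing the root \<open>l\<close> replaces
  the solution \<open>u\<close> by \<open>u' - l u\<close>, which decays by induction.\<close>

lemma linear_ode_decay:
  fixes A :: "complex^'n^'n" and u :: "complex^'n \<Rightarrow> real \<Rightarrow> complex^'n"
  assumes deriv: "\<And>v t. (u v has_vector_derivative A *v u v t) (at t)"
    and lin: "\<And>v l t. u (A *v v - l *s v) t = A *v u v t - l *s u v t"
    and u0: "\<And>t. u 0 t = 0"
    and p: "p \<noteq> 0" "poly_orbit A p v = 0" "\<And>l. poly p l = 0 \<Longrightarrow> Re l < 0"
  shows "\<exists>K a. a > 0 \<and> (\<forall>t\<ge>0. norm (u v t) \<le> K * exp (- a * t))"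
  using p
proof (induction "degree p" arbitrary: p v)
  case 0
  then obtain c where "p = [:c:]" "c \<noteq> 0" by (metis degree_eq_zeroE pCons_0_0)
  then have "v = 0" using 0 by (simp add: poly_orbit_def)
  then show ?case using u0 by (intro exI[of _ 0] exI[of _ 1]) simp
next
  case (Suc d)
  then obtain l where l: "poly p l = 0" using fundamental_theorem_of_algebra_alt[of p] by fastforce
  then obtain q where q: "p = [:- l, 1:] * q" by (auto simp: poly_eq_0_iff_dvd dvd_def)
  have q0: "q \<noteq> 0" using Suc.prems(1) q by auto
  have "degree q = d" using Suc.hyps(2) q0 by (simp add: q degree_mult_eq del: mult_pCons_left)
  define w where "w = A *v v - l *s v"
  have "poly_orbit A q w = 0"
    using Suc.prems(2) unfolding q poly_orbit_linear_factor' w_def .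
  moreover have "Re z < 0" if "poly q z = 0" for z
    using that Suc.prems(3)[of z] by (simp add: q)
  ultimately obtain K a where K: "a > 0" "\<And>t. t \<ge> 0 \<Longrightarrow> norm (u w t) \<le> K * exp (- a * t)"
    using Suc.hyps(1)[of q w] \<open>degree q = d\<close> q0 by blast
  have K0: "K \<ge> 0" using K(2)[of 0] order_trans[OF norm_ge_zero] by fastforce
  define b where "b = - Re l"
  have b: "b > 0" using Suc.prems(3)[OF l] by (simp add: b_def)
  \<comment> \<open>The rate must lie strictly below \<open>b\<close>: at equality the integral of
    \<open>exp ((b - a) s)\<close> would grow linearly and spoil the bound.\<close>
  define a' where "a' = min a (b / 2)"
  have a': "a' > 0" "a' < b" "a' \<le> a" using b K(1) by (auto simp: a'_def)
  \<comment> \<open>Integrating factor for the root \<open>l\<close>: since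
    \<open>u w = u' - l u\<close>, the derivative of \<phi> is the integrating factor times
    \<open>u w\<close>, whose decay is known.\<close>
  define \<phi> where "\<phi> t = exp (- of_real t * l) *s u v t" for t :: real
  have norm_scal: "norm (c *s x) = norm c * norm x" for c and x :: "complex^'n"
    by (simp add: norm_vec_def L2_set_def norm_mult power_mult_distrib sum_distrib_left[symmetric] real_sqrt_mult)
  have d\<phi>: "(\<phi> has_vector_derivative exp (- of_real t * l) *s u w t) (at t)" for t
  proof -
    have bb: "bounded_bilinear ((*s) :: complex \<Rightarrow> complex^'n \<Rightarrow> complex^'n)"
      by (intro bounded_bilinear.intro exI[of _ 1])
        (auto simp: vec.scale_left_distrib vec.scale_right_distrib norm_scal vec_eq_iff)
    have e: "((\<lambda>t. exp (- of_real t * l)) has_vector_derivative (- l * exp (- of_real t * l))) (at t)"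
      by (rule has_vector_derivative_real_field) (auto intro!: derivative_eq_intros)
    have "(\<phi> has_vector_derivative exp (- of_real t * l) *s (A *v u v t)
        + (- l * exp (- of_real t * l)) *s u v t) (at t)"
      unfolding \<phi>_def[abs_def] by (rule bounded_bilinear.has_vector_derivative[OF bb e deriv])
    moreover have "exp (- of_real t * l) *s (A *v u v t) + (- l * exp (- of_real t * l)) *s u v t
        = exp (- of_real t * l) *s u w t"
      by (simp add: w_def lin vec_eq_iff algebra_simps)
    ultimately show ?thesis by simp
  qed
  have nexp: "norm (exp (- of_real t * l)) = exp (b * t)" for t :: real
    by (simp add: b_def)
  define K' where "K' = norm (u v 0) + K / (b - a')"
  have "norm (u v t) \<le> K' * exp (- a' * t)" if t: "t \<ge> 0" for t
  proof (cases "t = 0")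
    case True
    then show ?thesis using K0 a' by (simp add: K'_def)
  next
    case False
    define \<psi> where "\<psi> s = K / (b - a') * exp ((b - a') * s)" for s
    have "norm (\<phi> t - \<phi> 0) \<le> \<psi> t - \<psi> 0"
    proof (rule differentiable_bound_general)
      show "0 < t" using t False by simp
      show "continuous_on {0..t} \<phi>"
        using d\<phi> has_vector_derivative_continuous by (intro continuous_at_imp_continuous_on) blast
      show "continuous_on {0..t} \<psi>" unfolding \<psi>_def by (intro continuous_intros)
      show "(\<phi> has_vector_derivative exp (- of_real s * l) *s u w s) (at s)" for s by (rule d\<phi>)
      show "(\<psi> has_vector_derivative K * exp ((b - a') * s)) (at s)" for s
        unfolding \<psi>_def using a'
        by (auto intro!: derivative_eq_intros simp: has_real_derivative_iff_has_vector_derivative[symmetric])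
      show "norm (exp (- of_real s * l) *s u w s) \<le> K * exp ((b - a') * s)" if "0 < s" "s < t" for s
      proof -
        have "norm (exp (- of_real s * l) *s u w s) = exp (b * s) * norm (u w s)"
          by (simp only: norm_scal nexp)
        also have "\<dots> \<le> exp (b * s) * (K * exp (- a * s))"
          using that K(2)[of s] by (intro mult_left_mono) auto
        also have "\<dots> \<le> exp (b * s) * (K * exp (- a' * s))"
          using that a' K0 by (intro mult_left_mono) auto
        also have "\<dots> = K * exp ((b - a') * s)" by (simp add: exp_add[symmetric] algebra_simps)
        finally show ?thesis .
      qed
    qed
    moreover have "\<psi> 0 \<ge> 0" using K0 a' by (simp add: \<psi>_def)
    ultimately have "norm (\<phi> t) \<le> norm (\<phi> 0) + \<psi> t"
      using norm_triangle_sub[of "\<phi> t" "\<phi> 0"] by linarith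
    moreover have "norm (\<phi> t) = exp (b * t) * norm (u v t)" by (simp only: \<phi>_def norm_scal nexp)
    moreover have "norm (\<phi> 0) = norm (u v 0)" by (simp add: \<phi>_def norm_scal)
    moreover have "norm (u v 0) \<le> norm (u v 0) * exp ((b - a') * t)"
      using a' t mult_left_mono[of 1 "exp ((b - a') * t)" "norm (u v 0)"] by simp
    ultimately have "exp (b * t) * norm (u v t) \<le> K' * exp ((b - a') * t)"
      by (simp add: \<psi>_def K'_def algebra_simps)
    also have "\<dots> = exp (b * t) * (K' * exp (- a' * t))"
      by (simp add: exp_add[symmetric] algebra_simps)
    finally show ?thesis by simp
  qed
  then show ?case using a' by blast
qed

lemma matrix_exp_exponential_decay:
  fixes B :: "real^'n^'n"
  assumes "\<forall>z. complex_eigenvalue B z \<longrightarrow> Re z < 0"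
  obtains K a where "a > 0" "K \<ge> 0"
    "\<And>t. t \<ge> 0 \<Longrightarrow> norm (matrix_exp (t *\<^sub>R B)) \<le> K * exp (- a * t)"
proof -
  define C where "C = map_matrix complex_of_real B"
  define u where "u v t = map_matrix complex_of_real (matrix_exp (t *\<^sub>R B)) *v v" for v :: "complex^'n" and t
  have cmul: "map_matrix complex_of_real (X ** Y) = map_matrix complex_of_real X ** map_matrix complex_of_real Y"
    for X Y :: "real^'n^'n"
    by (simp add: map_matrix_def matrix_matrix_mult_def vec_eq_iff)
  have deriv: "(u v has_vector_derivative C *v u v t) (at t)" for v t
  proof -
    have "bounded_linear (\<lambda>X :: real^'n^'n. map_matrix complex_of_real X *v v)"
      unfolding linear_conv_bounded_linear[symmetric]
      by (auto intro!: linearI simp: map_matrix_def matrix_vector_mult_def vec_eq_iff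
          sum.distrib[symmetric] sum_distrib_left algebra_simps scaleR_conv_of_real[where 'a = complex])
    from bounded_linear.has_vector_derivative[OF this has_vector_derivative_matrix_exp[of B t]]
    show ?thesis
      by (simp add: u_def[abs_def] C_def cmul matrix_vector_mul_assoc)
  qed
  have lin: "u (C *v v - l *s v) t = C *v u v t - l *s u v t" for v l t
    by (simp add: u_def C_def matrix_vector_mult_diff_distrib matrix_vector_mul_assoc vec.scale
        cmul[symmetric] matrix_exp_commute)
  have dec: "\<exists>K a. a > 0 \<and> (\<forall>t\<ge>0. norm (u v t) \<le> K * exp (- a * t))" for v
  proof -
    obtain p where p: "p \<noteq> 0" "poly_orbit C p v = 0"
      "\<And>l. poly p l = 0 \<Longrightarrow> \<exists>w. w \<noteq> 0 \<and> C *v w = l *s w"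
      using exists_annihilating_poly_eigenvalue_roots[of C v] by blast
    have "Re l < 0" if "poly p l = 0" for l
      using p(3)[OF that] assms by (auto simp: complex_eigenvalue_def C_def)
    then show ?thesis
      by (intro linear_ode_decay[OF deriv lin _ p(1,2)]) (auto simp: u_def)
  qed
  then obtain K a where Ka: "\<And>v. a v > 0" "\<And>v t. t \<ge> 0 \<Longrightarrow> norm (u v t) \<le> K v * exp (- a v * t)"
    by metis
  \<comment> \<open>The rate depends on the vector, but the columns of the exponential are finitely
    many orbits, those of the unit vectors, so a smallest rate exists.\<close>
  define a0 where "a0 = Min (range (\<lambda>j. a (axis j 1)))"
  have a0: "a0 > 0" "\<And>j. a0 \<le> a (axis j 1)" using Ka(1) by (auto simp: a0_def)
  have K0: "K v \<ge> 0" for v using Ka(2)[of 0 v] order_trans[OF norm_ge_zero] by fastforce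
  show ?thesis
  proof (rule that[of a0 "\<Sum>i\<in>(UNIV :: 'n set). \<Sum>j\<in>UNIV. K (axis j 1)"])
    fix t :: real assume t: "t \<ge> 0"
    have entry: "\<bar>matrix_exp (t *\<^sub>R B) $ i $ j\<bar> \<le> K (axis j 1) * exp (- a0 * t)" for i j
    proof -
      have "\<bar>matrix_exp (t *\<^sub>R B) $ i $ j\<bar> = norm (u (axis j 1) t $ i)"
        by (simp add: u_def map_matrix_def matrix_vector_mult_def axis_def if_distrib cong: if_cong)
      also have "\<dots> \<le> K (axis j 1) * exp (- a (axis j 1) * t)"
        using Ka(2)[OF t] Finite_Cartesian_Product.norm_nth_le[of "u (axis j 1) t" i] order_trans by blast
      also have "\<dots> \<le> K (axis j 1) * exp (- a0 * t)"
        using a0 t K0 by (intro mult_left_mono) (auto intro: mult_right_mono)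
      finally show ?thesis .
    qed
    have "norm (matrix_exp (t *\<^sub>R B)) \<le> (\<Sum>i\<in>UNIV. norm (matrix_exp (t *\<^sub>R B) $ i))"
      unfolding norm_vec_def by (rule L2_set_le_sum) simp
    also have "\<dots> \<le> (\<Sum>i\<in>(UNIV :: 'n set). \<Sum>j\<in>(UNIV :: 'n set). K (axis j 1) * exp (- a0 * t))"
      by (intro sum_mono order_trans[OF norm_le_l1_cart] sum_mono entry)
    finally show "norm (matrix_exp (t *\<^sub>R B)) \<le> (\<Sum>i\<in>(UNIV :: 'n set). \<Sum>j\<in>UNIV. K (axis j 1)) * exp (- a0 * t)"
      by (simp add: sum_distrib_right mult.assoc)
  qed (use a0 K0 in \<open>auto intro!: sum_nonneg mult_nonneg_nonneg\<close>)
qed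

section \<open>Positive definite forms\<close>

lemma norm_matrix_vector_mult_le_norm:
  obtains K where "K > 0" "\<And>(A :: real^'n^'m) x. norm (A *v x) \<le> norm A * norm x * K"
  using bounded_bilinear.pos_bounded[OF bounded_bilinear_matrix_vector_mult] by blast

lemma inner_transpose_matrix: "(transpose A *v x) \<bullet> y = x \<bullet> (A *v (y :: real^'n))"
  by (metis dot_lmul_matrix transpose_matrix_vector)

lemma invertible_if_positive_form:
  fixes A :: "real^'n^'n"
  assumes "\<And>x. x \<noteq> 0 \<Longrightarrow> (A *v x) \<bullet> x > 0"
  shows "invertible A"
proof -
  have "A *v x = 0 \<Longrightarrow> x = 0" for x using assms[of x] by (cases "x = 0") auto
  then have "\<exists>B. B ** A = mat 1" by (simp add: matrix_left_invertible_ker)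
  then show ?thesis by (simp add: invertible_left_inverse)
qed

lemma matrix_inv_mult:
  fixes A :: "real^'n^'n"
  assumes "invertible A"
  shows "A ** matrix_inv A = mat 1" "matrix_inv A ** A = mat 1"
proof -
  have "A ** matrix_inv A = mat 1 \<and> matrix_inv A ** A = mat 1"
    using assms unfolding invertible_def matrix_inv_def by (rule someI_ex)
  then show "A ** matrix_inv A = mat 1" "matrix_inv A ** A = mat 1" by auto
qed

lemma matrix_inv_mult_vector:
  fixes A :: "real^'n^'n"
  assumes "invertible A"
  shows "A *v (matrix_inv A *v x) = x" "matrix_inv A *v (A *v x) = x"
  using matrix_inv_mult[OF assms] by (simp_all add: matrix_vector_mul_assoc)

text \<open>On the segment from the identity to \<open>A\<close> every form is positive, hence every
  matrix is invertible; the determinant starts at 1 and cannot change sign.\<close>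

lemma det_pos_if_positive_form:
  fixes A :: "real^'n^'n"
  assumes "\<And>x. x \<noteq> 0 \<Longrightarrow> (A *v x) \<bullet> x > 0"
  shows "det A > 0"
proof (rule ccontr)
  assume "\<not> det A > 0"
  define F where "F s = s *\<^sub>R A + (1 - s) *\<^sub>R (mat 1 :: real^'n^'n)" for s :: real
  have "continuous_on {0..1} (\<lambda>s. det (F s))"
    unfolding F_def det_def by (intro continuous_intros)
  moreover have "det (F 1) \<le> 0" "det (F 0) \<ge> 0" using \<open>\<not> det A > 0\<close> by (simp_all add: F_def)
  ultimately obtain s where s: "0 \<le> s" "s \<le> 1" "det (F s) = 0"
    using IVT2'[of "\<lambda>s. det (F s)" 1 0 0] by auto
  have "invertible (F s)"
  proof (rule invertible_if_positive_form)
    fix x :: "real^'n" assume x: "x \<noteq> 0"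
    have "(F s *v x) \<bullet> x = s * ((A *v x) \<bullet> x) + (1 - s) * (x \<bullet> x)"
      by (simp add: F_def matrix_vector_mult_add_rdistrib scaleR_matrix_vector_assoc[symmetric] inner_add_left)
    moreover have "\<dots> > 0"
    proof (cases "s = 0")
      case False
      then have "s * ((A *v x) \<bullet> x) > 0" using s assms[OF x] by simp
      moreover have "(1 - s) * (x \<bullet> x) \<ge> 0" using s by simp
      ultimately show ?thesis by linarith
    qed (use x in simp)
    ultimately show "(F s *v x) \<bullet> x > 0" by simp
  qed
  then show False using s by (simp add: invertible_det_nz)
qed

lemma continuous_on_det: "continuous_on S (det :: real^'n^'n \<Rightarrow> real)"
  unfolding det_def by (intro continuous_intros)

text \<open>The admissible matrices form a compact set on which the determinant is continuous and
  positive. The uniformity is what gives a bound independent of \<open>t\<close> for the normalised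
  covariance matrices.\<close>

lemma det_lower_bound:
  assumes "c > 0"
  obtains \<delta> where "\<delta> > 0"
    "\<And>A :: real^'n^'n. norm A \<le> M \<Longrightarrow> (\<And>x. c * (norm x)\<^sup>2 \<le> (A *v x) \<bullet> x) \<Longrightarrow> det A \<ge> \<delta>"
proof -
  define S where "S = {A :: real^'n^'n. norm A \<le> M \<and> (\<forall>x. c * (norm x)\<^sup>2 \<le> (A *v x) \<bullet> x)}"
  have pos: "det A > 0" if "A \<in> S" for A
  proof (rule det_pos_if_positive_form)
    fix x :: "real^'n" assume "x \<noteq> 0"
    then have "c * (norm x)\<^sup>2 > 0" using assms by simp
    then show "(A *v x) \<bullet> x > 0" using that by (auto simp: S_def intro: less_le_trans)
  qed
  have cont: "continuous_on UNIV (\<lambda>A :: real^'n^'n. (A *v x) \<bullet> x)" for x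
    by (intro continuous_intros bounded_linear.continuous_on[OF
        bounded_bilinear.bounded_linear_left[OF bounded_bilinear_matrix_vector_mult]])
  have "closed S"
    unfolding S_def by (intro closed_Collect_conj closed_Collect_all closed_Collect_le cont continuous_intros)
  moreover have "bounded S" unfolding bounded_iff S_def by auto
  ultimately have "compact S" by (simp add: compact_eq_bounded_closed)
  show ?thesis
  proof (cases "S = {}")
    case True
    then show ?thesis using that[of 1] by (auto simp: S_def)
  next
    case False
    obtain A0 where "A0 \<in> S" "\<And>A. A \<in> S \<Longrightarrow> det A0 \<le> det A"
      using continuous_attains_inf[OF \<open>compact S\<close> False continuous_on_det] by blast
    then show ?thesis using that[of "det A0"] pos by (auto simp: S_def)
  qed
qed

lemma positive_form_lower_bound:
  fixes A :: "real^'n^'n"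
  assumes "\<And>x. x \<noteq> 0 \<Longrightarrow> (A *v x) \<bullet> x > 0"
  obtains c where "c > 0" "\<And>x. c * (norm x)\<^sup>2 \<le> (A *v x) \<bullet> x"
proof -
  have "continuous_on (sphere 0 1) (\<lambda>x. (A *v x) \<bullet> x)"
    by (intro continuous_intros linear_continuous_on matrix_vector_mul_bounded_linear)
  moreover have "sphere (0 :: real^'n) 1 \<noteq> {}" by simp
  ultimately obtain x0 where x0: "x0 \<in> sphere 0 1"
    "\<And>x. x \<in> sphere 0 1 \<Longrightarrow> (A *v x0) \<bullet> x0 \<le> (A *v x) \<bullet> x"
    using continuous_attains_inf[OF compact_sphere] by blast
  show ?thesis
  proof (rule that[of "(A *v x0) \<bullet> x0"])
    have "x0 \<noteq> 0" using x0(1) by auto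
    then show "(A *v x0) \<bullet> x0 > 0" using assms by blast
    fix x :: "real^'n"
    show "(A *v x0) \<bullet> x0 * (norm x)\<^sup>2 \<le> (A *v x) \<bullet> x"
    proof (cases "x = 0")
      case False
      have "(A *v x0) \<bullet> x0 \<le> (A *v (x /\<^sub>R norm x)) \<bullet> (x /\<^sub>R norm x)"
        using False by (intro x0) (simp add: norm_sgn sgn_div_norm)
      also have "\<dots> = (A *v x) \<bullet> x / (norm x)\<^sup>2"
        by (simp add: matrix_vector_mult_scaleR power2_eq_square divide_inverse)
      finally show ?thesis using False by (simp add: field_simps)
    qed simp
  qed
qed

text \<open>The variational formula \<open>\<langle>A\<inverse> w, w\<rangle> = sup\<^sub>y 2 \<langle>w, y\<rangle> - \<langle>A y, y\<rangle>\<close>, tested with \<open>y = \<theta>\<inverse> C\<inverse> w\<close>.\<close>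

lemma inverse_form_antimono:
  fixes A C :: "real^'n^'n"
  assumes sym: "transpose A = A" and A: "\<And>x. x \<noteq> 0 \<Longrightarrow> (A *v x) \<bullet> x > 0"
    and C: "invertible C" and "\<theta> > 0"
    and le: "\<And>y. (A *v y) \<bullet> y \<le> \<theta> * ((C *v y) \<bullet> y)"
  shows "(matrix_inv C *v w) \<bullet> w \<le> \<theta> * ((matrix_inv A *v w) \<bullet> w)"
proof -
  define z where "z = matrix_inv A *v w"
  define v where "v = matrix_inv C *v w"
  define y where "y = (1 / \<theta>) *\<^sub>R v"
  have Az: "A *v z = w"
    using matrix_inv_mult_vector(1)[OF invertible_if_positive_form[of A]] A by (simp add: z_def)
  have Cv: "C *v v = w" using matrix_inv_mult_vector(1)[OF C] by (simp add: v_def)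
  \<comment> \<open>Completing the square around \<open>z\<close>, the inverse image of
    \<open>w\<close>; the two cross terms agree by symmetry of \<open>A\<close>.\<close>
  have "0 \<le> (A *v (y - z)) \<bullet> (y - z)"
    using A[of "y - z"] by (cases "y = z") auto
  also have "\<dots> = (A *v y) \<bullet> y - 2 * (w \<bullet> y) + z \<bullet> w"
  proof -
    have "(A *v y) \<bullet> z = w \<bullet> y"
      using inner_transpose_matrix[of A y z] sym Az by (simp add: inner_commute)
    then show ?thesis
      by (simp add: matrix_vector_mult_diff_distrib Az inner_diff_left inner_diff_right inner_commute)
  qed
  also have "(A *v y) \<bullet> y \<le> \<theta> * ((C *v y) \<bullet> y)" by (rule le)
  also have "(C *v y) \<bullet> y = (1 / \<theta>)\<^sup>2 * (v \<bullet> w)"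
    by (simp add: y_def matrix_vector_mult_scaleR Cv power2_eq_square inner_commute)
  also have "w \<bullet> y = (1 / \<theta>) * (v \<bullet> w)" by (simp add: y_def inner_commute)
  finally have "(1 / \<theta>) * (v \<bullet> w) \<le> z \<bullet> w"
    using \<open>\<theta> > 0\<close> by (simp add: power2_eq_square field_simps)
  then show ?thesis using \<open>\<theta> > 0\<close> by (simp add: v_def z_def field_simps)
qed

lemma set_integrable_exp_minus:
  assumes "a > 0"
  shows "set_integrable lborel {0..} (\<lambda>s. exp (- a * s :: real))"
proof -
  have "(\<lambda>s. exp (- a * s)) absolutely_integrable_on {0..}"
    using has_integral_exp_minus_to_infinity[OF assms, of 0]
    by (intro nonnegative_absolutely_integrable_1) (auto simp: has_integral_integrable)
  then show ?thesis
    unfolding set_integrable_def by (subst (asm) integrable_completion) auto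
qed

section \<open>Covariance matrices and the Mehler kernel\<close>

locale stable_pair =
  fixes Q B :: "real^'n^'n"
  assumes pos_def: "pos_def_matrix Q"
    and stable: "\<forall>z. complex_eigenvalue B z \<longrightarrow> Re z < 0"
begin

text \<open>This is the exponential of \<open>s\<close> times the adjoint of \<open>B\<close>. The
  integrand of \<open>Qt\<close> is the pullback of \<open>Q\<close> under it, and
  \<open>q y s\<close> is the value of that form at \<open>y\<close>.\<close>

definition flow :: "real \<Rightarrow> real^'n^'n" where
  "flow s = transpose (matrix_exp (s *\<^sub>R B))"

definition q :: "real^'n \<Rightarrow> real \<Rightarrow> real" where
  "q y s = (Q *v (flow s *v y)) \<bullet> (flow s *v y)"

lemma flow_altdef: "flow s = matrix_exp (s *\<^sub>R transpose B)"
  by (simp add: flow_def flip: matrix_exp_transpose transpose_scalar)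

lemma flow_add: "flow (s + t) = flow s ** flow t"
  by (simp add: flow_altdef matrix_exp_add)

lemma flow_add_vector: "flow s *v (flow t *v y) = flow (s + t) *v y"
  by (simp add: flow_add matrix_vector_mul_assoc)

lemma flow_0 [simp]: "flow 0 = mat 1"
  by (simp add: flow_altdef)

lemma continuous_on_flow: "continuous_on S flow"
  unfolding flow_altdef[abs_def] by (rule continuous_on_matrix_exp)

lemma norm_flow_decay:
  obtains K a where "a > 0" "K \<ge> 0" "\<And>t. t \<ge> 0 \<Longrightarrow> norm (flow t) \<le> K * exp (- a * t)"
proof -
  obtain L where L: "\<And>A :: real^'n^'n. norm (transpose A) \<le> norm A * L" "L > 0"
    using bounded_linear.pos_bounded[OF bounded_linear_transpose] by blast
  obtain K a where K: "a > 0" "K \<ge> 0" "\<And>t. t \<ge> 0 \<Longrightarrow> norm (matrix_exp (t *\<^sub>R B)) \<le> K * exp (- a * t)"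
    using matrix_exp_exponential_decay[OF stable] by blast
  show ?thesis
  proof (rule that[of a "K * L"])
    fix t :: real assume "t \<ge> 0"
    have "norm (flow t) \<le> norm (matrix_exp (t *\<^sub>R B)) * L" unfolding flow_def by (rule L)
    also have "\<dots> \<le> (K * exp (- a * t)) * L"
      using K(3)[OF \<open>t \<ge> 0\<close>] L(2) by (intro mult_right_mono) auto
    finally show "norm (flow t) \<le> K * L * exp (- a * t)" by (simp add: mult_ac)
  qed (use K L in auto)
qed

lemma norm_flow_bounded_below_time:
  obtains M where "M > 0" "\<And>s. s \<ge> - T \<Longrightarrow> norm (flow s) \<le> M"
proof -
  obtain K a where K: "a > 0" "K \<ge> 0" "\<And>t. t \<ge> 0 \<Longrightarrow> norm (flow t) \<le> K * exp (- a * t)"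
    using norm_flow_decay by blast
  have "compact (flow ` {- T..0})" by (intro compact_continuous_image continuous_on_flow) auto
  then obtain N where N: "\<And>s. s \<in> {- T..0} \<Longrightarrow> norm (flow s) \<le> N"
    by (meson bounded_iff compact_imp_bounded imageI)
  show ?thesis
  proof (rule that[of "\<bar>N\<bar> + K + 1"])
    fix s assume "s \<ge> - T"
    show "norm (flow s) \<le> \<bar>N\<bar> + K + 1"
    proof (cases "s \<ge> 0")
      case True
      then have "norm (flow s) \<le> K * 1"
        using K(3)[OF True] K(1,2) mult_left_mono[of "exp (- a * s)" 1 K] by simp
      then show ?thesis by simp
    next
      case False
      then show ?thesis using N[of s] \<open>s \<ge> - T\<close> K(2) by simp
    qed
  qed (use K in simp)
qed

text \<open>Decay makes the upper bound hold for all times above \<open>- T\<close>. Applied at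
  \<open>- s\<close> to \<open>flow s *v y\<close>, it turns into the lower bound, which thus holds
  for all times below \<open>T\<close>.\<close>

lemma flow_vector_bounds:
  obtains M where "M > 0" "\<And>s y. s \<ge> - T \<Longrightarrow> norm (flow s *v y) \<le> M * norm y"
    "\<And>s y. s \<le> T \<Longrightarrow> norm y \<le> M * norm (flow s *v y)"
proof -
  obtain K where K: "K > 0" "\<And>(A :: real^'n^'n) x. norm (A *v x) \<le> norm A * norm x * K"
    using norm_matrix_vector_mult_le_norm by blast
  obtain N where N: "N > 0" "\<And>s. s \<ge> - T \<Longrightarrow> norm (flow s) \<le> N"
    using norm_flow_bounded_below_time[of T] by blast
  have up: "norm (flow s *v y) \<le> N * K * norm y" if "s \<ge> - T" for s y
  proof -
    have "norm (flow s *v y) \<le> norm (flow s) * norm y * K" by (rule K)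
    also have "\<dots> \<le> N * norm y * K"
      using N(2)[OF that] K(1) by (intro mult_right_mono) auto
    finally show ?thesis by (simp add: mult_ac)
  qed
  show ?thesis
  proof (rule that[of "N * K"])
    show "norm y \<le> N * K * norm (flow s *v y)" if "s \<le> T" for s y
      using up[of "- s" "flow s *v y"] that by (simp add: flow_add_vector)
  qed (use up N K in auto)
qed

lemma Q_form_bounds:
  obtains c C where "c > 0" "C > 0" "\<And>x. c * (norm x)\<^sup>2 \<le> (Q *v x) \<bullet> x"
    "\<And>x. (Q *v x) \<bullet> x \<le> C * (norm x)\<^sup>2"
proof -
  obtain c where c: "c > 0" "\<And>x. c * (norm x)\<^sup>2 \<le> (Q *v x) \<bullet> x"
    using positive_form_lower_bound[of Q] pos_def by (auto simp: pos_def_matrix_def)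
  obtain K where K: "K > 0" "\<And>(A :: real^'n^'n) x. norm (A *v x) \<le> norm A * norm x * K"
    using norm_matrix_vector_mult_le_norm by blast
  have "(Q *v x) \<bullet> x \<le> (norm Q * K + 1) * (norm x)\<^sup>2" for x
  proof -
    have "(Q *v x) \<bullet> x \<le> norm (Q *v x) * norm x" by (rule norm_cauchy_schwarz)
    also have "\<dots> \<le> (norm Q * norm x * K) * norm x" by (intro mult_right_mono K) simp
    also have "\<dots> \<le> (norm Q * K + 1) * (norm x)\<^sup>2" by (simp add: power2_eq_square algebra_simps)
    finally show ?thesis .
  qed
  moreover have "norm Q * K + 1 > 0" using K(1) by (simp add: add_nonneg_pos)
  ultimately show ?thesis using that c by blast
qed

lemma q_bounds:
  obtains c C where "c > 0" "C > 0" "\<And>s y. s \<le> T \<Longrightarrow> c * (norm y)\<^sup>2 \<le> q y s"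
    "\<And>s y. s \<ge> - T \<Longrightarrow> q y s \<le> C * (norm y)\<^sup>2"
proof -
  obtain M where M: "M > 0" "\<And>s y. s \<ge> - T \<Longrightarrow> norm (flow s *v y) \<le> M * norm y"
    "\<And>s y. s \<le> T \<Longrightarrow> norm y \<le> M * norm (flow s *v y)"
    using flow_vector_bounds by blast
  obtain c C where c: "c > 0" "C > 0" "\<And>x. c * (norm x)\<^sup>2 \<le> (Q *v x) \<bullet> x"
    "\<And>x. (Q *v x) \<bullet> x \<le> C * (norm x)\<^sup>2"
    using Q_form_bounds by blast
  show ?thesis
  proof (rule that[of "c / M\<^sup>2" "C * M\<^sup>2"])
    show "c / M\<^sup>2 * (norm y)\<^sup>2 \<le> q y s" if "s \<le> T" for s y
    proof -
      have "(norm y)\<^sup>2 \<le> (M * norm (flow s *v y))\<^sup>2" using M(3)[OF that] by (intro power_mono) auto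
      then have "c / M\<^sup>2 * (norm y)\<^sup>2 \<le> c / M\<^sup>2 * (M * norm (flow s *v y))\<^sup>2"
        using c by (intro mult_left_mono) auto
      also have "\<dots> = c * (norm (flow s *v y))\<^sup>2" using M(1) by (simp add: power_mult_distrib)
      also have "\<dots> \<le> q y s" unfolding q_def by (rule c)
      finally show ?thesis .
    qed
    show "q y s \<le> C * M\<^sup>2 * (norm y)\<^sup>2" if "s \<ge> - T" for s y
    proof -
      have "q y s \<le> C * (norm (flow s *v y))\<^sup>2" unfolding q_def by (rule c)
      also have "\<dots> \<le> C * (M * norm y)\<^sup>2"
        using M(2)[OF that] c by (intro mult_left_mono power_mono) auto
      finally show ?thesis by (simp add: power_mult_distrib mult_ac)
    qed
  qed (use c M in auto)
qed

lemma q_nonneg: "q y s \<ge> 0"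
  using pos_def unfolding q_def pos_def_matrix_def
  by (cases "flow s *v y = 0") (auto intro: less_imp_le)

lemma q_flow: "q (flow h *v y) s = q y (s + h)"
  by (simp add: q_def flow_add_vector)

section \<open>Quadratic forms of the covariance matrices as time integrals\<close>

definition integrand :: "real \<Rightarrow> real^'n^'n" where
  "integrand s = transpose (flow s) ** Q ** flow s"

lemma integrand_form: "(integrand s *v y) \<bullet> y = q y s"
  by (simp add: integrand_def q_def matrix_vector_mul_assoc[symmetric] inner_transpose_matrix
      del: transpose_matrix_vector)

lemma continuous_on_integrand: "continuous_on S integrand"
  unfolding integrand_def
  by (intro bounded_bilinear.continuous_on[OF bounded_bilinear_matrix_matrix_mult]
      bounded_linear.continuous_on[OF bounded_linear_transpose] continuous_on_flow continuous_intros)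

lemma Qt_eq: "Qt Q B t = (LINT s:{s. 0 \<le> s \<and> ereal s \<le> t}|lborel. integrand s)"
  by (simp add: Qt_def integrand_def flow_altdef matrix_exp_transpose[symmetric] transpose_scalar)

lemma set_integrable_integrand: "set_integrable lborel {0..} integrand"
proof -
  obtain K a where K: "a > 0" "K \<ge> 0" "\<And>t. t \<ge> 0 \<Longrightarrow> norm (flow t) \<le> K * exp (- a * t)"
    using norm_flow_decay by blast
  obtain L where L: "L > 0" "\<And>(X :: real^'n^'n) (Y :: real^'n^'n). norm (X ** Y) \<le> norm X * norm Y * L"
    using bounded_bilinear.pos_bounded[OF bounded_bilinear_matrix_matrix_mult] by blast
  obtain M where M: "M > 0" "\<And>s. s \<ge> - 0 \<Longrightarrow> norm (flow s) \<le> M"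
    using norm_flow_bounded_below_time[of 0] by blast
  obtain N where N: "\<And>A :: real^'n^'n. norm (transpose A) \<le> norm A * N" "N > 0"
    using bounded_linear.pos_bounded[OF bounded_linear_transpose] by blast
  define C where "C = M * N * norm Q * L * K * L"
  have bound: "norm (integrand s) \<le> C * exp (- a * s)" if "s \<ge> 0" for s
  proof -
    have "norm (integrand s) \<le> norm (transpose (flow s) ** Q) * norm (flow s) * L"
      unfolding integrand_def by (rule L)
    also have "\<dots> \<le> (norm (transpose (flow s)) * norm Q * L) * norm (flow s) * L"
      using L by (intro mult_right_mono L) auto
    also have "\<dots> \<le> ((M * N) * norm Q * L) * (K * exp (- a * s)) * L"
    proof -
      have "norm (transpose (flow s)) \<le> M * N"
        using N(1)[of "flow s"] M(2)[of s] that N(2) mult_right_mono[of "norm (flow s)" M N] by linarith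
      then show ?thesis
        using K(2) K(3)[of s] that L M N by (intro mult_right_mono mult_mono mult_nonneg_nonneg) auto
    qed
    finally show ?thesis by (simp add: C_def mult_ac)
  qed
  have "set_integrable lborel {0..} (\<lambda>s. C * exp (- a * s))"
    using set_integrable_exp_minus by (simp add: K(1))
  then show ?thesis
  proof (rule set_integrable_bound)
    show "set_borel_measurable lborel {0..} integrand"
      unfolding set_borel_measurable_def
      using borel_measurable_continuous_onI[OF continuous_on_integrand] by simp
    show "AE s in lborel. s \<in> {0..} \<longrightarrow> norm (integrand s) \<le> norm (C * exp (- a * s))"
      using bound by (auto simp: abs_le_iff intro!: AE_I2 order_trans[OF bound])
  qed
qed

lemma set_integrable_integrand_subset: "A \<in> sets borel \<Longrightarrow> A \<subseteq> {0..} \<Longrightarrow> set_integrable lborel A integrand"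
  by (rule set_integrable_subset[OF set_integrable_integrand]) auto

lemma time_domain: "{s. 0 \<le> s \<and> ereal s \<le> t} \<in> sets borel" "{s. 0 \<le> s \<and> ereal s \<le> t} \<subseteq> {0..}"
  by auto

lemma bounded_linear_form: "bounded_linear (\<lambda>A :: real^'n^'n. (A *v y) \<bullet> y)"
  by (intro bounded_linear_inner_left_comp bounded_bilinear.bounded_linear_left[OF bounded_bilinear_matrix_vector_mult])

lemma set_integrable_q: "A \<in> sets borel \<Longrightarrow> A \<subseteq> {0..} \<Longrightarrow> set_integrable lborel A (q y)"
  using integrable_bounded_linear[OF bounded_linear_form, of lborel "\<lambda>s. indicator A s *\<^sub>R integrand s" y]
    set_integrable_integrand_subset[of A]
  by (simp add: set_integrable_def scaleR_matrix_vector_assoc[symmetric] integrand_form)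

lemma Qt_form: "(Qt Q B t *v y) \<bullet> y = (LINT s:{s. 0 \<le> s \<and> ereal s \<le> t}|lborel. q y s)"
  using integral_bounded_linear[OF bounded_linear_form, of lborel
      "\<lambda>s. indicator {s. 0 \<le> s \<and> ereal s \<le> t} s *\<^sub>R integrand s" y]
    set_integrable_integrand_subset[OF time_domain, of t]
  by (simp add: set_integrable_def set_lebesgue_integral_def Qt_eq scaleR_matrix_vector_assoc[symmetric] integrand_form)

lemma Qt_form_finite: "(Qt Q B (ereal t) *v y) \<bullet> y = (LINT s:{0..t}|lborel. q y s)"
  unfolding Qt_form by (rule arg_cong[where f = "\<lambda>A. LINT s:A|lborel. q y s"]) auto

lemma Qinf_form: "(Qinf Q B *v y) \<bullet> y = (LINT s:{0..}|lborel. q y s)"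
  unfolding Qt_form by (rule arg_cong[where f = "\<lambda>A. LINT s:A|lborel. q y s"]) auto

lemma transpose_Qt: "transpose (Qt Q B t) = Qt Q B t"
proof -
  have "transpose (integrand s) = integrand s" for s
    using pos_def by (simp add: integrand_def pos_def_matrix_def matrix_transpose_mul matrix_mul_assoc)
  then show ?thesis
    using integral_bounded_linear[OF bounded_linear_transpose, of lborel
      "\<lambda>s. indicator {s. 0 \<le> s \<and> ereal s \<le> t} s *\<^sub>R integrand s"]
    set_integrable_integrand_subset[OF time_domain, of t]
    by (simp add: set_integrable_def set_lebesgue_integral_def Qt_eq transpose_scalar)
qed

text \<open>For times in \<open>[0, 1]\<close> the integrand is comparable with the identity, so
  \<open>Qt\<close> is comparable with \<open>t\<close> times the identity.\<close>

lemma Qt_bounds: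
  obtains c C where "c > 0" "C > 0"
    "\<And>t y. 0 < t \<Longrightarrow> t \<le> 1 \<Longrightarrow> c * t * (norm y)\<^sup>2 \<le> (Qt Q B (ereal t) *v y) \<bullet> y"
    "\<And>t y. 0 < t \<Longrightarrow> t \<le> 1 \<Longrightarrow> (Qt Q B (ereal t) *v y) \<bullet> y \<le> C * t * (norm y)\<^sup>2"
    "\<And>t. 0 < t \<Longrightarrow> t \<le> 1 \<Longrightarrow> norm (Qt Q B (ereal t)) \<le> C * t"
proof -
  obtain c C where c: "c > 0" "C > 0" "\<And>s y. s \<le> 1 \<Longrightarrow> c * (norm y)\<^sup>2 \<le> q y s"
    "\<And>s y. s \<ge> - 1 \<Longrightarrow> q y s \<le> C * (norm y)\<^sup>2"
    using q_bounds[of 1] by blast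
  have "compact (integrand ` {0..1})" by (intro compact_continuous_image continuous_on_integrand) auto
  then obtain N where N: "\<And>s. s \<in> {0..1} \<Longrightarrow> norm (integrand s) \<le> N"
    by (meson bounded_iff compact_imp_bounded imageI)
  have const: "(LINT s:{0..t}|lborel. k) = k * t" if "0 < t" for k t :: real
    using that by (simp add: set_lebesgue_integral_def)
  have ci: "set_integrable lborel {0..t} (\<lambda>_. k)" for k t :: real
    by (simp add: set_integrable_def integrable_real_indicator emeasure_lborel_Icc_eq)
  define D where "D = max C N"
  show ?thesis
  proof (rule that[of c D])
    fix t :: real assume t: "0 < t" "t \<le> 1"
    show "c * t * (norm y)\<^sup>2 \<le> (Qt Q B (ereal t) *v y) \<bullet> y" for y
      using set_integral_mono[OF ci[of t "c * (norm y)\<^sup>2"] set_integrable_q[of "{0..t}" y]] t c(3)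
      by (simp add: Qt_form_finite const mult_ac)
    have "(Qt Q B (ereal t) *v y) \<bullet> y \<le> C * t * (norm y)\<^sup>2" for y
      using set_integral_mono[OF set_integrable_q[of "{0..t}" y] ci[of t "C * (norm y)\<^sup>2"]] t c(4)
      by (simp add: Qt_form_finite const mult_ac)
    also have "C * t * (norm y)\<^sup>2 \<le> D * t * (norm y)\<^sup>2" for y
      using t by (intro mult_right_mono) (auto simp: D_def)
    finally show "(Qt Q B (ereal t) *v y) \<bullet> y \<le> D * t * (norm y)\<^sup>2" for y .
    have "Qt Q B (ereal t) = (LINT s:{0..t}|lborel. integrand s)"
      unfolding Qt_eq by (rule arg_cong[where f = "\<lambda>A. LINT s:A|lborel. integrand s"]) auto
    then have "norm (Qt Q B (ereal t)) \<le> (LINT s:{0..t}|lborel. norm (integrand s))"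
      using set_integral_norm_bound[OF set_integrable_integrand_subset[of "{0..t}"]] by simp
    also have "\<dots> \<le> (LINT s:{0..t}|lborel. N)"
      using t N by (intro set_integral_mono ci set_integrable_norm set_integrable_integrand_subset) auto
    also have "\<dots> \<le> D * t" using t by (simp add: const D_def)
    finally show "norm (Qt Q B (ereal t)) \<le> D * t" .
  qed (use c in \<open>auto simp: D_def\<close>)
qed

text \<open>The difference integrates \<open>q y\<close> over the times after \<open>t\<close>. For
  every \<open>t \<le> 1\<close> these contain \<open>{1<..2}\<close>, an interval of length one
  that does not depend on \<open>t\<close>.\<close>

lemma Qinf_Qt_gap:
  obtains c where "c > 0"
    "\<And>t y. t \<le> 1 \<Longrightarrow> c * (norm y)\<^sup>2 \<le> (Qinf Q B *v y) \<bullet> y - (Qt Q B (ereal t) *v y) \<bullet> y"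
proof -
  obtain c C where c: "c > 0" "C > 0" "\<And>s y. s \<le> 2 \<Longrightarrow> c * (norm y)\<^sup>2 \<le> q y s"
    "\<And>s y. s \<ge> - 2 \<Longrightarrow> q y s \<le> C * (norm y)\<^sup>2"
    using q_bounds[of 2] by blast
  show ?thesis
  proof (rule that[OF c(1)])
    fix t :: real and y :: "real^'n" assume t: "t \<le> 1"
    have i1: "integrable lborel (\<lambda>s. indicator {0..t} s * q y s)"
      using set_integrable_q[of "{0..t}" y] by (auto simp: set_integrable_def)
    have i2: "integrable lborel (\<lambda>s :: real. indicator {1<..2} s * (c * (norm y)\<^sup>2))"
      by (intro integrable_mult_left integrable_real_indicator) auto
    have i3: "integrable lborel (\<lambda>s. indicator {0..} s * q y s)"
      using set_integrable_q[of "{0..}" y] by (auto simp: set_integrable_def)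
    have "(LINT s|lborel. indicator {0..t} s * q y s + indicator {1<..2} s * (c * (norm y)\<^sup>2))
        \<le> (LINT s|lborel. indicator {0..} s * q y s)"
      using t c(3)[of _ y] q_nonneg[of y]
      by (intro integral_mono Bochner_Integration.integrable_add i1 i2 i3) (auto simp: indicator_def)
    then show "c * (norm y)\<^sup>2 \<le> (Qinf Q B *v y) \<bullet> y - (Qt Q B (ereal t) *v y) \<bullet> y"
      using i1 i2 by (simp add: Qinf_form Qt_form_finite set_lebesgue_integral_def)
  qed
qed

lemma Qt_0: "Qt Q B 0 = 0"
proof -
  have "{s. 0 \<le> s \<and> ereal s \<le> 0} = {0}" by auto
  then have "Qt Q B 0 = (LINT s:{0}|lborel. integrand s)" by (simp add: Qt_eq)
  also have "\<dots> = 0"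
    unfolding set_lebesgue_integral_def
  proof (rule integral_eq_zero_AE)
    show "AE s in lborel. indicator {0 :: real} s *\<^sub>R integrand s = 0"
      using AE_lborel_singleton[of 0] by eventually_elim auto
  qed
  finally show ?thesis .
qed

lemma Qinf_bounds:
  obtains c C where "c > 0" "C > 0" "\<And>y. c * (norm y)\<^sup>2 \<le> (Qinf Q B *v y) \<bullet> y"
    "\<And>y. (Qinf Q B *v y) \<bullet> y \<le> C * (norm y)\<^sup>2"
proof -
  obtain c where c: "c > 0"
    "\<And>t y. t \<le> 1 \<Longrightarrow> c * (norm y)\<^sup>2 \<le> (Qinf Q B *v y) \<bullet> y - (Qt Q B (ereal t) *v y) \<bullet> y"
    using Qinf_Qt_gap by blast
  obtain K where K: "K > 0" "\<And>(A :: real^'n^'n) x. norm (A *v x) \<le> norm A * norm x * K"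
    using norm_matrix_vector_mult_le_norm by blast
  have "(Qinf Q B *v x) \<bullet> x \<le> (norm (Qinf Q B) * K + 1) * (norm x)\<^sup>2" for x
  proof -
    have "(Qinf Q B *v x) \<bullet> x \<le> norm (Qinf Q B *v x) * norm x" by (rule norm_cauchy_schwarz)
    also have "\<dots> \<le> (norm (Qinf Q B) * norm x * K) * norm x" by (intro mult_right_mono K) simp
    also have "\<dots> \<le> (norm (Qinf Q B) * K + 1) * (norm x)\<^sup>2" by (simp add: power2_eq_square algebra_simps)
    finally show ?thesis .
  qed
  moreover have "norm (Qinf Q B) * K + 1 > 0" using K(1) by (simp add: add_nonneg_pos)
  \<comment> \<open>At \<open>t = 0\<close> the gap is the whole form of \<open>Qinf\<close>,
    because \<open>Qt\<close> vanishes there.\<close>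
  moreover have "c * (norm y)\<^sup>2 \<le> (Qinf Q B *v y) \<bullet> y" for y
    using c(2)[of 0 y] Qt_0 by (simp add: zero_ereal_def)
  ultimately show ?thesis using that c(1) by blast
qed

lemma Qinf_pos: "y \<noteq> 0 \<Longrightarrow> (Qinf Q B *v y) \<bullet> y > 0"
proof -
  assume "y \<noteq> 0"
  obtain c C where c: "c > 0" "C > 0" "\<And>y. c * (norm y)\<^sup>2 \<le> (Qinf Q B *v y) \<bullet> y"
    "\<And>y. (Qinf Q B *v y) \<bullet> y \<le> C * (norm y)\<^sup>2"
    using Qinf_bounds by blast
  have "0 < c * (norm y)\<^sup>2" using c(1) \<open>y \<noteq> 0\<close> by simp
  then show ?thesis using c(3)[of y] by linarith
qed

text \<open>By the group law, replacing \<open>y\<close> by \<open>flow (- h) *v y\<close> moves the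
  start of the time integral from 0 to \<open>- h\<close>. The added interval has length
  \<open>h\<close>, and on negative times \<open>q y\<close> is at least \<open>c\<close> times the
  squared norm of \<open>y\<close>.\<close>

lemma Qinf_growth:
  obtains a where "a > 0" "\<And>h y. h \<ge> 0 \<Longrightarrow>
    (1 + a * h) * ((Qinf Q B *v y) \<bullet> y) \<le> (Qinf Q B *v (flow (- h) *v y)) \<bullet> (flow (- h) *v y)"
proof -
  obtain c C' where c: "c > 0" "C' > 0" "\<And>s y. s \<le> 0 \<Longrightarrow> c * (norm y)\<^sup>2 \<le> q y s"
    "\<And>s y. s \<ge> - 0 \<Longrightarrow> q y s \<le> C' * (norm y)\<^sup>2"
    using q_bounds[of 0] by blast
  obtain c' C where C: "c' > 0" "C > 0" "\<And>y. c' * (norm y)\<^sup>2 \<le> (Qinf Q B *v y) \<bullet> y"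
    "\<And>y. (Qinf Q B *v y) \<bullet> y \<le> C * (norm y)\<^sup>2"
    using Qinf_bounds by blast
  show ?thesis
  proof (rule that[of "c / C"])
    fix h :: real and y :: "real^'n" assume h: "h \<ge> 0"
    have i1: "integrable lborel (\<lambda>s. indicator {0..} s * q (flow (- h) *v y) s)"
      using set_integrable_q[of "{0..}" "flow (- h) *v y"] by (auto simp: set_integrable_def)
    have sh: "indicator {0..} (h + 1 * s) * q (flow (- h) *v y) (h + 1 * s) = indicator {- h..} s * q y s" for s :: real
      by (auto simp: q_flow indicator_def)
    have i2: "integrable lborel (\<lambda>s. indicator {- h..} s * q y s)"
      using lborel_integrable_real_affine[OF i1, of 1 h] by (simp only: sh)
    have i3: "integrable lborel (\<lambda>s :: real. indicator {- h..<0} s * (c * (norm y)\<^sup>2))"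
      using h by (intro integrable_mult_left integrable_real_indicator) auto
    have i4: "integrable lborel (\<lambda>s. indicator {0..} s * q y s)"
      using set_integrable_q[of "{0..}" y] by (auto simp: set_integrable_def)
    have "(1 + c / C * h) * ((Qinf Q B *v y) \<bullet> y) \<le> (Qinf Q B *v y) \<bullet> y + h * (c * (norm y)\<^sup>2)"
    proof -
      have "c / C * h * ((Qinf Q B *v y) \<bullet> y) \<le> c / C * h * (C * (norm y)\<^sup>2)"
        using c C h by (intro mult_left_mono) auto
      then show ?thesis using C by (simp add: algebra_simps)
    qed
    also have "\<dots> = (LINT s|lborel. indicator {0..} s * q y s + indicator {- h..<0} s * (c * (norm y)\<^sup>2))"
      using i3 i4 h by (simp add: Qinf_form set_lebesgue_integral_def)
    also have "\<dots> \<le> (LINT s|lborel. indicator {- h..} s * q y s)"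
      using h c(3)[of _ y]
      by (intro integral_mono Bochner_Integration.integrable_add i2 i3 i4) (auto simp: indicator_def)
    also have "\<dots> = (LINT s|lborel. indicator {0..} s * q (flow (- h) *v y) s)"
      using lborel_integral_real_affine[of 1 "\<lambda>s. indicator {0..} s * q (flow (- h) *v y) s" h]
      by (simp only: sh) simp
    also have "\<dots> = (Qinf Q B *v (flow (- h) *v y)) \<bullet> (flow (- h) *v y)"
      by (simp add: Qinf_form set_lebesgue_integral_def)
    finally show "(1 + c / C * h) * ((Qinf Q B *v y) \<bullet> y) \<le> (Qinf Q B *v (flow (- h) *v y)) \<bullet> (flow (- h) *v y)" .
  qed (use c C in auto)
qed

end

lemma det_scaleR: "det (t *\<^sub>R A) = t ^ CARD('n) * det (A :: real^'n^'n)"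
proof -
  have "det (t *\<^sub>R A) = det (\<chi> i. t *s (A $ i))"
    by (rule arg_cong[where f = det]) (simp add: vec_eq_iff)
  then show ?thesis using det_rows_mul[of "\<lambda>_. t" "\<lambda>i. A $ i"] by simp
qed

section \<open>The flow \<open>Dt\<close>, the form \<open>R\<close> and Gaussian bounds for the
  Mehler kernel\<close>

context stable_pair
begin

lemma Qinf_invertible: "invertible (Qinf Q B)"
  by (rule invertible_if_positive_form) (rule Qinf_pos)

lemma Dt_eq: "Dt Q B t = Qinf Q B ** flow (- t) ** matrix_inv (Qinf Q B)"
  by (simp add: Dt_def flow_altdef)

lemma Dt_0: "Dt Q B 0 = mat 1"
  by (simp add: Dt_eq matrix_inv_mult Qinf_invertible)

lemma Dt_add: "Dt Q B (s + t) = Dt Q B s ** Dt Q B t"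
proof -
  have "Dt Q B s ** Dt Q B t
      = Qinf Q B ** flow (- s) ** (matrix_inv (Qinf Q B) ** Qinf Q B) ** flow (- t) ** matrix_inv (Qinf Q B)"
    by (simp only: Dt_eq matrix_mul_assoc)
  also have "\<dots> = Qinf Q B ** (flow (- s) ** flow (- t)) ** matrix_inv (Qinf Q B)"
    by (simp add: matrix_inv_mult Qinf_invertible matrix_mul_assoc)
  also have "flow (- s) ** flow (- t) = flow (- (s + t))"
    using flow_add[of "- s" "- t"] by simp
  finally show ?thesis by (simp add: Dt_eq)
qed

lemma continuous_on_Dt: "continuous_on S (Dt Q B)"
  unfolding Dt_eq[abs_def]
  by (intro bounded_bilinear.continuous_on[OF bounded_bilinear_matrix_matrix_mult]
      continuous_on_const continuous_on_compose2[OF continuous_on_flow[of UNIV]] continuous_intros) auto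

text \<open>Conjugation by \<open>Qinf\<close> reduces this to the mean value inequality for
  \<open>flow\<close> on \<open>[-1, 1]\<close>.\<close>

lemma Dt_lipschitz:
  obtains M where "M > 0" "\<And>t x. \<bar>t\<bar> \<le> 1 \<Longrightarrow> norm (Dt Q B t *v x - x) \<le> M * \<bar>t\<bar> * norm x"
proof -
  have "compact ((\<lambda>t. transpose B ** flow t) ` {- 1..1})"
    by (intro compact_continuous_image bounded_bilinear.continuous_on[OF bounded_bilinear_matrix_matrix_mult]
      continuous_on_const continuous_on_flow) auto
  then obtain N where N: "\<And>s. s \<in> {- 1..1} \<Longrightarrow> norm (transpose B ** flow s) \<le> N"
    by (meson bounded_iff compact_imp_bounded imageI)
  have lip: "norm (flow t - flow 0) \<le> N * norm (t - 0)" if "\<bar>t\<bar> \<le> 1" for t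
  proof (rule differentiable_bound)
    show "convex {- 1..1 :: real}" by simp
    show "(flow has_derivative (\<lambda>h. h *\<^sub>R (transpose B ** flow s))) (at s within {- 1..1})" for s
      using has_vector_derivative_matrix_exp[of "transpose B" s]
      unfolding flow_altdef[abs_def] has_vector_derivative_def by (rule has_derivative_at_withinI)
    show "onorm (\<lambda>h. h *\<^sub>R (transpose B ** flow s)) \<le> N" if "s \<in> {- 1..1}" for s
      using N[OF that] by (intro onorm_le) (simp add: mult.commute[of N] mult_left_mono)
  qed (use that in auto)
  obtain K where K: "K > 0" "\<And>(A :: real^'n^'n) x. norm (A *v x) \<le> norm A * norm x * K"
    using norm_matrix_vector_mult_le_norm by blast
  define P where "P = Qinf Q B"
  define I where "I = matrix_inv P"
  have PI: "P *v (I *v x) = x" for x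
    unfolding P_def I_def by (rule matrix_inv_mult_vector[OF Qinf_invertible])
  define M where "M = norm P * (\<bar>N\<bar> * (norm I * K) * K) * K + 1"
  show ?thesis
  proof (rule that[of M])
    show "M > 0" using K(1) by (simp add: M_def add_nonneg_pos)
    fix t :: real and x :: "real^'n" assume t: "\<bar>t\<bar> \<le> 1"
    have "Dt Q B t *v x - x = P *v ((flow (- t) - flow 0) *v (I *v x))"
      by (simp add: Dt_eq P_def[symmetric] I_def[symmetric] matrix_vector_mult_diff_rdistrib
          matrix_vector_mult_diff_distrib PI flip: matrix_vector_mul_assoc)
    also have "norm \<dots> \<le> norm P * norm ((flow (- t) - flow 0) *v (I *v x)) * K" by (rule K)
    also have "\<dots> \<le> norm P * (norm (flow (- t) - flow 0) * norm (I *v x) * K) * K"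
      using K(1) by (intro mult_right_mono mult_left_mono K) auto
    also have "\<dots> \<le> norm P * ((\<bar>N\<bar> * \<bar>t\<bar>) * (norm I * norm x * K) * K) * K"
    proof -
      have "norm (flow (- t) - flow 0) \<le> \<bar>N\<bar> * \<bar>t\<bar>"
        using lip[of "- t"] t mult_right_mono[OF abs_ge_self[of N] abs_ge_zero[of t]] by simp
      then show ?thesis
        using K(1) by (intro mult_right_mono mult_left_mono mult_mono K) auto
    qed
    also have "\<dots> = (M - 1) * \<bar>t\<bar> * norm x" by (simp add: M_def mult_ac)
    also have "\<dots> \<le> M * \<bar>t\<bar> * norm x" by (intro mult_right_mono) auto
    finally show "norm (Dt Q B t *v x - x) \<le> M * \<bar>t\<bar> * norm x" .
  qed
qed

text \<open>In the coordinate \<open>y = matrix_inv (Qinf Q B) *v x\<close> the form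
  \<open>R\<close> is half the form of \<open>Qinf\<close>, and \<open>Dt Q B h\<close> acts as
  \<open>flow (- h)\<close>. Hence the growth of \<open>R\<close> along \<open>Dt\<close> is the
  growth of \<open>Qinf\<close> under \<open>flow\<close>.\<close>

lemma quad_R_eq: "quad_R Q B x = 1 / 2 * ((Qinf Q B *v (matrix_inv (Qinf Q B) *v x)) \<bullet> (matrix_inv (Qinf Q B) *v x))"
  by (simp add: quad_R_def matrix_inv_mult_vector[OF Qinf_invertible] inner_commute)

lemma quad_R_growth:
  obtains a where "a > 0" "\<And>h x. h \<ge> 0 \<Longrightarrow> (1 + a * h) * quad_R Q B x \<le> quad_R Q B (Dt Q B h *v x)"
proof -
  obtain a where a: "a > 0" "\<And>h y. h \<ge> 0 \<Longrightarrow>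
    (1 + a * h) * ((Qinf Q B *v y) \<bullet> y) \<le> (Qinf Q B *v (flow (- h) *v y)) \<bullet> (flow (- h) *v y)"
    using Qinf_growth by blast
  have "matrix_inv (Qinf Q B) *v (Dt Q B h *v x) = flow (- h) *v (matrix_inv (Qinf Q B) *v x)" for h x
    by (simp add: Dt_eq matrix_inv_mult_vector[OF Qinf_invertible] flip: matrix_vector_mul_assoc)
  then show ?thesis
    using that[of a] a by (simp add: quad_R_eq)
qed

lemma quad_R_bounds:
  obtains c C where "c > 0" "C > 0" "\<And>x. c * (norm x)\<^sup>2 \<le> quad_R Q B x"
    "\<And>x. quad_R Q B x \<le> C * (norm x)\<^sup>2"
proof -
  obtain c C where c: "c > 0" "C > 0" "\<And>y. c * (norm y)\<^sup>2 \<le> (Qinf Q B *v y) \<bullet> y"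
    "\<And>y. (Qinf Q B *v y) \<bullet> y \<le> C * (norm y)\<^sup>2"
    using Qinf_bounds by blast
  obtain K where K: "K > 0" "\<And>(A :: real^'n^'n) x. norm (A *v x) \<le> norm A * norm x * K"
    using norm_matrix_vector_mult_le_norm by blast
  define P where "P = Qinf Q B"
  define I where "I = matrix_inv P"
  have PI: "P *v (I *v x) = x" for x
    unfolding P_def I_def by (rule matrix_inv_mult_vector[OF Qinf_invertible])
  define p where "p = norm P * K + 1"
  define i where "i = norm I * K + 1"
  have p: "p > 0" and i: "i > 0" using K(1) by (simp_all add: p_def i_def add_nonneg_pos)
  show ?thesis
  proof (rule that[of "c / (2 * p\<^sup>2)" "C * i\<^sup>2"])
    fix x :: "real^'n"
    have x: "norm x \<le> p * norm (I *v x)"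
    proof -
      have "norm x \<le> norm P * norm (I *v x) * K" using K(2)[of P "I *v x"] by (simp add: PI)
      also have "\<dots> \<le> p * norm (I *v x)" by (simp add: p_def algebra_simps)
      finally show ?thesis .
    qed
    have y: "norm (I *v x) \<le> i * norm x"
    proof -
      have "norm (I *v x) \<le> norm I * norm x * K" by (rule K)
      also have "\<dots> \<le> i * norm x" by (simp add: i_def algebra_simps)
      finally show ?thesis .
    qed
    have "c / (2 * p\<^sup>2) * (norm x)\<^sup>2 \<le> c / (2 * p\<^sup>2) * (p * norm (I *v x))\<^sup>2"
      using c x by (intro mult_left_mono power_mono) auto
    also have "\<dots> = 1 / 2 * (c * (norm (I *v x))\<^sup>2)" using p by (simp add: power_mult_distrib)
    also have "\<dots> \<le> quad_R Q B x"
      unfolding quad_R_eq P_def[symmetric] I_def[symmetric]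
      using c(3)[of "I *v x"] by (intro mult_left_mono) (auto simp: P_def)
    finally show "c / (2 * p\<^sup>2) * (norm x)\<^sup>2 \<le> quad_R Q B x" .
    have "quad_R Q B x \<le> 1 / 2 * (C * (norm (I *v x))\<^sup>2)"
      unfolding quad_R_eq P_def[symmetric] I_def[symmetric]
      using c(4)[of "I *v x"] by (intro mult_left_mono) (auto simp: P_def)
    also have "\<dots> \<le> C * (norm (I *v x))\<^sup>2" using c by simp
    also have "\<dots> \<le> C * (i * norm x)\<^sup>2" using c y by (intro mult_left_mono power_mono) auto
    finally show "quad_R Q B x \<le> C * i\<^sup>2 * (norm x)\<^sup>2" by (simp add: power_mult_distrib mult_ac)
  qed (use c p i in auto)
qed

lemma continuous_on_quad_R: "continuous_on S (quad_R Q B)"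
  unfolding quad_R_def[abs_def]
  by (intro continuous_intros linear_continuous_on matrix_vector_mul_bounded_linear)

text \<open>The gap between the covariances means \<open>Qt \<le> \<theta> Qinf\<close> as forms,
  with \<theta> < 1 independent of \<open>t\<close>. Inversion gives that the inverse of
  \<open>Qinf\<close> is at most \<theta> times that of \<open>Qt\<close>, so the difference keeps
  the fraction \<open>1 - \<theta>\<close> of the inverse of \<open>Qt\<close>, which is of order
  \<open>1 / t\<close>.\<close>

lemma inverse_difference_lower_bound:
  obtains b where "b > 0" "\<And>t w. 0 < t \<Longrightarrow> t \<le> 1 \<Longrightarrow>
    b * (norm w)\<^sup>2 / t \<le> ((matrix_inv (Qt Q B (ereal t)) - matrix_inv (Qinf Q B)) *v w) \<bullet> w"
proof -
  obtain c1 C1 where Qt: "c1 > 0" "C1 > 0"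
    "\<And>t y. 0 < t \<Longrightarrow> t \<le> 1 \<Longrightarrow> c1 * t * (norm y)\<^sup>2 \<le> (Qt Q B (ereal t) *v y) \<bullet> y"
    "\<And>t y. 0 < t \<Longrightarrow> t \<le> 1 \<Longrightarrow> (Qt Q B (ereal t) *v y) \<bullet> y \<le> C1 * t * (norm y)\<^sup>2"
    using Qt_bounds by metis
  obtain c2 C2 where Qi: "c2 > 0" "C2 > 0" "\<And>y. c2 * (norm y)\<^sup>2 \<le> (Qinf Q B *v y) \<bullet> y"
    "\<And>y. (Qinf Q B *v y) \<bullet> y \<le> C2 * (norm y)\<^sup>2"
    using Qinf_bounds by blast
  obtain g where g: "g > 0"
    "\<And>t y. t \<le> 1 \<Longrightarrow> g * (norm y)\<^sup>2 \<le> (Qinf Q B *v y) \<bullet> y - (Qt Q B (ereal t) *v y) \<bullet> y"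
    using Qinf_Qt_gap by blast
  \<comment> \<open>\<open>1 - \<theta> \<le> g / C2\<close> converts the gap, stated against the
    squared norm, into a fraction of \<open>Qinf\<close>; the bound \<open>1 / 2\<close> keeps
    \<theta> positive.\<close>
  define \<theta> where "\<theta> = 1 - min (g / C2) (1 / 2)"
  have \<theta>: "0 < \<theta>" "\<theta> < 1" using g(1) Qi(2) by (auto simp: \<theta>_def min_def)
  show ?thesis
  proof (rule that[of "(1 - \<theta>) / C1"])
    show "(1 - \<theta>) / C1 > 0" using \<theta> Qt by simp
    fix t :: real and w :: "real^'n" assume t: "0 < t" "t \<le> 1"
    define A where "A = Qt Q B (ereal t)"
    have sym: "transpose A = A" unfolding A_def by (rule transpose_Qt)
    have pos: "(A *v x) \<bullet> x > 0" if "x \<noteq> 0" for x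
    proof -
      have "0 < c1 * t * (norm x)\<^sup>2" using Qt(1) t that by simp
      then show ?thesis using Qt(3)[OF t, of x] by (simp add: A_def)
    qed
    have "(matrix_inv (Qinf Q B) *v w) \<bullet> w \<le> \<theta> * ((matrix_inv A *v w) \<bullet> w)"
    proof (rule inverse_form_antimono[OF sym pos Qinf_invertible \<theta>(1)])
      fix y
      have "(1 - \<theta>) * ((Qinf Q B *v y) \<bullet> y) \<le> (g / C2) * (C2 * (norm y)\<^sup>2)"
        using \<theta> g(1) Qi order_trans[OF _ Qi(3)[of y], of 0]
        by (intro mult_mono Qi) (auto simp: \<theta>_def min_def)
      also have "\<dots> = g * (norm y)\<^sup>2" using Qi by simp
      also have "\<dots> \<le> (Qinf Q B *v y) \<bullet> y - (A *v y) \<bullet> y"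
        using g(2)[OF t(2), of y] by (simp add: A_def)
      finally show "(A *v y) \<bullet> y \<le> \<theta> * ((Qinf Q B *v y) \<bullet> y)" by (simp add: algebra_simps)
    qed
    \<comment> \<open>Comparing \<open>Qt\<close> with \<open>C1 * t\<close> times the identity
      bounds its inverse from below by \<open>1 / (C1 * t)\<close>.\<close>
    moreover have one: "invertible (mat 1 :: real^'n^'n)" by (auto simp: invertible_def)
    have "(matrix_inv (mat 1) *v w) \<bullet> w \<le> (C1 * t) * ((matrix_inv A *v w) \<bullet> w)"
    proof (rule inverse_form_antimono[OF sym pos])
      show "invertible (mat 1 :: real^'n^'n)" by (rule one)
      show "(A *v y) \<bullet> y \<le> C1 * t * ((mat 1 *v y) \<bullet> y)" for y
        using Qt(4)[OF t, of y] by (simp add: A_def power2_norm_eq_inner)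
    qed (use Qt t in auto)
    then have "(norm w)\<^sup>2 / (C1 * t) \<le> (matrix_inv A *v w) \<bullet> w"
      using matrix_inv_mult(1)[OF one] Qt(2) t
      by (simp add: power2_norm_eq_inner field_simps)
    then have "(1 - \<theta>) * ((norm w)\<^sup>2 / (C1 * t)) \<le> (1 - \<theta>) * ((matrix_inv A *v w) \<bullet> w)"
      using \<theta> by (intro mult_left_mono) auto
    ultimately have "(1 - \<theta>) * ((norm w)\<^sup>2 / (C1 * t)) \<le> (matrix_inv A *v w) \<bullet> w - (matrix_inv (Qinf Q B) *v w) \<bullet> w"
      by (simp add: algebra_simps)
    then show "(1 - \<theta>) / C1 * (norm w)\<^sup>2 / t
        \<le> ((matrix_inv (Qt Q B (ereal t)) - matrix_inv (Qinf Q B)) *v w) \<bullet> w"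
      by (simp add: A_def matrix_vector_mult_diff_rdistrib inner_diff_left)
  qed
qed

text \<open>The matrices \<open>Qt / t\<close> for \<open>0 < t \<le> 1\<close> satisfy the two
  uniform bounds of \<open>det_lower_bound\<close>, so \<open>det Qt\<close> is at least
  \<open>\<delta> t^n\<close>.\<close>

lemma det_ratio_bound:
  obtains C where "C > 0" "\<And>t. 0 < t \<Longrightarrow> t \<le> 1 \<Longrightarrow>
    sqrt (det (Qinf Q B) / det (Qt Q B (ereal t))) \<le> C * (1 / sqrt t) ^ CARD('n)"
proof -
  obtain c1 C1 where Qt: "c1 > 0" "C1 > 0"
    "\<And>t y. 0 < t \<Longrightarrow> t \<le> 1 \<Longrightarrow> c1 * t * (norm y)\<^sup>2 \<le> (Qt Q B (ereal t) *v y) \<bullet> y"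
    "\<And>t. 0 < t \<Longrightarrow> t \<le> 1 \<Longrightarrow> norm (Qt Q B (ereal t)) \<le> C1 * t"
    using Qt_bounds by metis
  obtain \<delta> where \<delta>: "\<delta> > 0"
    "\<And>A :: real^'n^'n. norm A \<le> C1 \<Longrightarrow> (\<And>x. c1 * (norm x)\<^sup>2 \<le> (A *v x) \<bullet> x) \<Longrightarrow> det A \<ge> \<delta>"
    using det_lower_bound[OF Qt(1)] by blast
  define d where "d = det (Qinf Q B)"
  have d: "d > 0" unfolding d_def by (rule det_pos_if_positive_form) (rule Qinf_pos)
  show ?thesis
  proof (rule that[of "sqrt (d / \<delta>)"])
    show "sqrt (d / \<delta>) > 0" using d \<delta> by simp
    fix t :: real assume t: "0 < t" "t \<le> 1"
    define A where "A = (1 / t) *\<^sub>R Qt Q B (ereal t)"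
    have QA: "Qt Q B (ereal t) = t *\<^sub>R A" using t by (simp add: A_def)
    have "det A \<ge> \<delta>"
    proof (rule \<delta>)
      show "norm A \<le> C1" using Qt(4)[OF t] t by (simp add: A_def field_simps)
      show "c1 * (norm x)\<^sup>2 \<le> (A *v x) \<bullet> x" for x
        using Qt(3)[OF t, of x] t by (simp add: A_def field_simps flip: scaleR_matrix_vector_assoc)
    qed
    then have "d / (t ^ CARD('n) * det A) \<le> d / (t ^ CARD('n) * \<delta>)"
      using d \<delta>(1) t by (intro divide_left_mono mult_left_mono) auto
    then have "sqrt (d / det (Qt Q B (ereal t))) \<le> sqrt (d / \<delta> * (1 / t) ^ CARD('n))"
      by (simp add: QA det_scaleR power_one_over field_simps)
    also have "\<dots> = sqrt (d / \<delta>) * (1 / sqrt t) ^ CARD('n)"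
      by (simp only: real_sqrt_mult real_sqrt_power real_sqrt_divide real_sqrt_one)
    finally show "sqrt (det (Qinf Q B) / det (Qt Q B (ereal t))) \<le> sqrt (d / \<delta>) * (1 / sqrt t) ^ CARD('n)"
      by (simp add: d_def)
  qed
qed

lemma mehler_kernel_bound:
  obtains C b where "C > 0" "b > 0" "\<And>t x u. 0 < t \<Longrightarrow> t \<le> 1 \<Longrightarrow>
    mehler_kernel Q B t x u
      \<le> C * exp (quad_R Q B x) * ((1 / sqrt t) ^ CARD('n) * exp (- b * (norm (u - Dt Q B t *v x))\<^sup>2 / t))"
proof -
  obtain C where C: "C > 0" "\<And>t. 0 < t \<Longrightarrow> t \<le> 1 \<Longrightarrow>
    sqrt (det (Qinf Q B) / det (Qt Q B (ereal t))) \<le> C * (1 / sqrt t) ^ CARD('n)"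
    using det_ratio_bound by blast
  obtain b where b: "b > 0" "\<And>t w. 0 < t \<Longrightarrow> t \<le> 1 \<Longrightarrow>
    b * (norm w)\<^sup>2 / t \<le> ((matrix_inv (Qt Q B (ereal t)) - matrix_inv (Qinf Q B)) *v w) \<bullet> w"
    using inverse_difference_lower_bound by blast
  show ?thesis
  proof (rule that[of C "b / 2"])
    fix t :: real and x u :: "real^'n" assume t: "0 < t" "t \<le> 1"
    have "mehler_kernel Q B t x u \<le> (C * (1 / sqrt t) ^ CARD('n)) * exp (quad_R Q B x)
        * exp (- (b / 2) * (norm (u - Dt Q B t *v x))\<^sup>2 / t)"
      unfolding mehler_kernel_def
    proof (intro mult_mono)
      show "exp (- 1 / 2 * (((matrix_inv (Qt Q B (ereal t)) - matrix_inv (Qinf Q B)) *v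
          (u - Dt Q B t *v x)) \<bullet> (u - Dt Q B t *v x))) \<le> exp (- (b / 2) * (norm (u - Dt Q B t *v x))\<^sup>2 / t)"
        using b(2)[OF t, of "u - Dt Q B t *v x"] by simp
    qed (use C t in auto)
    then show "mehler_kernel Q B t x u \<le> C * exp (quad_R Q B x) *
        ((1 / sqrt t) ^ CARD('n) * exp (- (b / 2) * (norm (u - Dt Q B t *v x))\<^sup>2 / t))"
      by (simp add: mult_ac)
  qed (use C b in auto)
qed

end

section \<open>The localizing function\<close>

locale localization =
  fixes c :: "nat \<Rightarrow> real^'n" and \<rho> rt :: "nat \<Rightarrow> real^'n \<Rightarrow> real"
  assumes c0: "c 0 = 0"
    and centres: "maximal_ball_centres c"
    and loc: "localizing_functions c \<rho> rt"
begin

lemma rho_nonneg: "\<rho> j x \<ge> 0" and rt_nonneg: "rt j x \<ge> 0"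
  and rho_outside: "dist (c j) x \<ge> 4 / (1 + norm (c j)) \<Longrightarrow> \<rho> j x = 0"
  and rho_inside: "dist (c j) x < 3 / (1 + norm (c j)) \<Longrightarrow> \<rho> j x = 1"
  and rt_inside: "dist (c j) x < 5 / (1 + norm (c j)) \<Longrightarrow> rt j x = 1"
  using loc by (auto simp: localizing_functions_def support_on_def scaled_ball_def subset_iff not_less[symmetric])

lemma continuous_on_rho: "continuous_on UNIV (\<rho> j)" and continuous_on_rt: "continuous_on UNIV (rt j)"
proof -
  have "k_smooth 0 (\<rho> j)" "k_smooth 0 (rt j)"
    using loc unfolding localizing_functions_def smooth_def by blast+
  then show "continuous_on UNIV (\<rho> j)" "continuous_on UNIV (rt j)" by simp_all
qed

lemma separated: "i \<noteq> j \<Longrightarrow> dist (c i) (c j) \<ge> 1 / (1 + norm (c i))"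
proof (rule ccontr)
  assume ij: "i \<noteq> j" and "\<not> dist (c i) (c j) \<ge> 1 / (1 + norm (c i))"
  then have "c j \<in> scaled_ball 1 (c i)" by (simp add: scaled_ball_def)
  moreover have "1 / (1 + norm (c j)) > 0" by (simp add: add_pos_nonneg)
  then have "c j \<in> scaled_ball 1 (c j)" by (simp add: scaled_ball_def)
  ultimately show False
    using centres ij by (auto simp: maximal_ball_centres_def disjoint_family_on_def)
qed

text \<open>The centres \<open>c j\<close> with \<open>\<rho> j u \<noteq> 0\<close> lie within
  distance 4 of \<open>u\<close>, so their norms are bounded and disjointness of the balls separates
  them by a fixed distance. A compact ball contains only finitely many such points.\<close>

lemma finite_rho_support: "finite {j. \<rho> j u \<noteq> 0}"
proof (rule ccontr)
  assume inf: "infinite {j. \<rho> j u \<noteq> 0}"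
  define J where "J = {j. \<rho> j u \<noteq> 0}"
  have near: "dist (c j) u < 4" if "j \<in> J" for j
  proof -
    have "dist (c j) u < 4 / (1 + norm (c j))"
      using that rho_outside[of j u] by (auto simp: J_def not_le[symmetric])
    also have "\<dots> \<le> 4" by (simp add: divide_le_eq add_pos_nonneg)
    finally show ?thesis .
  qed
  have inj: "inj_on c J"
  proof (rule inj_onI, rule ccontr)
    fix i j assume "c i = c j" "i \<noteq> j"
    moreover have "1 / (1 + norm (c i)) > 0" by (simp add: add_pos_nonneg)
    ultimately show False using separated[of i j] by simp
  qed
  \<comment> \<open>A centre within distance 4 of \<open>u\<close> has norm at most
    \<open>norm u + 4\<close>, so its unit ball has at least this radius.\<close>
  define \<epsilon> where "\<epsilon> = 1 / (5 + norm u)"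
  have \<epsilon>: "\<epsilon> > 0" by (simp add: \<epsilon>_def add_pos_nonneg)
  have sep: "dist x y \<ge> \<epsilon>" if xy: "x \<in> c ` J" "y \<in> c ` J" "x \<noteq> y" for x y
  proof -
    obtain i j where ij: "x = c i" "y = c j" "i \<in> J" "i \<noteq> j" using xy by blast
    have "norm (c i) \<le> norm u + 4"
      using near[OF ij(3)] norm_triangle_sub[of "c i" u] by (simp add: dist_norm)
    then have "\<epsilon> \<le> 1 / (1 + norm (c i))"
      unfolding \<epsilon>_def by (intro divide_left_mono) (auto intro!: mult_pos_pos add_pos_nonneg)
    then show ?thesis using separated[OF ij(4)] ij by simp
  qed
  have "c ` J \<subseteq> cball u 4" using near by (force simp: dist_commute)
  moreover have "infinite (c ` J)" using inf inj by (simp add: finite_image_iff J_def)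
  ultimately obtain x where "x islimpt (c ` J)"
    using compact_cball[of u 4] unfolding compact_eq_Bolzano_Weierstrass by blast
  then have "infinite (c ` J \<inter> ball x (\<epsilon> / 2))" using \<epsilon> by (simp add: islimpt_eq_infinite_ball)
  then obtain y z where "y \<in> c ` J \<inter> ball x (\<epsilon> / 2)" "z \<in> c ` J \<inter> ball x (\<epsilon> / 2)" "y \<noteq> z"
    by (metis infinite_arbitrarily_large[of _ 2] card_2_iff insert_subset)
  moreover from this have "dist y z < \<epsilon>"
    using dist_triangle_half_r[of x y \<epsilon> z] by simp
  ultimately show False using sep by fastforce
qed

text \<open>By maximality the ball \<open>scaled_ball 1 u\<close> meets some
  \<open>scaled_ball 1 (c j)\<close>. Once \<open>norm u \<ge> 1\<close> the radius at
  \<open>u\<close> is at most twice that at \<open>c j\<close>, so \<open>u\<close> is closer to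
  \<open>c j\<close> than three of its radii. The points with \<open>norm u < 3\<close> lie in the
  tripled ball around \<open>c 0 = 0\<close>.\<close>

lemma covered: "\<exists>j. dist (c j) u < 3 / (1 + norm (c j))"
proof (cases "norm u < 3")
  case True
  then show ?thesis using c0 by (intro exI[of _ 0]) simp
next
  case False
  have pos: "1 + norm x > 0" for x :: "real^'n" by (simp add: add_pos_nonneg)
  show ?thesis
  proof (cases "u \<in> range c")
    case True
    then obtain j where "u = c j" by auto
    then show ?thesis using pos[of "c j"] by (intro exI[of _ j]) simp
  next
    case notin: False
    have "\<not> disjoint_family_on (scaled_ball 1) (insert u (range c))"
    proof
      assume "disjoint_family_on (scaled_ball 1) (insert u (range c))"
      then have "insert u (range c) = range c"
        using centres unfolding maximal_ball_centres_def by blast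
      then show False using notin by auto
    qed
    moreover have "disjoint_family_on (scaled_ball 1) (range c)"
      using centres unfolding maximal_ball_centres_def disjoint_family_on_def by (metis UNIV_I imageE)
    ultimately obtain j where "scaled_ball 1 u \<inter> scaled_ball 1 (c j) \<noteq> {}"
      using notin by (fastforce simp: disjoint_family_on_def)
    then obtain z where z: "dist u z < 1 / (1 + norm u)" "dist (c j) z < 1 / (1 + norm (c j))"
      by (auto simp: scaled_ball_def)
    define s where "s = norm u"
    define r where "r = norm (c j)"
    have d: "dist (c j) u < 1 / (1 + s) + 1 / (1 + r)"
      using z dist_triangle2[of "c j" u z] unfolding s_def r_def by linarith
    have "r \<le> s + 2"
    proof -
      have "1 / (1 + s) \<le> 1" "1 / (1 + r) \<le> 1" by (simp_all add: s_def r_def divide_le_eq pos)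
      then show ?thesis
        using d norm_triangle_sub[of "c j" u] by (simp add: dist_norm s_def r_def)
    qed
    then have "1 + r \<le> 2 * (1 + s)" using False by (simp add: s_def)
    then have "1 / (1 + s) \<le> 2 / (1 + r)" using pos by (simp add: field_simps s_def r_def)
    then have "dist (c j) u < 3 / (1 + r)" using d by (simp add: add_divide_distrib[symmetric])
    then show ?thesis by (auto simp: r_def)
  qed
qed

lemma partition_fun_sums:
  "(\<lambda>j. w j * partition_fun \<rho> j u) sums (\<Sum>j | \<rho> j u \<noteq> 0. w j * partition_fun \<rho> j u)"
  by (rule sums_finite[OF finite_rho_support]) (simp add: partition_fun_def)

lemma suminf_rho: "(\<Sum>i. \<rho> i u) = (\<Sum>i | \<rho> i u \<noteq> 0. \<rho> i u)"
  by (rule suminf_finite[OF finite_rho_support]) simp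

lemma suminf_rho_pos: "(\<Sum>i. \<rho> i u) > 0"
proof -
  obtain j where "\<rho> j u = 1" using covered rho_inside by blast
  then show ?thesis
    unfolding suminf_rho using finite_rho_support[of u] rho_nonneg
    by (intro sum_pos2[where i = j]) auto
qed

lemma eta_eq: "eta \<rho> rt x u = (\<Sum>j | \<rho> j u \<noteq> 0. rt j x * partition_fun \<rho> j u)"
  unfolding eta_def by (rule sums_unique[OF partition_fun_sums, symmetric])

lemma eta_nonneg: "eta \<rho> rt x u \<ge> 0"
  unfolding eta_eq partition_fun_def
  using suminf_rho_pos[of u] rho_nonneg rt_nonneg
  by (intro sum_nonneg mult_nonneg_nonneg divide_nonneg_nonneg) auto

text \<open>If \<open>u\<close> lies in the ball \<open>4 B_j\<close> and \<open>x\<close> is this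
  close to \<open>u\<close>, then \<open>norm (c j) \<le> norm x + 4 + 1 / 6\<close>. The allowed
  distance is therefore at most one radius of \<open>B_j\<close>, and \<open>x\<close> lies in
  \<open>5 B_j\<close>. So every relevant \<open>rt j x\<close> is 1, and the partition of unity
  sums to 1 at \<open>u\<close>. The constant \<open>1 / 6\<close> becomes the \<delta> of the weak
  type estimate.\<close>

lemma eta_eq_1:
  assumes "norm (x - u) \<le> 1 / (6 * (1 + norm x))"
  shows "eta \<rho> rt x u = 1"
proof -
  have pos: "1 + norm x > 0" for x :: "real^'n" by (simp add: add_pos_nonneg)
  have "rt j x = 1" if "\<rho> j u \<noteq> 0" for j
  proof (rule rt_inside)
    have d: "dist (c j) u < 4 / (1 + norm (c j))"
      using that rho_outside[of j u] by (auto simp: not_le[symmetric])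
    also have "\<dots> \<le> 4" by (simp add: divide_le_eq pos)
    finally have "norm (c j) \<le> norm u + 4"
      using norm_triangle_sub[of "c j" u] by (simp add: dist_norm)
    moreover have "1 / (6 * (1 + norm x)) \<le> 1 / 6" by (intro divide_left_mono) (simp_all add: add_pos_nonneg)
    then have "norm u \<le> norm x + 1 / 6"
      using assms norm_triangle_sub[of u x] by (simp add: norm_minus_commute)
    ultimately have "1 + norm (c j) \<le> 6 * (1 + norm x)" using norm_ge_zero[of x] by argo
    then have "1 / (6 * (1 + norm x)) \<le> 1 / (1 + norm (c j))"
      by (intro divide_left_mono mult_pos_pos) (simp_all add: add_pos_nonneg)
    then have "norm (x - u) \<le> 1 / (1 + norm (c j))" using assms by simp
    moreover have "dist (c j) x \<le> dist (c j) u + norm (x - u)"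
      using dist_triangle2[of "c j" x u] by (simp add: dist_norm)
    ultimately show "dist (c j) x < 5 / (1 + norm (c j))"
      using d by (simp add: add_divide_distrib[symmetric])
  qed
  then have "eta \<rho> rt x u = (\<Sum>j | \<rho> j u \<noteq> 0. \<rho> j u) / (\<Sum>i. \<rho> i u)"
    unfolding eta_eq partition_fun_def sum_divide_distrib by (intro sum.cong) auto
  then show ?thesis using suminf_rho_pos[of u] by (simp add: suminf_rho)
qed

lemma borel_measurable_eta: "(\<lambda>(x, u). eta \<rho> rt x u) \<in> borel_measurable (borel \<Otimes>\<^sub>M borel)"
proof -
  have [measurable]: "\<rho> j \<in> borel_measurable borel" "rt j \<in> borel_measurable borel" for j
    by (simp_all add: borel_measurable_continuous_onI continuous_on_rho continuous_on_rt)
  show ?thesis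
    unfolding eta_def partition_fun_def by measurable
qed

end

section \<open>Integration\<close>

lemma nn_integral_lborel_translate:
  fixes f :: "'a::euclidean_space \<Rightarrow> ennreal"
  assumes [measurable]: "f \<in> borel_measurable borel"
  shows "(\<integral>\<^sup>+x. f (a + x) \<partial>lborel) = (\<integral>\<^sup>+x. f x \<partial>lborel)"
proof -
  have "(\<integral>\<^sup>+x. f x \<partial>lborel) = (\<integral>\<^sup>+x. f x \<partial>distr lborel borel ((+) a))"
    by (simp add: lborel_distr_plus)
  then show ?thesis by (simp add: nn_integral_distr)
qed

text \<open>The uniqueness argument for Haar measure: integrate a translate of \<open>h \<circ> L\<close> over the unit
  ball and exchange the integrals. (The change of variables theorem of the library is
  restricted to well-ordered index types.)\<close>

lemma nn_integral_matrix_image_le: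
  fixes L L' :: "real^'n^'n"
  assumes L: "L' ** L = mat 1" "L ** L' = mat 1" and "K \<ge> 0"
    and bound: "\<And>x. norm (L' *v x) \<le> K * norm x"
    and [measurable]: "h \<in> borel_measurable borel"
  shows "(\<integral>\<^sup>+x. h (L *v x) \<partial>lborel) \<le> ennreal (K ^ CARD('n)) * (\<integral>\<^sup>+x. h x \<partial>lborel)"
proof -
  have cont: "continuous_on UNIV ((*v) L)"
    by (intro linear_continuous_on matrix_vector_mul_bounded_linear)
  have [measurable]: "(*v) L \<in> borel_measurable borel"
    by (rule borel_measurable_continuous_onI[OF cont])
  have [measurable]: "cball (0 :: real^'n) 1 \<in> sets borel"
    by (rule borel_closed) simp
  define V where "V = unit_ball_vol CARD('n)"
  have V: "V > 0" by (simp add: V_def)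
  have ball: "emeasure lborel (cball (0 :: real^'n) 1) = ennreal V"
    by (simp add: emeasure_cball V_def)
  have LL: "L *v (L' *v x) = x" "L' *v (L *v x) = x" for x
    by (simp_all add: matrix_vector_mul_assoc L)
  have "(\<integral>\<^sup>+x. h (L *v x) \<partial>lborel) * ennreal V
      = (\<integral>\<^sup>+y. indicator (cball 0 1) y * (\<integral>\<^sup>+x. h (L *v x) \<partial>lborel) \<partial>(lborel :: (real^'n) measure))"
  proof -
    have cb: "cball (0 :: real^'n) 1 \<in> sets lborel" by (simp only: sets_lborel borel_closed[OF closed_cball])
    have "(\<integral>\<^sup>+y. indicator (cball 0 1) y * (\<integral>\<^sup>+x. h (L *v x) \<partial>lborel) \<partial>(lborel :: (real^'n) measure))
        = (\<integral>\<^sup>+y. indicator (cball 0 1) y \<partial>(lborel :: (real^'n) measure)) * (\<integral>\<^sup>+x. h (L *v x) \<partial>lborel)"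
      by (rule nn_integral_multc) (rule borel_measurable_indicator[OF cb])
    then show ?thesis
      by (simp only: nn_integral_indicator[OF cb] ball mult.commute)
  qed
  also have "\<dots> = (\<integral>\<^sup>+y. indicator (cball 0 1) y * (\<integral>\<^sup>+x. h (L *v x + y) \<partial>lborel) \<partial>lborel)"
  proof (rule nn_integral_cong)
    fix y :: "real^'n"
    have "(\<integral>\<^sup>+x. h (L *v x) \<partial>lborel) = (\<integral>\<^sup>+x. h (L *v (L' *v y + x)) \<partial>lborel)"
      by (rule nn_integral_lborel_translate[symmetric]) simp
    then show "indicator (cball 0 1) y * (\<integral>\<^sup>+x. h (L *v x) \<partial>lborel)
        = indicator (cball 0 1) y * (\<integral>\<^sup>+x. h (L *v x + y) \<partial>lborel)"
      by (simp add: matrix_vector_right_distrib LL add.commute)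
  qed
  also have "\<dots> = (\<integral>\<^sup>+y. (\<integral>\<^sup>+x. indicator (cball 0 1) y * h (L *v x + y) \<partial>lborel) \<partial>lborel)"
    by (simp add: nn_integral_cmult)
  also have "\<dots> = (\<integral>\<^sup>+x. (\<integral>\<^sup>+y. indicator (cball 0 1) y * h (L *v x + y) \<partial>lborel) \<partial>lborel)"
    by (rule lborel_pair.Fubini') measurable
  also have "\<dots> = (\<integral>\<^sup>+x. (\<integral>\<^sup>+w. indicator (cball 0 1) (w - L *v x) * h w \<partial>lborel) \<partial>lborel)"
  proof (rule nn_integral_cong)
    fix x :: "real^'n"
    show "(\<integral>\<^sup>+y. indicator (cball 0 1) y * h (L *v x + y) \<partial>lborel)
        = (\<integral>\<^sup>+w. indicator (cball 0 1) (w - L *v x) * h w \<partial>lborel)"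
      using nn_integral_lborel_translate[of "\<lambda>w. indicator (cball 0 1) (w - L *v x) * h w" "L *v x"]
      by simp
  qed
  also have "\<dots> = (\<integral>\<^sup>+w. (\<integral>\<^sup>+x. indicator (cball 0 1) (w - L *v x) * h w \<partial>lborel) \<partial>lborel)"
    by (rule lborel_pair.Fubini') measurable
  also have "\<dots> \<le> (\<integral>\<^sup>+w. ennreal (V * K ^ CARD('n)) * h w \<partial>lborel)"
  proof (intro nn_integral_mono)
    \<comment> \<open>For fixed \<open>w\<close>, the points \<open>x\<close> with
      \<open>w - L x\<close> in the unit ball lie in the ball of radius \<open>K\<close> about
      \<open>L' w\<close>. Its volume \<open>V * K^n\<close> is the source of the factor, and
      \<open>V\<close> cancels at the end.\<close>
    fix w :: "real^'n"
    have "(\<integral>\<^sup>+x. indicator (cball 0 1) (w - L *v x) * h w \<partial>lborel)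
        \<le> (\<integral>\<^sup>+x. indicator (cball (L' *v w) K) x * h w \<partial>lborel)"
    proof (intro nn_integral_mono mult_right_mono)
      fix x :: "real^'n"
      have "dist (L' *v w) x \<le> K" if "norm (w - L *v x) \<le> 1"
      proof -
        have "dist (L' *v w) x = norm (L' *v (w - L *v x))"
          by (simp add: dist_norm matrix_vector_mult_diff_distrib LL)
        also have "\<dots> \<le> K * norm (w - L *v x)" by (rule bound)
        also have "\<dots> \<le> K" using that \<open>K \<ge> 0\<close> mult_left_mono[of _ 1 K] by simp
        finally show ?thesis .
      qed
      then show "indicator (cball 0 1) (w - L *v x) \<le> (indicator (cball (L' *v w) K) x :: ennreal)"
        by (auto simp: indicator_def)
    qed simp
    also have "\<dots> = ennreal (V * K ^ CARD('n)) * h w"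
    proof -
      have cb: "cball (L' *v w) K \<in> sets lborel" by (simp only: sets_lborel borel_closed[OF closed_cball])
      show ?thesis
        using \<open>K \<ge> 0\<close>
        by (subst nn_integral_multc[OF borel_measurable_indicator[OF cb]])
          (simp add: nn_integral_indicator[OF cb] emeasure_cball V_def)
    qed
    finally show "(\<integral>\<^sup>+x. indicator (cball 0 1) (w - L *v x) * h w \<partial>lborel)
        \<le> ennreal (V * K ^ CARD('n)) * h w" .
  qed
  also have "\<dots> = (ennreal (K ^ CARD('n)) * (\<integral>\<^sup>+x. h x \<partial>lborel)) * ennreal V"
    using V \<open>K \<ge> 0\<close> by (subst nn_integral_cmult) (simp_all add: ennreal_mult mult_ac)
  finally show ?thesis
    using V by (simp add: ennreal_mult_le_mult_iff mult.commute[of _ "ennreal V"])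
qed

lemma nn_integral_exp_half_line:
  assumes "c > 0"
  shows "(\<integral>\<^sup>+\<sigma>. indicator {..s} \<sigma> * ennreal (exp (- c * (s - \<sigma>))) \<partial>lborel) = ennreal (1 / c)"
proof -
  have "(\<integral>\<^sup>+x. indicator {0..} x * ennreal (exp (- c * x)) \<partial>lborel) = ennreal (exp (- c * 0) / c)"
  proof -
    have "((\<lambda>x. indicator {0..} x * exp (- c * x)) has_integral (exp (- c * 0) / c)) UNIV"
    proof -
      have "(\<lambda>x. indicator {0..} x * exp (- c * x)) = (\<lambda>x. if x \<in> {0..} then exp (- c * x) else 0)"
        by (auto simp: indicator_def)
      then show ?thesis
        using has_integral_exp_minus_to_infinity[OF assms, of 0]
        by (simp only: has_integral_restrict_UNIV)
    qed
    from nn_integral_has_integral_lborel[OF _ _ this] show ?thesis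
      by (simp add: ennreal_mult'' ennreal_indicator)
  qed
  moreover have "(\<integral>\<^sup>+x. indicator {0..} x * ennreal (exp (- c * x)) \<partial>lborel)
      = (\<integral>\<^sup>+x. indicator {0..} (s + (-1) * x) * ennreal (exp (- c * (s + (-1) * x))) \<partial>lborel)"
    by (subst nn_integral_real_affine[of _ "-1" s]) auto
  moreover have "indicator {0..} (s + (-1) * x) * ennreal (exp (- c * (s + (-1) * x)))
     = indicator {..s} x * ennreal (exp (- c * (s - x)))" for x
    by (auto simp: indicator_def)
  ultimately show ?thesis by simp
qed

text \<open>From \<open>(1 + x / m)^m \<le> exp x\<close> at \<open>x = b v^2\<close> one gets
  \<open>v^(2m) \<le> (m / b)^m exp (b v^2)\<close>; the smaller power is absorbed by
  \<open>v^m \<le> 1 + v^(2m)\<close>.\<close>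

lemma power_gaussian_bounded:
  fixes b :: real
  assumes "b > 0"
  obtains C where "C > 0" "\<And>v. v \<ge> 0 \<Longrightarrow> v ^ m * exp (- b * v\<^sup>2) \<le> C"
proof (rule that[of "1 + (m / b) ^ m"])
  show "1 + (m / b) ^ m > 0" using assms by (simp add: add_pos_nonneg)
  fix v :: real assume v: "v \<ge> 0"
  have e: "(b * v\<^sup>2 / m) ^ m \<le> exp (b * v\<^sup>2)"
  proof (cases "m = 0")
    case False
    have "(b * v\<^sup>2 / m) ^ m \<le> (1 + b * v\<^sup>2 / m) ^ m"
      using assms by (intro power_mono) auto
    also have "\<dots> \<le> exp (b * v\<^sup>2)"
      using False assms by (intro exp_ge_one_plus_x_over_n_power_n) (auto intro: order_trans[of _ 0])
    finally show ?thesis .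
  qed (use assms in simp)
  have "real m ^ m > 0" by (cases "m = 0") auto
  have "v ^ m \<le> 1 + (v\<^sup>2) ^ m"
  proof (cases "v \<le> 1")
    case True
    then show ?thesis using v power_le_one[of v m] by (simp add: add_increasing2)
  next
    case False
    then have "v ^ m \<le> (v\<^sup>2) ^ m" using v by (intro power_mono) (auto simp: power2_eq_square)
    then show ?thesis by simp
  qed
  also have "\<dots> \<le> exp (b * v\<^sup>2) + (m / b) ^ m * exp (b * v\<^sup>2)"
    using e assms v \<open>real m ^ m > 0\<close> by (intro add_mono) (auto simp: field_simps power_mult_distrib)
  finally have "v ^ m \<le> (1 + (m / b) ^ m) * exp (b * v\<^sup>2)" by (simp add: algebra_simps)
  then show "v ^ m * exp (- b * v\<^sup>2) \<le> 1 + (m / b) ^ m"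
    by (simp add: exp_minus field_simps)
qed

text \<open>Tonelli for the counting measure.\<close>

lemma suminf_ennreal_swap:
  fixes f :: "nat \<Rightarrow> nat \<Rightarrow> ennreal"
  shows "(\<Sum>i. \<Sum>j. f i j) = (\<Sum>j. \<Sum>i. f i j)"
  using nn_integral_suminf[of "\<lambda>j i. f i j" "count_space UNIV"]
  by (simp add: nn_integral_count_space_nat)

lemma suminf_indicator_le_card:
  assumes "A \<subseteq> F" "finite F" "card F \<le> n"
  shows "(\<Sum>k. indicator A k :: ennreal) \<le> of_nat n"
proof -
  have "(\<Sum>k. indicator A k :: ennreal) = emeasure (count_space UNIV) A"
    by (simp flip: nn_integral_count_space_nat)
  also have "\<dots> = of_nat (card A)" using assms by (simp add: finite_subset)
  also have "\<dots> \<le> of_nat n" using card_mono[OF assms(2,1)] assms(3) by simp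
  finally show ?thesis .
qed

section \<open>Flow lines of an expanding linear flow\<close>

text \<open>The geometric part of the estimate sees the semigroup and the covariance matrices only
  through these properties: a linear flow with speed of order \<open>norm x\<close>, and a form
  comparable with the squared norm that grows along it.\<close>

locale expanding_flow =
  fixes D :: "real \<Rightarrow> real^'n^'n" and R :: "real^'n \<Rightarrow> real" and a lo hi M :: real
  assumes D_0: "D 0 = mat 1"
    and D_add: "D (s + t) = D s ** D t"
    and continuous_D: "continuous_on UNIV D"
    and lipschitz: "\<bar>t\<bar> \<le> 1 \<Longrightarrow> norm (D t *v x - x) \<le> M * \<bar>t\<bar> * norm x"
    and growth: "h \<ge> 0 \<Longrightarrow> (1 + a * h) * R x \<le> R (D h *v x)"
    and R_lower: "lo * (norm x)\<^sup>2 \<le> R x"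
    and R_upper: "R x \<le> hi * (norm x)\<^sup>2"
    and continuous_R: "continuous_on UNIV R"
    and pos: "a > 0" "lo > 0" "hi > 0" "M > 0"
begin

lemma R_nonneg: "R x \<ge> 0"
  using R_lower[of x] pos(2) order_trans[of 0 "lo * (norm x)\<^sup>2"] by simp

lemma D_D: "D s *v (D t *v x) = D (s + t) *v x"
  by (simp add: D_add matrix_vector_mul_assoc)

lemma D_minus: "D (- s) ** D s = mat 1" "D s ** D (- s) = mat 1"
  using D_add[of "- s" s] D_add[of s "- s"] by (simp_all add: D_0)

lemma measurable_R [measurable]: "R \<in> borel_measurable borel"
  by (rule borel_measurable_continuous_onI[OF continuous_R])

lemma measurable_flow [measurable (raw)]:
  assumes [measurable]: "f \<in> borel_measurable N" "g \<in> borel_measurable N"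
  shows "(\<lambda>x. D (f x) *v g x) \<in> borel_measurable N"
proof -
  have "continuous_on UNIV (\<lambda>p. D (fst p) *v snd p)"
    by (intro bounded_bilinear.continuous_on[OF bounded_bilinear_matrix_vector_mult]
        continuous_on_compose2[OF continuous_D] continuous_intros) auto
  then have "(\<lambda>p. D (fst p) *v snd p) \<in> borel_measurable (borel \<Otimes>\<^sub>M borel)"
    by (simp add: borel_measurable_continuous_onI borel_prod)
  from measurable_compose[OF _ this, of "\<lambda>x. (f x, g x)" N] show ?thesis by simp
qed

lemma flow_bounded:
  obtains N where "N \<ge> 1" "\<And>s x. \<bar>s\<bar> \<le> T \<Longrightarrow> norm (D s *v x) \<le> N * norm x"
    "\<And>s x. \<bar>s\<bar> \<le> T \<Longrightarrow> norm x \<le> N * norm (D s *v x)"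
proof -
  obtain K where K: "K > 0" "\<And>(A :: real^'n^'n) x. norm (A *v x) \<le> norm A * norm x * K"
    using norm_matrix_vector_mult_le_norm by blast
  have "compact (D ` {- T..T})"
    using continuous_D by (intro compact_continuous_image) (auto intro: continuous_on_subset)
  then obtain N where N: "\<And>s. s \<in> {- T..T} \<Longrightarrow> norm (D s) \<le> N"
    by (meson bounded_iff compact_imp_bounded imageI)
  define N' where "N' = \<bar>N\<bar> * K + 1"
  have up: "norm (D s *v x) \<le> N' * norm x" if "\<bar>s\<bar> \<le> T" for s x
  proof -
    have "norm (D s *v x) \<le> norm (D s) * norm x * K" by (rule K)
    also have "\<dots> \<le> \<bar>N\<bar> * norm x * K"
      using K(1) N[of s] that by (intro mult_right_mono) (auto simp: abs_le_iff)
    also have "\<dots> \<le> N' * norm x" by (simp add: N'_def algebra_simps)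
    finally show ?thesis .
  qed
  show ?thesis
  proof (rule that[of N'])
    show "norm x \<le> N' * norm (D s *v x)" if "\<bar>s\<bar> \<le> T" for s x
      using up[of "- s" "D s *v x"] that by (simp add: D_D D_0)
  qed (use up K in \<open>auto simp: N'_def\<close>)
qed

text \<open>Along a flow line, \<open>exp (- R)\<close> decays at least at rate \<open>a m\<close> while \<open>R \<ge> m\<close>, so the integral
  is controlled by its largest value.\<close>

lemma nn_integral_exp_flow_line_le:
  assumes "m > 0" "l \<ge> 0"
  shows "(\<integral>\<^sup>+\<sigma>. indicator {y. R y \<ge> m \<and> exp (- R y) \<le> l} (D (- \<sigma>) *v z) * ennreal (exp (- R (D (- \<sigma>) *v z))) \<partial>lborel)
    \<le> ennreal (l / (a * m))"
proof -
  define r where "r \<sigma> = R (D (- \<sigma>) *v z)" for \<sigma>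
  define P where "P = {\<sigma>. r \<sigma> \<ge> m \<and> exp (- r \<sigma>) \<le> l}"
  have am: "a * m > 0" using pos assms by simp
  \<comment> \<open>Decreasing \<sigma> moves the point forward along the flow, so \<open>r\<close>
    grows as \<sigma> decreases; while \<open>r \<sigma> \<ge> m\<close> the rate is at least
    \<open>a * m\<close>.\<close>
  have step: "r s \<ge> r \<sigma> + a * m * (\<sigma> - s)" if "r \<sigma> \<ge> m" "s \<le> \<sigma>" for s \<sigma>
  proof -
    have "(1 + a * (\<sigma> - s)) * r \<sigma> \<le> R (D (\<sigma> - s) *v (D (- \<sigma>) *v z))"
      unfolding r_def using that by (intro growth) simp
    also have "\<dots> = r s" by (simp add: r_def D_D)
    finally have "r \<sigma> + a * (\<sigma> - s) * r \<sigma> \<le> r s" by (simp add: algebra_simps)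
    moreover have "a * (\<sigma> - s) * m \<le> a * (\<sigma> - s) * r \<sigma>"
      using that pos by (intro mult_left_mono) auto
    ultimately show ?thesis by (simp add: mult_ac)
  qed
  show ?thesis
  proof (cases "P = {}")
    case True
    then have "indicator {y. R y \<ge> m \<and> exp (- R y) \<le> l} (D (- \<sigma>) *v z) = (0 :: ennreal)" for \<sigma>
      by (auto simp: P_def r_def indicator_def)
    then show ?thesis by simp
  next
    case False
    have lpos: "l > 0" using False by (auto simp: P_def intro: less_le_trans[OF exp_gt_zero])
    \<comment> \<open>On \<open>P\<close> the value of \<open>r\<close> is at least
      \<open>- ln l\<close>, so from \<sigma> onwards it can drop by at most
      \<open>ln l + r \<sigma>\<close> before the line leaves \<open>P\<close> for good.\<close>
    have upper: "\<tau> \<le> \<sigma> + (ln l + r \<sigma>) / (a * m)" if "\<sigma> \<in> P" "\<tau> \<in> P" for \<sigma> \<tau>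
    proof -
      have ln: "- r \<tau>' \<le> ln l" if "\<tau>' \<in> P" for \<tau>'
        using that lpos by (simp add: P_def ln_ge_iff)
      show ?thesis
      proof (cases "\<sigma> \<le> \<tau>")
        case True
        then have "a * m * (\<tau> - \<sigma>) \<le> r \<sigma> - r \<tau>" using step[of \<tau> \<sigma>] that by (simp add: P_def)
        also have "\<dots> \<le> ln l + r \<sigma>" using ln[OF that(2)] by simp
        finally have "\<tau> - \<sigma> \<le> (ln l + r \<sigma>) / (a * m)"
          by (simp add: pos_le_divide_eq[OF am] mult.commute)
        then show ?thesis by simp
      next
        case False
        have "(ln l + r \<sigma>) / (a * m) \<ge> 0" using ln[OF that(1)] am by simp
        then show ?thesis using False by simp
      qed
    qed
    \<comment> \<open>The supremum need not belong to \<open>P\<close>. The estimate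
      \<open>key\<close> is therefore read off from \<open>upper\<close>, which bounds
      \<open>s\<close> in terms of each single \<sigma>, and not from the value of \<open>r\<close>
      at \<open>s\<close>.\<close>
    define s where "s = Sup P"
    have bdd: "bdd_above P"
    proof -
      obtain \<sigma> where "\<sigma> \<in> P" using False by blast
      then show ?thesis using upper by (intro bdd_aboveI[of _ "\<sigma> + (ln l + r \<sigma>) / (a * m)"]) blast
    qed
    have key: "exp (- r \<sigma>) \<le> l * exp (- (a * m) * (s - \<sigma>))" if "\<sigma> \<in> P" for \<sigma>
    proof -
      have "s \<le> \<sigma> + (ln l + r \<sigma>) / (a * m)"
        unfolding s_def using False upper that by (intro cSup_least) auto
      then have "s - \<sigma> \<le> (ln l + r \<sigma>) / (a * m)" by simp
      then have "a * m * (s - \<sigma>) \<le> ln l + r \<sigma>" by (simp add: pos_le_divide_eq[OF am] mult.commute)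
      then have "exp (- r \<sigma>) \<le> exp (ln l - a * m * (s - \<sigma>))" by simp
      also have "\<dots> = l * exp (- (a * m) * (s - \<sigma>))" using lpos by (simp add: exp_diff exp_minus divide_inverse)
      finally show ?thesis .
    qed
    have "(\<integral>\<^sup>+\<sigma>. indicator {y. R y \<ge> m \<and> exp (- R y) \<le> l} (D (- \<sigma>) *v z) * ennreal (exp (- R (D (- \<sigma>) *v z))) \<partial>lborel)
      \<le> (\<integral>\<^sup>+\<sigma>. ennreal l * (indicator {..s} \<sigma> * ennreal (exp (- (a * m) * (s - \<sigma>)))) \<partial>lborel)"
    proof (rule nn_integral_mono)
      fix \<sigma> :: real
      show "indicator {y. R y \<ge> m \<and> exp (- R y) \<le> l} (D (- \<sigma>) *v z) * ennreal (exp (- R (D (- \<sigma>) *v z)))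
        \<le> ennreal l * (indicator {..s} \<sigma> * ennreal (exp (- (a * m) * (s - \<sigma>))))"
      proof (cases "\<sigma> \<in> P")
        case True
        then have "\<sigma> \<le> s" unfolding s_def by (rule cSup_upper[OF _ bdd])
        then show ?thesis
          using key[OF True] True lpos
          by (auto simp: P_def r_def[symmetric] ennreal_mult[symmetric] intro!: ennreal_leI)
      next
        case False
        then have "indicator {y. R y \<ge> m \<and> exp (- R y) \<le> l} (D (- \<sigma>) *v z) = (0 :: ennreal)"
          by (auto simp: P_def r_def indicator_def)
        then show ?thesis by simp
      qed
    qed
    also have "\<dots> = ennreal l * ennreal (1 / (a * m))"
      by (subst nn_integral_cmult) (measurable, simp only: nn_integral_exp_half_line[OF am])
    also have "\<dots> = ennreal (l / (a * m))" using assms am by (simp flip: ennreal_mult)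
    finally show ?thesis .
  qed
qed

text \<open>\<open>g\<close> is constant along flow lines, so one may divide by \<open>g\<close>, replace one factor \<open>g\<close> by its
  definition, and after exchanging the integrals bound the flow line integral of \<open>exp (- R)\<close>
  over \<open>E\<close> by \<open>C g / \<alpha>\<close>.\<close>

lemma weak_type_flow_average:
  fixes \<Psi> :: "real^'n \<Rightarrow> ennreal" and E :: "(real^'n) set"
  assumes [measurable]: "\<Psi> \<in> borel_measurable borel" "E \<in> sets borel"
    and m: "m > 0" "\<And>x. x \<in> E \<Longrightarrow> R x \<ge> m"
    and \<Psi>_bound: "K < \<infinity>" "\<And>z. \<Psi> z \<le> K"
    and N: "N \<ge> 1" "\<And>s x. \<bar>s\<bar> \<le> T \<Longrightarrow> norm x \<le> N * norm (D s *v x)"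
    and time: "\<And>x s. x \<in> E \<Longrightarrow> \<Psi> (D s *v x) \<noteq> 0 \<Longrightarrow> \<bar>s\<bar> \<le> T" "T \<ge> 0"
    and C: "C > 0" and \<alpha>: "\<alpha> > 0"
    and E: "\<And>x. x \<in> E \<Longrightarrow> ennreal \<alpha> < ennreal (C * exp (R x)) * (\<integral>\<^sup>+s. \<Psi> (D s *v x) \<partial>lborel)"
  shows "(\<integral>\<^sup>+x. indicator E x * ennreal (exp (- R x)) \<partial>lborel)
    \<le> ennreal (N ^ CARD('n) * C / (\<alpha> * a * m)) * (\<integral>\<^sup>+z. \<Psi> z \<partial>lborel)"
proof -
  define g where "g x = (\<integral>\<^sup>+s. \<Psi> (D s *v x) \<partial>lborel)" for x
  have [measurable]: "g \<in> borel_measurable borel" unfolding g_def[abs_def] by measurable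
  have g_inv: "g (D t *v x) = g x" for t x
    using nn_integral_lborel_translate[of "\<lambda>s. \<Psi> (D s *v x)" t]
    by (simp add: g_def D_D add.commute)
  \<comment> \<open>The average is taken over times in \<open>{- T..T}\<close> only and of a bounded
    function; finiteness is needed for dividing by \<open>g\<close>.\<close>
  have g_finite: "g x < \<infinity>" if "x \<in> E" for x
  proof -
    have "g x \<le> (\<integral>\<^sup>+s. K * indicator {- T..T} s \<partial>lborel)"
      unfolding g_def
    proof (rule nn_integral_mono)
      show "\<Psi> (D s *v x) \<le> K * indicator {- T..T} s" for s
        using time(1)[OF that, of s] \<Psi>_bound(2)[of "D s *v x"]
        by (cases "\<Psi> (D s *v x) = 0") (auto simp: abs_le_iff indicator_def)
    qed
    also have "\<dots> = K * ennreal (2 * T)" using time(2) by (simp add: nn_integral_cmult_indicator)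
    also have "\<dots> < \<infinity>" using \<Psi>_bound(1) by (simp add: ennreal_mult_less_top)
    finally show ?thesis .
  qed
  \<comment> \<open>On \<open>E\<close> the function \<open>g\<close> is finite, and it is nonzero
    by the level set condition, so the inverse is a genuine one there.\<close>
  define H where "H x = indicator E x * ennreal (exp (- R x)) * inverse (g x)" for x
  have [measurable]: "H \<in> borel_measurable borel" unfolding H_def[abs_def] by measurable
  have "(\<integral>\<^sup>+x. indicator E x * ennreal (exp (- R x)) \<partial>lborel) = (\<integral>\<^sup>+x. H x * g x \<partial>lborel)"
  proof (rule nn_integral_cong)
    fix x :: "real^'n"
    show "indicator E x * ennreal (exp (- R x)) = H x * g x"
    proof (cases "x \<in> E")
      case True
      have "g x \<noteq> 0" using E[OF True] by (auto simp: g_def[symmetric])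
      then have "inverse (g x) * g x = 1" using g_finite[OF True]
        by (simp add: ennreal_inverse_mult' divide_ennreal_def[symmetric] ennreal_divide_self mult.commute)
      then show ?thesis by (simp add: H_def mult.assoc)
    qed (simp add: H_def)
  qed
  also have "\<dots> = (\<integral>\<^sup>+x. (\<integral>\<^sup>+s. H x * \<Psi> (D s *v x) \<partial>lborel) \<partial>lborel)"
    by (simp add: g_def nn_integral_cmult)
  also have "\<dots> = (\<integral>\<^sup>+s. (\<integral>\<^sup>+x. H x * \<Psi> (D s *v x) \<partial>lborel) \<partial>lborel)"
    by (rule lborel_pair.Fubini') measurable
  also have "\<dots> \<le> (\<integral>\<^sup>+s. ennreal (N ^ CARD('n)) * (\<integral>\<^sup>+z. H (D (- s) *v z) * \<Psi> z \<partial>lborel) \<partial>lborel)"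
  proof (rule nn_integral_mono)
    fix s :: real
    show "(\<integral>\<^sup>+x. H x * \<Psi> (D s *v x) \<partial>lborel) \<le> ennreal (N ^ CARD('n)) * (\<integral>\<^sup>+z. H (D (- s) *v z) * \<Psi> z \<partial>lborel)"
    \<comment> \<open>The substitution \<open>z = D s *v x\<close> costs at most \<open>N^n\<close>
      for times up to \<open>T\<close>; for larger times the integrand vanishes by
      \<open>time\<close>.\<close>
    proof (cases "\<bar>s\<bar> \<le> T")
      case True
      have "norm (D (- s) *v x) \<le> N * norm x" for x
        using N(2)[OF True, of "D (- s) *v x"] by (simp add: D_D D_0)
      then have "(\<integral>\<^sup>+x. H (D (- s) *v (D s *v x)) * \<Psi> (D s *v x) \<partial>lborel)
          \<le> ennreal (N ^ CARD('n)) * (\<integral>\<^sup>+z. H (D (- s) *v z) * \<Psi> z \<partial>lborel)"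
        using N(1) by (intro nn_integral_matrix_image_le[where L' = "D (- s)"] D_minus) auto
      then show ?thesis by (simp add: D_D D_0)
    next
      case False
      have "H x * \<Psi> (D s *v x) = 0" for x
        using time(1)[of x s] False by (cases "x \<in> E") (auto simp: H_def)
      then show ?thesis by (simp only: nn_integral_const mult_zero_left zero_le)
    qed
  qed
  also have "\<dots> = ennreal (N ^ CARD('n)) * (\<integral>\<^sup>+s. (\<integral>\<^sup>+z. H (D (- s) *v z) * \<Psi> z \<partial>lborel) \<partial>lborel)"
    by (rule nn_integral_cmult) measurable
  also have "(\<integral>\<^sup>+s. (\<integral>\<^sup>+z. H (D (- s) *v z) * \<Psi> z \<partial>lborel) \<partial>lborel)
      = (\<integral>\<^sup>+z. (\<integral>\<^sup>+s. H (D (- s) *v z) * \<Psi> z \<partial>lborel) \<partial>lborel)"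
    by (rule lborel_pair.Fubini') measurable
  also have "\<dots> \<le> (\<integral>\<^sup>+z. ennreal (C / (\<alpha> * a * m)) * \<Psi> z \<partial>lborel)"
  proof (rule nn_integral_mono)
    fix z :: "real^'n"
    define J where "J = (\<integral>\<^sup>+s. indicator E (D (- s) *v z) * ennreal (exp (- R (D (- s) *v z))) \<partial>lborel)"
    have "(\<integral>\<^sup>+s. H (D (- s) *v z) * \<Psi> z \<partial>lborel) = J * (inverse (g z) * \<Psi> z)"
      unfolding J_def H_def g_inv by (subst nn_integral_multc[symmetric]) (auto simp: mult_ac)
    moreover have "J * inverse (g z) \<le> ennreal (C / (\<alpha> * a * m))"
    proof (cases "g z < \<infinity>")
      case True
      then obtain \<gamma> where \<gamma>: "g z = ennreal \<gamma>" "\<gamma> \<ge> 0" by (cases "g z") auto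
      \<comment> \<open>The value \<gamma> of \<open>g\<close> is the same at every point of the
        line, so the condition \<open>\<alpha> < C * exp (R y) * g y\<close> becomes one upper bound
        \<open>l\<close> for \<open>exp (- R)\<close> on the whole line.\<close>
      define l where "l = C * \<gamma> / \<alpha>"
      have l: "l \<ge> 0" using \<gamma> C \<alpha> by (simp add: l_def)
      have "J \<le> (\<integral>\<^sup>+s. indicator {y. R y \<ge> m \<and> exp (- R y) \<le> l} (D (- s) *v z) * ennreal (exp (- R (D (- s) *v z))) \<partial>lborel)"
        unfolding J_def
      proof (intro nn_integral_mono mult_right_mono)
        fix s :: real
        have "R y \<ge> m \<and> exp (- R y) \<le> l" if "y = D (- s) *v z" "y \<in> E" for y
        proof -
          have "ennreal \<alpha> < ennreal (C * exp (R y)) * ennreal \<gamma>"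
            using E[OF that(2)] g_inv[of "- s" z] by (simp add: g_def[symmetric] that(1) \<gamma>)
          then have "\<alpha> < C * exp (R y) * \<gamma>"
            using C \<gamma> by (simp add: ennreal_mult[symmetric] ennreal_less_iff \<alpha> less_imp_le)
          then have "exp (- R y) \<le> l" using \<alpha> by (simp add: l_def exp_minus field_simps)
          then show ?thesis using m(2)[OF that(2)] by simp
        qed
        then show "indicator E (D (- s) *v z)
            \<le> (indicator {y. R y \<ge> m \<and> exp (- R y) \<le> l} (D (- s) *v z) :: ennreal)"
          by (auto simp: indicator_def)
      qed simp
      also have "\<dots> \<le> ennreal (l / (a * m))" by (rule nn_integral_exp_flow_line_le[OF m(1) l])
      also have "\<dots> = ennreal (C / (\<alpha> * a * m)) * g z"
        using C \<alpha> pos m \<gamma> by (simp add: l_def \<gamma> flip: ennreal_mult)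
      finally have "J * inverse (g z) \<le> ennreal (C / (\<alpha> * a * m)) * (g z * inverse (g z))"
        by (metis mult.assoc mult_right_mono zero_le)
      also have "\<dots> \<le> ennreal (C / (\<alpha> * a * m)) * 1"
      \<comment> \<open>An inequality suffices: for \<gamma> = 0 the product is
        \<open>0 * \<infinity> = 0\<close>.\<close>
      proof (intro mult_left_mono)
        show "g z * inverse (g z) \<le> 1"
          using \<gamma> by (cases "\<gamma> = 0") (auto simp: inverse_ennreal simp flip: ennreal_mult)
      qed simp
      finally show ?thesis by simp
    next
      case False
      then have "g z = top" by (simp add: less_top[symmetric])
      then show ?thesis by simp
    qed
    ultimately show "(\<integral>\<^sup>+s. H (D (- s) *v z) * \<Psi> z \<partial>lborel) \<le> ennreal (C / (\<alpha> * a * m)) * \<Psi> z"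
      by (simp only: mult.assoc[symmetric] mult_right_mono zero_le)
  qed
  also have "\<dots> = ennreal (C / (\<alpha> * a * m)) * (\<integral>\<^sup>+z. \<Psi> z \<partial>lborel)"
    by (rule nn_integral_cmult) measurable
  finally show ?thesis
    using C \<alpha> pos m N(1) by (simp add: mult.assoc[symmetric] mult_left_mono flip: ennreal_mult)
qed

end

section \<open>Dyadic decomposition of the kernel\<close>

text \<open>In the variable \<open>v = r / sqrt t\<close>, multiplying the left side by
  \<open>r^n\<close> gives \<open>v^n exp (- b v^2)\<close>, which is bounded. One more factor
  \<open>r = sqrt t * v\<close> is affordable because \<open>sqrt t \<le> 1\<close>; this yields
  \<open>max 1 r\<close>.\<close>

lemma heat_factor_bound:
  fixes b :: real
  assumes "b > 0"
  obtains C where "C > 0"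
    "\<And>t r. 0 < t \<Longrightarrow> t \<le> 1 \<Longrightarrow> r > 0 \<Longrightarrow> (1 / sqrt t) ^ n * exp (- b * r\<^sup>2 / t) \<le> C / (r ^ n * max 1 r)"
proof -
  obtain C1 where C1: "C1 > 0" "\<And>v. v \<ge> 0 \<Longrightarrow> v ^ n * exp (- b * v\<^sup>2) \<le> C1"
    using power_gaussian_bounded[OF assms, of n] by blast
  obtain C2 where C2: "C2 > 0" "\<And>v. v \<ge> 0 \<Longrightarrow> v ^ Suc n * exp (- b * v\<^sup>2) \<le> C2"
    using power_gaussian_bounded[OF assms, of "Suc n"] by blast
  show ?thesis
  proof (rule that[of "C1 + C2"])
    fix t r :: real assume t: "0 < t" "t \<le> 1" "r > 0"
    define v where "v = r / sqrt t"
    have v: "v \<ge> 0" "v\<^sup>2 = r\<^sup>2 / t" using t by (simp_all add: v_def power_divide)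
    have st: "0 < sqrt t" "sqrt t \<le> 1" using t by simp_all
    define e where "e = exp (- b * v\<^sup>2)"
    have e: "exp (- b * r\<^sup>2 / t) = e" by (simp add: e_def v)
    have r1: "r ^ n * ((1 / sqrt t) ^ n * e) \<le> C1"
      using C1(2)[OF v(1)] by (simp add: e_def v_def power_divide)
    have r2: "r * (r ^ n * ((1 / sqrt t) ^ n * e)) \<le> C2"
    proof -
      have "r * (r ^ n * ((1 / sqrt t) ^ n * e)) = sqrt t * (v ^ Suc n * e)"
        using st by (simp add: v_def power_divide)
      also have "\<dots> \<le> 1 * (v ^ Suc n * e)" using st v by (intro mult_right_mono) (auto simp: e_def)
      also have "\<dots> \<le> C2" using C2(2)[OF v(1)] by (simp add: e_def)
      finally show ?thesis .
    qed
    have "(r ^ n * max 1 r) * ((1 / sqrt t) ^ n * e) \<le> C1 + C2"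
    proof (cases "r \<le> 1")
      case True
      then have "max 1 r = 1" by simp
      then show ?thesis using r1 C2(1) by simp
    next
      case False
      then have "max 1 r = r" by simp
      then have "(r ^ n * max 1 r) * ((1 / sqrt t) ^ n * e) = r * (r ^ n * ((1 / sqrt t) ^ n * e))"
        by (simp only: mult_ac)
      then show ?thesis using r2 C1(1) by linarith
    qed
    moreover have "r ^ n * max 1 r > 0" using t by simp
    ultimately show "(1 / sqrt t) ^ n * exp (- b * r\<^sup>2 / t) \<le> (C1 + C2) / (r ^ n * max 1 r)"
      unfolding e by (simp add: pos_le_divide_eq mult.commute)
  qed (use C1 C2 in simp)
qed

lemma dyadic_scale:
  fixes r L :: real
  assumes "L \<ge> 1" "r \<ge> 1 / L"
  obtains j :: nat where "r \<le> 2 ^ j / L" "2 ^ j / L \<le> 2 * r"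
proof -
  define j where "j = (LEAST j :: nat. r * L \<le> 2 ^ j)"
  obtain i :: nat where "r * L < 2 ^ i" using real_arch_pow[of 2 "r * L"] by auto
  then have j: "r * L \<le> 2 ^ j" using LeastI[of "\<lambda>j. r * L \<le> 2 ^ j" i] by (simp add: j_def)
  have rL: "r * L \<ge> 1" using assms by (simp add: pos_divide_le_eq)
  have "2 ^ j \<le> 2 * (r * L)"
  proof (cases j)
    case (Suc i)
    then have "\<not> r * L \<le> 2 ^ i" using not_less_Least[of i "\<lambda>j. r * L \<le> 2 ^ j"] by (simp add: j_def)
    then show ?thesis by (simp add: Suc)
  qed (use rL in simp)
  then show ?thesis using that[of j] j assms by (simp add: pos_divide_le_eq pos_le_divide_eq)
qed

lemma exists_power_shell:
  fixes r b :: real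
  assumes "r \<ge> 1" "b > 1"
  obtains k :: nat where "b ^ k \<le> r" "r < b ^ Suc k"
proof -
  define j where "j = (LEAST j :: nat. r < b ^ j)"
  obtain i :: nat where "r < b ^ i" using real_arch_pow[of b r] assms by auto
  then have j: "r < b ^ j" unfolding j_def by (rule LeastI)
  then obtain k where k: "j = Suc k" using assms by (cases j) auto
  then have "\<not> r < b ^ k" using not_less_Least[of k "\<lambda>j. r < b ^ j"] by (simp add: j_def)
  then show ?thesis using that[of k] j k by simp
qed

lemma ennreal_le_suminf: "f j \<le> (\<Sum>i. f i :: ennreal)"
  using sum_le_suminf[of f "{j}"] by simp

text \<open>With \<open>L = 2^k\<close> and \<open>\<rho> = 2^j / L\<close>, the \<open>j\<close>-th
  term is \<open>L / \<rho>^(n+1)\<close> on a ball of radius \<open>c * \<rho>\<close>. Averaging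
  it over a flow time \<open>min \<rho> 1 / L\<close> gives
  \<open>1 / (\<rho>^n * max 1 \<rho>)\<close>, the bound for the heat factor at distance \<rho>;
  its integral in \<open>z\<close> is of order \<open>L / \<rho> = L^2 / 2^j\<close>.\<close>

definition dyadic_kernel :: "real \<Rightarrow> real \<Rightarrow> real \<Rightarrow> nat \<Rightarrow> real^'n \<Rightarrow> real^'n \<Rightarrow> ennreal" where
  "dyadic_kernel A1 A2 c k z u = indicator {A1 * 2 ^ k..A2 * 2 ^ k} (norm z) *
     (\<Sum>j. ennreal (2 ^ k / (2 ^ j / 2 ^ k) ^ Suc CARD('n)) * indicator {..c * (2 ^ j / 2 ^ k)} (dist u z))"

lemma measurable_dyadic_kernel [measurable (raw)]:
  assumes [measurable]: "f \<in> borel_measurable N" "g \<in> borel_measurable N"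
  shows "(\<lambda>x. dyadic_kernel A1 A2 c k (f x) (g x)) \<in> borel_measurable N"
  unfolding dyadic_kernel_def by measurable

text \<open>The coefficients decay at least like \<open>2^-j\<close>. The bound depends on
  \<open>k\<close>, which is harmless: it serves to make the flow averages finite on each
  shell.\<close>

lemma dyadic_kernel_bounded:
  obtains K where "K < \<infinity>" "\<And>(z :: real^'n) u. dyadic_kernel A1 A2 c k z u \<le> K"
proof -
  define f where "f j = (2 :: real) ^ k / (2 ^ j / 2 ^ k) ^ Suc CARD('n)" for j :: nat
  have f: "0 \<le> f j" "f j \<le> 2 ^ k * (2 ^ k) ^ Suc CARD('n) * (1 / 2) ^ j" for j
  proof -
    have "(2 :: real) ^ j \<le> (2 ^ j) ^ Suc CARD('n)" by (rule self_le_power) auto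
    then have "(2 ^ k * (2 ^ k) ^ Suc CARD('n)) / (2 ^ j) ^ Suc CARD('n) \<le> (2 ^ k * (2 ^ k) ^ Suc CARD('n) :: real) / 2 ^ j"
      by (intro divide_left_mono) auto
    then show "f j \<le> 2 ^ k * (2 ^ k) ^ Suc CARD('n) * (1 / 2) ^ j"
      unfolding f_def power_divide[of "2 ^ j"] by (simp add: power_one_over)
  qed (simp add: f_def)
  have "summable f"
  proof (rule summable_comparison_test')
    show "summable (\<lambda>j. 2 ^ k * (2 ^ k) ^ Suc CARD('n) * (1 / 2 :: real) ^ j)"
      by (intro summable_mult summable_geometric) simp
    show "norm (f j) \<le> 2 ^ k * (2 ^ k) ^ Suc CARD('n) * (1 / 2) ^ j" for j using f[of j] by simp
  qed
  then have "(\<Sum>j. ennreal (f j)) < \<infinity>" using f by (simp add: less_top ennreal_suminf_neq_top)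
  moreover have "dyadic_kernel A1 A2 c k z u \<le> (\<Sum>j. ennreal (f j))" for z u :: "real^'n"
  proof -
    have "dyadic_kernel A1 A2 c k z u \<le> 1 * (\<Sum>j. ennreal (f j) * 1)"
      unfolding dyadic_kernel_def f_def
      by (intro mult_mono suminf_le mult_left_mono) (auto simp: indicator_def)
    then show ?thesis by simp
  qed
  ultimately show ?thesis using that by blast
qed

definition meeting_shells :: "real \<Rightarrow> real \<Rightarrow> real \<Rightarrow> real^'n \<Rightarrow> nat \<Rightarrow> nat set" where
  "meeting_shells A1 A2 c u j = {k. \<exists>z :: real^'n. norm z \<in> {A1 * 2 ^ k..A2 * 2 ^ k} \<and> dist u z \<le> c * (2 ^ j / 2 ^ k)}"

text \<open>For \<open>k \<ge> j\<close> the radius \<open>c 2 ^ j / 2 ^ k\<close> is at most \<open>c\<close>, so all the annuli that meet the ball have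
  comparable sizes.\<close>

lemma shells_meeting_ball:
  assumes "A1 > 0" "A2 > 0" "c > 0"
  shows "\<exists>N0. \<forall>(u :: real^'n) j. \<exists>F. meeting_shells A1 A2 c u j \<subseteq> F \<and> finite F \<and> card F \<le> j + Suc N0"
proof -
  \<comment> \<open>If \<open>k'\<close> exceeded \<open>k\<close> by \<open>N0\<close> or more, a
    point of the annulus \<open>k\<close> and one of the annulus \<open>k'\<close> would be more
    than \<open>2 * c\<close> apart and could not share a ball of radius \<open>c\<close>.\<close>
  obtain N0 :: nat where N0: "(A2 + 2 * c) / A1 < 2 ^ N0"
    using real_arch_pow[of 2 "(A2 + 2 * c) / A1"] by auto
  show ?thesis
  proof (intro exI[of _ N0] allI)
    fix u :: "real^'n" and j :: nat
    define I where "I = meeting_shells A1 A2 c u j"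
    note I_def' = I_def[unfolded meeting_shells_def]
    have gap: "k' < k + N0" if k: "k \<in> I" "j \<le> k" and k': "k' \<in> I" "j \<le> k'" for k k'
    proof (rule ccontr)
      assume "\<not> k' < k + N0"
      have near: "c * (2 ^ j / 2 ^ i) \<le> c" if "j \<le> i" for i
        using assms that by (simp add: mult_le_cancel_left1 divide_le_eq)
      obtain z where z: "norm z \<le> A2 * 2 ^ k" "dist u z \<le> c" using k near by (force simp: I_def')
      obtain z' where z': "A1 * 2 ^ k' \<le> norm z'" "dist u z' \<le> c" using k' near by (force simp: I_def')
      have "norm z' \<le> norm z + dist z z'" using norm_triangle_sub[of z' z] by (simp add: dist_norm norm_minus_commute)
      also have "dist z z' \<le> 2 * c" using dist_triangle3[of z z' u] z z' by linarith
      also have "2 * c \<le> 2 * c * 2 ^ k" using assms by simp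
      finally have "A1 * 2 ^ k' \<le> (A2 + 2 * c) * 2 ^ k" using z z' by (simp add: distrib_right)
      moreover have "A1 * (2 ^ N0 * 2 ^ k) \<le> A1 * 2 ^ k'"
        using \<open>\<not> k' < k + N0\<close> assms by (simp add: power_add[symmetric] add.commute)
      ultimately have "A1 * (2 ^ N0 * 2 ^ k) \<le> (A2 + 2 * c) * 2 ^ k" by (rule order_trans[rotated])
      then have "A1 * 2 ^ N0 * 2 ^ k \<le> (A2 + 2 * c) * 2 ^ k" by (simp only: mult.assoc)
      then have "A1 * 2 ^ N0 \<le> A2 + 2 * c" by (rule mult_right_le_imp_le) simp
      then show False using N0 assms by (simp add: pos_divide_less_eq mult.commute)
    qed
    \<comment> \<open>The \<open>j\<close> indices below \<open>j\<close> are simply all counted;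
      the others lie among \<open>N0\<close> consecutive ones.\<close>
    show "\<exists>F. meeting_shells A1 A2 c u j \<subseteq> F \<and> finite F \<and> card F \<le> j + Suc N0"
    proof (cases "\<exists>k\<in>I. j \<le> k")
      case True
      define k0 where "k0 = (LEAST k. k \<in> I \<and> j \<le> k)"
      have k0: "k0 \<in> I \<and> j \<le> k0" unfolding k0_def by (rule LeastI_ex) (use True in blast)
      have "I \<subseteq> {..<j} \<union> {k0..<k0 + N0}"
      proof
        fix k assume k: "k \<in> I"
        show "k \<in> {..<j} \<union> {k0..<k0 + N0}"
        proof (cases "j \<le> k")
          case True
          then have "k0 \<le> k" unfolding k0_def by (intro Least_le[of "\<lambda>k. k \<in> I \<and> j \<le> k"] conjI k)
          then show ?thesis using gap[of k0 k] k0 k True by simp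
        qed simp
      qed
      moreover have "card ({..<j} \<union> {k0..<k0 + N0}) \<le> j + Suc N0"
        using card_Un_le[of "{..<j}" "{k0..<k0 + N0}"] by simp
      moreover have "finite ({..<j} \<union> {k0..<k0 + N0})" by simp
      ultimately show ?thesis unfolding I_def by (intro exI conjI)
    next
      case False
      have "I \<subseteq> {..<j}"
      proof
        fix k assume "k \<in> I"
        then show "k \<in> {..<j}" using False by (simp add: not_le[symmetric])
      qed
      moreover have "finite {..<j}" "card {..<j} \<le> j + Suc N0" by simp_all
      ultimately show ?thesis unfolding I_def by (intro exI conjI)
    qed
  qed
qed

text \<open>After the factor \<open>1 / 4^k\<close> the term of scale \<open>j\<close> contributes
  \<open>V * 2^-j\<close>, whatever \<open>k\<close> is. Exchanging the sums leaves the number of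
  meeting shells, at most \<open>j + Suc N0\<close>, weighted by \<open>2^-j\<close>.\<close>

lemma sum_dyadic_kernel_integral:
  assumes "A1 > 0" "A2 > 0" "c > 0"
  obtains W where "W > 0"
    "\<And>u :: real^'n. (\<Sum>k. ennreal (1 / 4 ^ k) * (\<integral>\<^sup>+z. dyadic_kernel A1 A2 c k z u \<partial>lborel)) \<le> ennreal W"
proof -
  let ?n = "CARD('n)"
  obtain N0 where N0: "\<forall>(u :: real^'n) j. \<exists>F. meeting_shells A1 A2 c u j \<subseteq> F \<and> finite F \<and> card F \<le> j + Suc N0"
    using shells_meeting_ball[OF assms] by (rule exE)
  define V where "V = unit_ball_vol ?n * c ^ ?n"
  have V: "V > 0" using assms by (simp add: V_def)
  define I where "I u j = meeting_shells A1 A2 c u j" for u :: "real^'n" and j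
  have summand: "ennreal (1 / 4 ^ k) * (\<integral>\<^sup>+z. dyadic_kernel A1 A2 c k z u \<partial>lborel)
      \<le> (\<Sum>j. ennreal (V * (1 / 2) ^ j) * indicator (I u j) k)" for k and u :: "real^'n"
  proof -
    define \<rho> where "\<rho> j = (2 :: real) ^ j / 2 ^ k" for j
    have \<rho>: "\<rho> j > 0" for j by (simp add: \<rho>_def)
    have p4: "(4 :: real) ^ k = 2 ^ k * 2 ^ k" by (simp flip: power_mult_distrib)
    have "(\<integral>\<^sup>+z. dyadic_kernel A1 A2 c k z u \<partial>lborel)
        \<le> (\<integral>\<^sup>+z. (\<Sum>j. ennreal (2 ^ k / \<rho> j ^ Suc ?n) * indicator (I u j) k * indicator (cball u (c * \<rho> j)) z) \<partial>lborel)"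
    proof (rule nn_integral_mono)
      fix z :: "real^'n"
      have "indicator {A1 * 2 ^ k..A2 * 2 ^ k} (norm z) * indicator {..c * \<rho> j} (dist u z)
          \<le> (indicator (I u j) k * indicator (cball u (c * \<rho> j)) z :: ennreal)" for j
        by (auto simp: indicator_def I_def meeting_shells_def \<rho>_def)
      then have "ennreal (2 ^ k / \<rho> j ^ Suc ?n) * (indicator {A1 * 2 ^ k..A2 * 2 ^ k} (norm z) * indicator {..c * \<rho> j} (dist u z))
          \<le> ennreal (2 ^ k / \<rho> j ^ Suc ?n) * (indicator (I u j) k * indicator (cball u (c * \<rho> j)) z)" for j
        by (intro mult_left_mono) auto
      then have le: "indicator {A1 * 2 ^ k..A2 * 2 ^ k} (norm z) * (ennreal (2 ^ k / \<rho> j ^ Suc ?n) * indicator {..c * \<rho> j} (dist u z))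
          \<le> ennreal (2 ^ k / \<rho> j ^ Suc ?n) * indicator (I u j) k * indicator (cball u (c * \<rho> j)) z" for j
        by (simp only: mult.assoc mult.left_commute)
      have "dyadic_kernel A1 A2 c k z u = (\<Sum>j. indicator {A1 * 2 ^ k..A2 * 2 ^ k} (norm z) *
          (ennreal (2 ^ k / \<rho> j ^ Suc ?n) * indicator {..c * \<rho> j} (dist u z)))"
        unfolding dyadic_kernel_def \<rho>_def by (rule ennreal_suminf_cmult[symmetric])
      also have "\<dots> \<le> (\<Sum>j. ennreal (2 ^ k / \<rho> j ^ Suc ?n) * indicator (I u j) k * indicator (cball u (c * \<rho> j)) z)"
        by (rule suminf_le[OF le]) auto
      finally show "dyadic_kernel A1 A2 c k z u
        \<le> (\<Sum>j. ennreal (2 ^ k / \<rho> j ^ Suc ?n) * indicator (I u j) k * indicator (cball u (c * \<rho> j)) z)" .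
    qed
    also have "\<dots> = (\<Sum>j. ennreal (2 ^ k / \<rho> j ^ Suc ?n) * indicator (I u j) k * ennreal (V * \<rho> j ^ ?n))"
    proof (subst nn_integral_suminf)
      have cb: "cball u r \<in> sets lborel" for r by (simp only: sets_lborel borel_closed[OF closed_cball])
      show "(\<Sum>j. \<integral>\<^sup>+z. ennreal (2 ^ k / \<rho> j ^ Suc ?n) * indicator (I u j) k * indicator (cball u (c * \<rho> j)) z \<partial>lborel)
        = (\<Sum>j. ennreal (2 ^ k / \<rho> j ^ Suc ?n) * indicator (I u j) k * ennreal (V * \<rho> j ^ ?n))"
      proof (intro suminf_cong)
        fix j
        have "emeasure lborel (cball u (c * \<rho> j)) = ennreal (V * \<rho> j ^ ?n)"
          using assms \<rho>[of j] by (simp add: emeasure_cball V_def power_mult_distrib mult_ac)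
        then show "(\<integral>\<^sup>+z. ennreal (2 ^ k / \<rho> j ^ Suc ?n) * indicator (I u j) k * indicator (cball u (c * \<rho> j)) z \<partial>lborel)
          = ennreal (2 ^ k / \<rho> j ^ Suc ?n) * indicator (I u j) k * ennreal (V * \<rho> j ^ ?n)"
          by (simp only: nn_integral_cmult_indicator[OF cb])
      qed
      show "(\<lambda>z. ennreal (2 ^ k / \<rho> j ^ Suc ?n) * indicator (I u j) k * indicator (cball u (c * \<rho> j)) z) \<in> borel_measurable lborel" for j
        by (intro borel_measurable_times_ennreal borel_measurable_const borel_measurable_indicator cb)
    qed
    finally have "ennreal (1 / 4 ^ k) * (\<integral>\<^sup>+z. dyadic_kernel A1 A2 c k z u \<partial>lborel)
      \<le> ennreal (1 / 4 ^ k) * (\<Sum>j. ennreal (2 ^ k / \<rho> j ^ Suc ?n) * indicator (I u j) k * ennreal (V * \<rho> j ^ ?n))"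
      by (intro mult_left_mono) auto
    also have "\<dots> = (\<Sum>j. ennreal (1 / 4 ^ k) * (ennreal (2 ^ k / \<rho> j ^ Suc ?n) * indicator (I u j) k * ennreal (V * \<rho> j ^ ?n)))"
      by (rule ennreal_suminf_cmult[symmetric])
    also have "\<dots> = (\<Sum>j. ennreal (V * (1 / 2) ^ j) * indicator (I u j) k)"
    proof (intro suminf_cong)
      fix j
      \<comment> \<open>The ball has volume \<open>V * \<rho>^n\<close>, so
        \<open>L / \<rho>^(n+1)\<close> integrates to \<open>V * L / \<rho>\<close>; dividing by
        \<open>L^2\<close> leaves \<open>V / (L * \<rho>)\<close> with
        \<open>L * \<rho> = 2^j\<close>.\<close>
      have "1 / 4 ^ k * (2 ^ k / \<rho> j ^ Suc ?n) * (V * \<rho> j ^ ?n) = V / (2 ^ k * \<rho> j)"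
        using \<rho>[of j] by (simp add: p4)
      also have "\<dots> = V * (1 / 2) ^ j" by (simp add: \<rho>_def power_one_over)
      finally have "ennreal (1 / 4 ^ k * (2 ^ k / \<rho> j ^ Suc ?n) * (V * \<rho> j ^ ?n)) = ennreal (V * (1 / 2) ^ j)" by simp
      then have "ennreal (1 / 4 ^ k) * ennreal (2 ^ k / \<rho> j ^ Suc ?n) * ennreal (V * \<rho> j ^ ?n) = ennreal (V * (1 / 2) ^ j)"
        using \<rho>[of j] V by (simp only: ennreal_mult' [symmetric] zero_le_divide_iff zero_le_power zero_le_one zero_le_numeral less_imp_le mult_nonneg_nonneg simp_thms)
      then show "ennreal (1 / 4 ^ k) * (ennreal (2 ^ k / \<rho> j ^ Suc ?n) * indicator (I u j) k * ennreal (V * \<rho> j ^ ?n))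
          = ennreal (V * (1 / 2) ^ j) * indicator (I u j) k"
        by (simp only: mult_ac flip: \<open>ennreal (1 / 4 ^ k) * ennreal (2 ^ k / \<rho> j ^ Suc ?n) * ennreal (V * \<rho> j ^ ?n) = ennreal (V * (1 / 2) ^ j)\<close>)
    qed
    finally show ?thesis .
  qed
  \<comment> \<open>\<open>j + Suc N0\<close> is at most \<open>Suc N0 * Suc j\<close>, and the
    series of \<open>(j + 1) / 2^j\<close> has sum 4.\<close>
  define W where "W = V * real (Suc N0) * 4"
  have s4: "(\<lambda>j. V * real (Suc N0) * (real (Suc j) * (1 / 2) ^ j)) sums W"
    using sums_mult[OF geometric_deriv_sums[of "1 / 2 :: real"], of "V * real (Suc N0)"]
    by (simp add: W_def power2_eq_square)
  show ?thesis
  proof (rule that[of W])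
    show "W > 0" using V by (simp add: W_def)
    fix u :: "real^'n"
    have "(\<Sum>k. ennreal (1 / 4 ^ k) * (\<integral>\<^sup>+z. dyadic_kernel A1 A2 c k z u \<partial>lborel))
        \<le> (\<Sum>k. \<Sum>j. ennreal (V * (1 / 2) ^ j) * indicator (I u j) k)"
      by (intro suminf_le summand) auto
    also have "\<dots> = (\<Sum>j. ennreal (V * (1 / 2) ^ j) * (\<Sum>k. indicator (I u j) k))"
      by (subst suminf_ennreal_swap) simp
    also have "\<dots> \<le> (\<Sum>j. ennreal (V * real (Suc N0) * (real (Suc j) * (1 / 2) ^ j)))"
    proof (intro suminf_le)
      fix j
      obtain F where F: "I u j \<subseteq> F" "finite F" "card F \<le> j + Suc N0" using N0 unfolding I_def by blast
      have "ennreal (V * (1 / 2) ^ j) * (\<Sum>k. indicator (I u j) k) \<le> ennreal (V * (1 / 2) ^ j) * of_nat (j + Suc N0)"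
        by (intro mult_left_mono suminf_indicator_le_card[OF F]) simp
      also have "\<dots> = ennreal (V * (1 / 2) ^ j * real (j + Suc N0))"
        using V by (simp only: ennreal_of_nat_eq_real_of_nat ennreal_mult' [symmetric] less_imp_le mult_nonneg_nonneg zero_le_power zero_le_divide_iff zero_le_one zero_le_numeral simp_thms of_nat_0_le_iff)
      also have "\<dots> \<le> ennreal (V * real (Suc N0) * (real (Suc j) * (1 / 2) ^ j))"
      proof (rule ennreal_leI)
        have "V * (1 / 2) ^ j * real (j + Suc N0) \<le> V * (1 / 2) ^ j * (real (Suc N0) * real (Suc j))"
          using V by (intro mult_left_mono) (auto simp: algebra_simps)
        then show "V * (1 / 2) ^ j * real (j + Suc N0) \<le> V * real (Suc N0) * (real (Suc j) * (1 / 2) ^ j)"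
          by (simp only: mult_ac)
      qed
      finally show "ennreal (V * (1 / 2) ^ j) * (\<Sum>k. indicator (I u j) k) \<le> ennreal (V * real (Suc N0) * (real (Suc j) * (1 / 2) ^ j))" .
    qed auto
    also have "\<dots> = ennreal W"
      using s4 V by (subst suminf_ennreal2) (auto simp: sums_iff)
    finally show "(\<Sum>k. ennreal (1 / 4 ^ k) * (\<integral>\<^sup>+z. dyadic_kernel A1 A2 c k z u \<partial>lborel)) \<le> ennreal W" .
  qed
qed

section \<open>Pointwise bounds of the heat factor and averages along the flow\<close>

context expanding_flow
begin

definition heat_factor :: "real \<Rightarrow> real \<Rightarrow> real^'n \<Rightarrow> real^'n \<Rightarrow> real" where
  "heat_factor b t x u = (1 / sqrt t) ^ CARD('n) * exp (- b * (norm (u - D t *v x))\<^sup>2 / t)"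

text \<open>Powers of 4, because \<open>R\<close> is quadratic: the points of \<open>shell k\<close>
  have norm of order \<open>2^k\<close>.\<close>

definition shell :: "nat \<Rightarrow> (real^'n) set" where
  "shell k = {x. 4 ^ k \<le> R x \<and> R x < 4 ^ Suc k}"

text \<open>For \<open>t \<ge> \<epsilon> / L^2\<close> the power of \<open>t\<close> alone is
  \<open>O(L^n)\<close>. For shorter times the flow moves \<open>x\<close> by at most
  \<open>\<delta> / (2 L)\<close>, so \<open>u\<close> stays at least that far from
  \<open>D t *v x\<close> and the Gaussian gives the bound.\<close>

lemma heat_factor_off_diagonal:
  assumes "b > 0" "\<delta> > 0" "X > 0"
  obtains C where "C > 0" "\<And>L x u t. L \<ge> 1 \<Longrightarrow> norm x \<le> X * L \<Longrightarrow> norm (x - u) \<ge> \<delta> / L \<Longrightarrow>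
    0 < t \<Longrightarrow> t \<le> 1 \<Longrightarrow> heat_factor b t x u \<le> C * L ^ CARD('n)"
proof -
  obtain C1 where C1: "C1 > 0" "\<And>t r. 0 < t \<Longrightarrow> t \<le> 1 \<Longrightarrow> r > 0 \<Longrightarrow>
      (1 / sqrt t) ^ CARD('n) * exp (- b * r\<^sup>2 / t) \<le> C1 / (r ^ CARD('n) * max 1 r)"
    using heat_factor_bound[OF assms(1), of "CARD('n)"] by blast
  \<comment> \<open>Chosen so that the displacement bound
    \<open>M * (\<epsilon> / L^2) * (X * L)\<close> equals
    \<open>\<delta> / (2 * L)\<close>.\<close>
  define \<epsilon> where "\<epsilon> = \<delta> / (2 * M * X)"
  have \<epsilon>: "\<epsilon> > 0" using assms pos by (simp add: \<epsilon>_def)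
  define C where "C = (1 / sqrt \<epsilon>) ^ CARD('n) + C1 * (2 / \<delta>) ^ CARD('n)"
  show ?thesis
  proof (rule that[of C])
    show "C > 0" using \<epsilon> C1 assms by (simp add: C_def add_pos_pos)
    fix L t :: real and x u :: "real^'n"
    assume L: "L \<ge> 1" and x: "norm x \<le> X * L" and xu: "norm (x - u) \<ge> \<delta> / L" and t: "0 < t" "t \<le> 1"
    show "heat_factor b t x u \<le> C * L ^ CARD('n)"
    proof (cases "t \<ge> \<epsilon> / L\<^sup>2")
      case True
      have "sqrt (\<epsilon> / L\<^sup>2) \<le> sqrt t" using True by simp
      then have "sqrt \<epsilon> / L \<le> sqrt t" using L by (simp add: real_sqrt_divide)
      then have "1 / sqrt t \<le> (1 / sqrt \<epsilon>) * L" using \<epsilon> L t by (simp add: field_simps)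
      then have "(1 / sqrt t) ^ CARD('n) \<le> ((1 / sqrt \<epsilon>) * L) ^ CARD('n)"
        using t by (intro power_mono) auto
      then have "heat_factor b t x u \<le> ((1 / sqrt \<epsilon>) * L) ^ CARD('n) * 1"
        unfolding heat_factor_def using assms(1) t \<epsilon> L by (intro mult_mono) auto
      also have "\<dots> = (1 / sqrt \<epsilon>) ^ CARD('n) * L ^ CARD('n)"
        by (simp only: power_mult_distrib mult_1_right)
      also have "\<dots> \<le> C * L ^ CARD('n)"
        using C1(1) assms L by (intro mult_right_mono) (auto simp: C_def)
      finally show ?thesis .
    next
      case False
      define r0 where "r0 = \<delta> / (2 * L)"
      have r0: "r0 > 0" using assms L by (simp add: r0_def)
      have "norm (D t *v x - x) \<le> M * t * norm x" using lipschitz[of t x] t by simp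
      also have "\<dots> \<le> M * (\<epsilon> / L\<^sup>2) * (X * L)"
        using False x pos t \<epsilon> by (intro mult_mono) auto
      also have "\<dots> = r0" using L pos assms by (simp add: \<epsilon>_def r0_def power2_eq_square)
      finally have "norm (D t *v x - x) \<le> r0" .
      moreover have "norm (x - u) \<le> norm (u - D t *v x) + norm (D t *v x - x)"
        using norm_triangle_ineq[of "D t *v x - u" "x - D t *v x"] by (simp add: norm_minus_commute)
      moreover have "\<delta> / L = 2 * r0" by (simp add: r0_def)
      ultimately have "r0 \<le> norm (u - D t *v x)" using xu by linarith
      then have "r0\<^sup>2 \<le> (norm (u - D t *v x))\<^sup>2" using r0 by (intro power_mono) auto
      then have "b * r0\<^sup>2 / t \<le> b * (norm (u - D t *v x))\<^sup>2 / t"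
        using assms(1) t by (intro divide_right_mono mult_left_mono) auto
      then have "heat_factor b t x u \<le> (1 / sqrt t) ^ CARD('n) * exp (- b * r0\<^sup>2 / t)"
        unfolding heat_factor_def using t by (intro mult_left_mono) auto
      also have "\<dots> \<le> C1 / (r0 ^ CARD('n) * max 1 r0)" by (rule C1(2)[OF t r0])
      also have "\<dots> \<le> C1 / (r0 ^ CARD('n) * 1)"
        using C1(1) r0 by (intro divide_left_mono mult_left_mono) auto
      also have "\<dots> = C1 * (2 / \<delta>) ^ CARD('n) * L ^ CARD('n)"
        using L assms by (simp add: r0_def power_divide power_mult_distrib)
      also have "\<dots> \<le> C * L ^ CARD('n)"
        using \<epsilon> L by (intro mult_right_mono) (auto simp: C_def)
      finally show ?thesis .
    qed
  qed
qed

text \<open>At distances below \<open>1 / L\<close> from \<open>D t *v x\<close> the off-diagonal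
  bound \<open>O(L^n)\<close> replaces the Gaussian one, so the distance may be cut off at
  \<open>1 / L\<close>; there \<open>max 1 r = 1\<close> because \<open>L \<ge> 1\<close>.\<close>

lemma heat_factor_global_bound:
  assumes "b > 0" "\<delta> > 0" "X > 0"
  obtains C where "C > 0" "\<And>L x u t r. L \<ge> 1 \<Longrightarrow> norm x \<le> X * L \<Longrightarrow> norm (x - u) \<ge> \<delta> / L \<Longrightarrow>
    0 < t \<Longrightarrow> t \<le> 1 \<Longrightarrow> r = max (norm (u - D t *v x)) (1 / L) \<Longrightarrow>
    heat_factor b t x u \<le> C / (r ^ CARD('n) * max 1 r)"
proof -
  obtain C1 where C1: "C1 > 0" "\<And>t r. 0 < t \<Longrightarrow> t \<le> 1 \<Longrightarrow> r > 0 \<Longrightarrow>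
      (1 / sqrt t) ^ CARD('n) * exp (- b * r\<^sup>2 / t) \<le> C1 / (r ^ CARD('n) * max 1 r)"
    using heat_factor_bound[OF assms(1), of "CARD('n)"] by blast
  obtain C2 where C2: "C2 > 0" "\<And>L x u t. L \<ge> 1 \<Longrightarrow> norm x \<le> X * L \<Longrightarrow> norm (x - u) \<ge> \<delta> / L \<Longrightarrow>
    0 < t \<Longrightarrow> t \<le> 1 \<Longrightarrow> heat_factor b t x u \<le> C2 * L ^ CARD('n)"
    using heat_factor_off_diagonal[OF assms] by metis
  show ?thesis
  proof (rule that[of "max C1 C2"])
    fix L t r :: real and x u :: "real^'n"
    assume L: "L \<ge> 1" and x: "norm x \<le> X * L" and xu: "norm (x - u) \<ge> \<delta> / L" and t: "0 < t" "t \<le> 1"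
      and r: "r = max (norm (u - D t *v x)) (1 / L)"
    have rpos: "r > 0" using L r by (simp add: less_max_iff_disj)
    show "heat_factor b t x u \<le> max C1 C2 / (r ^ CARD('n) * max 1 r)"
    proof (cases "norm (u - D t *v x) \<le> 1 / L")
      case True
      then have r': "r = 1 / L" "max 1 r = 1" using L r by simp_all
      have "heat_factor b t x u \<le> C2 * L ^ CARD('n)" by (rule C2(2)[OF L x xu t])
      also have "\<dots> \<le> max C1 C2 * L ^ CARD('n)" using L by (intro mult_right_mono) auto
      also have "L ^ CARD('n) = 1 / (r ^ CARD('n) * max 1 r)"
        by (subst r'(2)) (simp add: r'(1) power_one_over)
      finally show ?thesis by simp
    next
      case False
      then have "r = norm (u - D t *v x)" using r by simp
      then have "heat_factor b t x u \<le> C1 / (r ^ CARD('n) * max 1 r)"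
        using C1(2)[OF t rpos] by (simp add: heat_factor_def)
      also have "\<dots> \<le> max C1 C2 / (r ^ CARD('n) * max 1 r)"
        using rpos by (intro divide_right_mono) auto
      finally show ?thesis .
    qed
  qed (use C1 in simp)
qed

lemma shell_norm:
  obtains X1 X2 where "X1 > 0" "X2 > 0"
    "\<And>k x. x \<in> shell k \<Longrightarrow> X1 * 2 ^ k \<le> norm x" "\<And>k x. x \<in> shell k \<Longrightarrow> norm x \<le> X2 * 2 ^ k"
    "\<And>x. R x < 1 \<Longrightarrow> norm x \<le> X2"
proof (rule that[of "1 / sqrt hi" "2 / sqrt lo"])
  have p4: "(4 :: real) ^ k = (2 ^ k)\<^sup>2" for k by (simp add: power2_eq_square flip: power_mult_distrib)
  fix k x assume "x \<in> shell k"
  then have x: "(2 ^ k)\<^sup>2 \<le> R x" "R x < 4 * (2 ^ k)\<^sup>2" by (simp_all add: shell_def p4)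
  show "1 / sqrt hi * 2 ^ k \<le> norm x"
  proof (rule power2_le_imp_le)
    show "(1 / sqrt hi * 2 ^ k)\<^sup>2 \<le> (norm x)\<^sup>2"
      using x(1) R_upper[of x] pos by (simp add: power_mult_distrib power_divide field_simps)
  qed simp
  show "norm x \<le> 2 / sqrt lo * 2 ^ k"
  proof (rule power2_le_imp_le)
    show "(norm x)\<^sup>2 \<le> (2 / sqrt lo * 2 ^ k)\<^sup>2"
      using x(2) R_lower[of x] pos by (simp add: power_mult_distrib power_divide field_simps)
  qed (use pos in simp)
next
  fix x assume x: "R x < 1"
  show "norm x \<le> 2 / sqrt lo"
  proof (rule power2_le_imp_le)
    show "(norm x)\<^sup>2 \<le> (2 / sqrt lo)\<^sup>2"
      using x R_lower[of x] pos by (simp add: power_divide field_simps)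
  qed (use pos in simp)
qed (use pos in auto)

text \<open>A flow line meeting \<open>cball u r\<close> at time \<open>t\<close> stays within distance \<open>O(r)\<close> of \<open>u\<close> for a time of order
  \<open>min r 1 / L\<close>, where \<open>L = 2 ^ k\<close> is the size of the points of the shell. Averaging over that
  time turns the pointwise bound of the kernel at scale \<open>r = 2 ^ j / L\<close> into the \<open>j\<close>-th term.\<close>

lemma heat_factor_le_flow_average:
  assumes "b > 0" "\<delta> > 0"
  obtains A1 A2 c C where "A1 > 0" "A2 > 0" "c > 0" "C > 0"
    "\<And>k x u t. x \<in> shell k \<Longrightarrow> norm (x - u) \<ge> \<delta> / (1 + norm x) \<Longrightarrow> 0 < t \<Longrightarrow> t \<le> 1 \<Longrightarrow>
       ennreal (heat_factor b t x u) \<le> ennreal C * (\<integral>\<^sup>+s. dyadic_kernel A1 A2 c k (D s *v x) u \<partial>lborel)"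
proof -
  obtain X1 X2 where X: "X1 > 0" "X2 > 0"
    "\<And>k x. x \<in> shell k \<Longrightarrow> X1 * 2 ^ k \<le> norm x" "\<And>k x. x \<in> shell k \<Longrightarrow> norm x \<le> X2 * 2 ^ k"
    using shell_norm by metis
  \<comment> \<open>Times up to 2 suffice: \<open>t \<le> 1\<close> followed by a window of length
    at most 1.\<close>
  obtain N where N: "N \<ge> 1" "\<And>s x. \<bar>s\<bar> \<le> 2 \<Longrightarrow> norm (D s *v x) \<le> N * norm x"
    "\<And>s x. \<bar>s\<bar> \<le> 2 \<Longrightarrow> norm x \<le> N * norm (D s *v x)"
    using flow_bounded[of 2] by blast
  \<comment> \<open>On the shell \<open>1 + norm x \<le> (1 + X2) * L\<close>, so
    \<open>\<delta> / (1 + norm x)\<close> is at least \<open>\<delta>' / L\<close>.\<close>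
  define \<delta>' where "\<delta>' = \<delta> / (1 + X2)"
  have \<delta>': "\<delta>' > 0" using assms X by (simp add: \<delta>'_def)
  obtain C where C: "C > 0" "\<And>L x u t r. L \<ge> 1 \<Longrightarrow> norm x \<le> X2 * L \<Longrightarrow> norm (x - u) \<ge> \<delta>' / L \<Longrightarrow>
    0 < t \<Longrightarrow> t \<le> 1 \<Longrightarrow> r = max (norm (u - D t *v x)) (1 / L) \<Longrightarrow>
    heat_factor b t x u \<le> C / (r ^ CARD('n) * max 1 r)"
    using heat_factor_global_bound[OF assms(1) \<delta>' X(2)] by metis
  define A1 where "A1 = X1 / N"
  define A2 where "A2 = X2 * N"
  \<comment> \<open>The 1 accounts for the distance at time \<open>t\<close>, and
    \<open>M * N * X2\<close> for the motion during the window, at speed at most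
    \<open>M * N * X2 * L\<close>.\<close>
  define c where "c = 1 + M * N * X2"
  define C' where "C' = C * 2 ^ Suc CARD('n)"
  show ?thesis
  proof (rule that[of A1 A2 c C'])
    show "A1 > 0" "A2 > 0" "c > 0" "C' > 0"
      using X N(1) C pos by (simp_all add: A1_def A2_def c_def C'_def add_pos_nonneg)
    fix k and t :: real and x u :: "real^'n"
    assume x: "x \<in> shell k" and xu: "norm (x - u) \<ge> \<delta> / (1 + norm x)" and t: "0 < t" "t \<le> 1"
    define L :: real where "L = 2 ^ k"
    have L: "L \<ge> 1" by (simp add: L_def)
    have xL: "norm x \<le> X2 * L" "X1 * L \<le> norm x" using X x by (simp_all add: L_def)
    have "1 + norm x \<le> (1 + X2) * L" using xL(1) L by (simp add: distrib_right)
    then have "\<delta>' / L \<le> \<delta> / (1 + norm x)"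
      unfolding \<delta>'_def divide_divide_eq_left using assms X(2) L
      by (intro divide_left_mono mult_pos_pos add_pos_nonneg) auto
    then have xu': "norm (x - u) \<ge> \<delta>' / L" using xu by linarith
    define r where "r = max (norm (u - D t *v x)) (1 / L)"
    have r: "r \<ge> 1 / L" "norm (u - D t *v x) \<le> r" by (simp_all add: r_def)
    have rpos: "r > 0" using r(1) L by (auto intro: less_le_trans[of 0 "1 / L"])
    obtain j where j: "r \<le> 2 ^ j / L" "2 ^ j / L \<le> 2 * r" using dyadic_scale[OF L r(1)] by blast
    define \<rho> where "\<rho> = 2 ^ j / L"
    have \<rho>: "\<rho> > 0" using L by (simp add: \<rho>_def)
    \<comment> \<open>Within time \<open>\<rho> / L\<close> the flow moves by
      \<open>O(\<rho>)\<close>. The cut-off at \<open>1 / L\<close> keeps the window shorter than 1,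
      where the Lipschitz bound is valid.\<close>
    define w where "w = min \<rho> 1 / L"
    have w: "0 < w" "w \<le> 1" "w \<le> \<rho> / L" using \<rho> L by (auto simp: w_def min_def divide_simps)
    have hf: "heat_factor b t x u \<le> C' / (\<rho> ^ CARD('n) * max 1 \<rho>)"
    proof -
      have "heat_factor b t x u \<le> C / (r ^ CARD('n) * max 1 r)"
        by (rule C(2)[OF L xL(1) xu' t r_def])
      also have "\<dots> \<le> C / ((\<rho> / 2) ^ CARD('n) * (max 1 \<rho> / 2))"
        using C(1) \<rho> rpos j by (intro divide_left_mono mult_mono power_mono) (auto simp: \<rho>_def[symmetric])
      also have "\<dots> = C' / (\<rho> ^ CARD('n) * max 1 \<rho>)"
        by (simp add: C'_def power_divide mult_ac)
      finally show ?thesis .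
    qed
    have window: "ennreal (L / \<rho> ^ Suc CARD('n)) * indicator {t..t + w} s \<le> dyadic_kernel A1 A2 c k (D s *v x) u" for s
    proof (cases "s \<in> {t..t + w}")
      case True
      then have s: "\<bar>s\<bar> \<le> 2" "\<bar>s - t\<bar> \<le> w" using t w by auto
      have "norm (D s *v x) \<le> A2 * 2 ^ k"
        using order_trans[OF N(2)[OF s(1), of x] mult_left_mono[OF xL(1), of N]] N(1)
        by (simp add: A2_def L_def mult_ac)
      moreover have "A1 * 2 ^ k \<le> norm (D s *v x)"
        using N(3)[OF s(1), of x] xL(2) N(1) by (simp add: A1_def L_def field_simps)
      moreover have "dist u (D s *v x) \<le> c * \<rho>"
      proof -
        have "norm (D s *v x - D t *v x) = norm (D (s - t) *v (D t *v x) - D t *v x)"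
          by (simp add: D_D)
        also have "\<dots> \<le> M * \<bar>s - t\<bar> * norm (D t *v x)" using s w by (intro lipschitz) simp
        also have "\<dots> \<le> M * (\<rho> / L) * (N * (X2 * L))"
        proof (intro mult_mono)
          show "norm (D t *v x) \<le> N * (X2 * L)"
            using order_trans[OF N(2)[of t x] mult_left_mono[OF xL(1), of N]] t N(1) by simp
        qed (use s w pos L \<rho> in auto)
        also have "\<dots> = M * N * X2 * \<rho>" using L by simp
        finally have "norm (D s *v x - D t *v x) \<le> M * N * X2 * \<rho>" .
        moreover have "norm (u - D s *v x) \<le> norm (u - D t *v x) + norm (D s *v x - D t *v x)"
          using norm_triangle_ineq[of "u - D t *v x" "D t *v x - D s *v x"] by (simp add: norm_minus_commute)
        ultimately show ?thesis using r(2) j(1) by (simp add: dist_norm c_def distrib_right \<rho>_def[symmetric])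
      qed
      ultimately have "ennreal (L / \<rho> ^ Suc CARD('n)) * indicator {t..t + w} s
          \<le> indicator {A1 * 2 ^ k..A2 * 2 ^ k} (norm (D s *v x)) *
            (ennreal (2 ^ k / (2 ^ j / 2 ^ k) ^ Suc CARD('n)) * indicator {..c * (2 ^ j / 2 ^ k)} (dist u (D s *v x)))"
        using True by (simp add: L_def \<rho>_def)
      also have "\<dots> \<le> dyadic_kernel A1 A2 c k (D s *v x) u"
        unfolding dyadic_kernel_def
        by (intro mult_left_mono ennreal_le_suminf[where j = j and
              f = "\<lambda>j. ennreal (2 ^ k / (2 ^ j / 2 ^ k) ^ Suc CARD('n)) *
                indicator {..c * (2 ^ j / 2 ^ k)} (dist u (D s *v x))"]) simp
      finally show ?thesis .
    qed simp
    have "heat_factor b t x u \<le> C' * (L / \<rho> ^ Suc CARD('n) * w)"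
    proof -
      have "max 1 \<rho> * min \<rho> 1 = \<rho>" by (simp add: max_def min_def)
      then have "C' * (L / \<rho> ^ Suc CARD('n) * w) = C' / (\<rho> ^ CARD('n) * max 1 \<rho>)"
        using \<rho> L by (auto simp: w_def field_simps max_def min_def split: if_splits)
      then show ?thesis using hf by simp
    qed
    then have "ennreal (heat_factor b t x u) \<le> ennreal C' * (ennreal (L / \<rho> ^ Suc CARD('n)) * ennreal w)"
      using \<rho> L w C(1) by (simp add: C'_def ennreal_leI flip: ennreal_mult)
    also have "ennreal (L / \<rho> ^ Suc CARD('n)) * ennreal w
        = (\<integral>\<^sup>+s. ennreal (L / \<rho> ^ Suc CARD('n)) * indicator {t..t + w} s \<partial>lborel)"
      using w by (simp add: nn_integral_cmult_indicator)
    also have "ennreal C' * \<dots> \<le> ennreal C' * (\<integral>\<^sup>+s. dyadic_kernel A1 A2 c k (D s *v x) u \<partial>lborel)"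
      by (intro mult_left_mono nn_integral_mono window) simp
    finally show "ennreal (heat_factor b t x u) \<le> ennreal C' * (\<integral>\<^sup>+s. dyadic_kernel A1 A2 c k (D s *v x) u \<partial>lborel)" .
  qed
qed

text \<open>At both ends of the flow segment \<open>R\<close> is of order \<open>4^k\<close>, while
  it grows by a factor of at least \<open>1 + a * \<bar>s\<bar>\<close> from the earlier point to
  the later one. The two summands of \<open>T\<close> belong to the two signs of
  \<open>s\<close>.\<close>

lemma flow_time_bounded:
  assumes "A1 > 0" "A2 > 0"
  obtains T where "T \<ge> 0" "\<And>k x s. x \<in> shell k \<Longrightarrow> norm (D s *v x) \<in> {A1 * 2 ^ k..A2 * 2 ^ k} \<Longrightarrow> \<bar>s\<bar> \<le> T"
proof -
  have p4: "(4 :: real) ^ k = (2 ^ k)\<^sup>2" for k by (simp add: power2_eq_square flip: power_mult_distrib)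
  define T where "T = (hi * A2\<^sup>2 + 4 / (lo * A1\<^sup>2)) / a"
  show ?thesis
  proof (rule that[of T])
    show "T \<ge> 0" using pos by (simp add: T_def)
    fix k s and x :: "real^'n" assume x: "x \<in> shell k" and s: "norm (D s *v x) \<in> {A1 * 2 ^ k..A2 * 2 ^ k}"
    define z where "z = D s *v x"
    define q where "q = (4 :: real) ^ k"
    have q: "q > 0" by (simp add: q_def)
    have Rx: "q \<le> R x" "R x < 4 * q" using x by (simp_all add: shell_def q_def)
    have Rz: "lo * A1\<^sup>2 * q \<le> R z" "R z \<le> hi * A2\<^sup>2 * q"
    proof -
      have "lo * (A1 * 2 ^ k)\<^sup>2 \<le> lo * (norm z)\<^sup>2"
        using s assms pos by (intro mult_left_mono power_mono) (auto simp: z_def)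
      then show "lo * A1\<^sup>2 * q \<le> R z"
        using R_lower[of z] by (simp add: q_def p4 power_mult_distrib)
      have "hi * (norm z)\<^sup>2 \<le> hi * (A2 * 2 ^ k)\<^sup>2"
        using s pos by (intro mult_left_mono power_mono) (auto simp: z_def)
      then show "R z \<le> hi * A2\<^sup>2 * q"
        using R_upper[of z] by (simp add: q_def p4 power_mult_distrib)
    qed
    have "a * \<bar>s\<bar> \<le> hi * A2\<^sup>2 + 4 / (lo * A1\<^sup>2)"
    proof (cases "s \<ge> 0")
      case True
      have "(1 + a * s) * q \<le> (1 + a * s) * R x" using Rx pos True by (intro mult_left_mono) auto
      also have "\<dots> \<le> R z" unfolding z_def by (rule growth[OF True])
      also have "\<dots> \<le> hi * A2\<^sup>2 * q" by (rule Rz)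
      finally have "1 + a * s \<le> hi * A2\<^sup>2" using q by simp
      moreover have "4 / (lo * A1\<^sup>2) \<ge> 0" using pos by simp
      moreover have "a * \<bar>s\<bar> = a * s" using True by simp
      ultimately show ?thesis by linarith
    next
      case False
      have "(1 + a * (- s)) * (lo * A1\<^sup>2 * q) \<le> (1 + a * (- s)) * R z"
      proof (intro mult_left_mono Rz)
        have "a * (- s) \<ge> 0" using pos False by (intro mult_nonneg_nonneg) auto
        then show "0 \<le> 1 + a * (- s)" by linarith
      qed
      also have "\<dots> \<le> R (D (- s) *v z)" using False by (intro growth) simp
      also have "\<dots> = R x" by (simp add: z_def D_D D_0)
      also have "\<dots> \<le> 4 * q" using Rx by simp
      finally have "((1 + a * (- s)) * (lo * A1\<^sup>2)) * q \<le> 4 * q" by (simp only: mult.assoc)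
      then have "(1 + a * (- s)) * (lo * A1\<^sup>2) \<le> 4" using q by simp
      then have "1 + a * (- s) \<le> 4 / (lo * A1\<^sup>2)" using pos assms by (simp add: pos_le_divide_eq)
      moreover have "hi * A2\<^sup>2 \<ge> 0" using pos by simp
      moreover have "a * \<bar>s\<bar> = a * (- s)" using False by simp
      ultimately show ?thesis by linarith
    qed
    then show "\<bar>s\<bar> \<le> T" using pos by (simp add: T_def pos_le_divide_eq mult.commute)
  qed
qed

end

section \<open>The weak type estimate\<close>

context expanding_flow
begin

text \<open>\<open>weak_type_flow_average\<close> with \<Psi> the dyadic kernel integrated against
  \<open>F\<close>, and \<open>m = 4^k\<close>. The resulting \<open>1 / 4^k\<close> stays next to
  the kernel under the integral in \<open>u\<close>, so that the sum over \<open>k\<close> can be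
  taken there.\<close>

lemma exp_sublevel_integral_shell:
  fixes T F :: "real^'n \<Rightarrow> ennreal" and k :: nat
  assumes [measurable]: "F \<in> borel_measurable borel" "T \<in> borel_measurable borel"
    and F: "(\<integral>\<^sup>+u. F u \<partial>lborel) < \<infinity>" and A: "A1 > 0" "A2 > 0"
    and N: "N \<ge> 1" "\<And>s x. \<bar>s\<bar> \<le> t0 \<Longrightarrow> norm x \<le> N * norm (D s *v x)"
    and t0: "t0 \<ge> 0" "\<And>k x s. x \<in> shell k \<Longrightarrow> norm (D s *v x) \<in> {A1 * 2 ^ k..A2 * 2 ^ k} \<Longrightarrow> \<bar>s\<bar> \<le> t0"
    and C: "C > 0" and \<alpha>: "\<alpha> > 0"
    and T: "\<And>x. x \<in> shell k \<Longrightarrow> T x \<le> ennreal (C * exp (R x)) *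
       (\<integral>\<^sup>+u. (\<integral>\<^sup>+s. dyadic_kernel A1 A2 c k (D s *v x) u \<partial>lborel) * F u \<partial>lborel)"
  shows "(\<integral>\<^sup>+x. indicator {x \<in> shell k. ennreal \<alpha> < T x} x * ennreal (exp (- R x)) \<partial>lborel)
    \<le> ennreal (N ^ CARD('n) * C / (\<alpha> * a)) *
      (\<integral>\<^sup>+u. (ennreal (1 / 4 ^ k) * (\<integral>\<^sup>+z. dyadic_kernel A1 A2 c k z u \<partial>lborel)) * F u \<partial>lborel)"
proof -
  define \<Psi> where "\<Psi> z = (\<integral>\<^sup>+u. dyadic_kernel A1 A2 c k z u * F u \<partial>lborel)" for z
  have [measurable]: "\<Psi> \<in> borel_measurable borel" unfolding \<Psi>_def[abs_def] by measurable
  obtain K where K: "K < \<infinity>" "\<And>(z :: real^'n) u. dyadic_kernel A1 A2 c k z u \<le> K" by (rule dyadic_kernel_bounded[of A1 A2 c k]) blast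
  have avg: "(\<integral>\<^sup>+u. (\<integral>\<^sup>+s. dyadic_kernel A1 A2 c k (D s *v x) u \<partial>lborel) * F u \<partial>lborel) = (\<integral>\<^sup>+s. \<Psi> (D s *v x) \<partial>lborel)" for x
  proof -
    have "(\<integral>\<^sup>+u. (\<integral>\<^sup>+s. dyadic_kernel A1 A2 c k (D s *v x) u \<partial>lborel) * F u \<partial>lborel)
        = (\<integral>\<^sup>+u. (\<integral>\<^sup>+s. dyadic_kernel A1 A2 c k (D s *v x) u * F u \<partial>lborel) \<partial>lborel)"
      by (intro nn_integral_cong nn_integral_multc[symmetric]) measurable
    also have "\<dots> = (\<integral>\<^sup>+s. (\<integral>\<^sup>+u. dyadic_kernel A1 A2 c k (D s *v x) u * F u \<partial>lborel) \<partial>lborel)"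
      by (rule lborel_pair.Fubini') measurable
    finally show ?thesis by (simp only: \<Psi>_def)
  qed
  have meas: "{x \<in> shell k. ennreal \<alpha> < T x} \<in> sets borel"
    unfolding shell_def by measurable
  have "(\<integral>\<^sup>+x. indicator {x \<in> shell k. ennreal \<alpha> < T x} x * ennreal (exp (- R x)) \<partial>lborel)
      \<le> ennreal (N ^ CARD('n) * C / (\<alpha> * a * 4 ^ k)) * (\<integral>\<^sup>+z. \<Psi> z \<partial>lborel)"
  proof (rule weak_type_flow_average[where K = "K * (\<integral>\<^sup>+u. F u \<partial>lborel)" and T = t0])
    show "R x \<ge> 4 ^ k" if "x \<in> {x \<in> shell k. ennreal \<alpha> < T x}" for x
      using that by (simp add: shell_def)
    show "K * (\<integral>\<^sup>+u. F u \<partial>lborel) < \<infinity>" using K(1) F by (simp add: ennreal_mult_less_top)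
    show "\<Psi> z \<le> K * (\<integral>\<^sup>+u. F u \<partial>lborel)" for z
    proof -
      have "\<Psi> z \<le> (\<integral>\<^sup>+u. K * F u \<partial>lborel)"
        unfolding \<Psi>_def by (intro nn_integral_mono mult_right_mono K(2)) simp
      then show ?thesis by (simp add: nn_integral_cmult)
    qed
    show "\<bar>s\<bar> \<le> t0" if "x \<in> {x \<in> shell k. ennreal \<alpha> < T x}" "\<Psi> (D s *v x) \<noteq> 0" for x s
    proof (rule t0(2))
      show "x \<in> shell k" using that(1) by simp
      show "norm (D s *v x) \<in> {A1 * 2 ^ k..A2 * 2 ^ k}"
      proof (rule ccontr)
        assume "\<not> ?thesis"
        then have "dyadic_kernel A1 A2 c k (D s *v x) u = 0" for u
          unfolding dyadic_kernel_def by (simp only: indicator_simps mult_zero_left not_False_eq_True)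
        then show False using that(2) by (simp add: \<Psi>_def)
      qed
    qed
    show "ennreal \<alpha> < ennreal (C * exp (R x)) * (\<integral>\<^sup>+s. \<Psi> (D s *v x) \<partial>lborel)"
      if "x \<in> {x \<in> shell k. ennreal \<alpha> < T x}" for x
      using that T[of x] by (auto simp: avg)
  qed (use meas N t0 C \<alpha> in auto)
  also have "(\<integral>\<^sup>+z. \<Psi> z \<partial>lborel) = (\<integral>\<^sup>+u. (\<integral>\<^sup>+z. dyadic_kernel A1 A2 c k z u * F u \<partial>lborel) \<partial>lborel)"
    unfolding \<Psi>_def by (rule lborel_pair.Fubini') measurable
  also have "\<dots> = (\<integral>\<^sup>+u. (\<integral>\<^sup>+z. dyadic_kernel A1 A2 c k z u \<partial>lborel) * F u \<partial>lborel)"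
    by (intro nn_integral_cong nn_integral_multc) measurable
  also have "ennreal (N ^ CARD('n) * C / (\<alpha> * a * 4 ^ k)) = ennreal (N ^ CARD('n) * C / (\<alpha> * a)) * ennreal (1 / 4 ^ k)"
    using N(1) C \<alpha> pos by (subst ennreal_mult[symmetric]) auto
  also have "\<dots> * (\<integral>\<^sup>+u. (\<integral>\<^sup>+z. dyadic_kernel A1 A2 c k z u \<partial>lborel) * F u \<partial>lborel)
      = ennreal (N ^ CARD('n) * C / (\<alpha> * a)) *
        (\<integral>\<^sup>+u. ennreal (1 / 4 ^ k) * ((\<integral>\<^sup>+z. dyadic_kernel A1 A2 c k z u \<partial>lborel) * F u) \<partial>lborel)"
    by (subst nn_integral_cmult) (measurable, simp only: mult.assoc)
  finally show ?thesis by (simp only: mult.assoc)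
qed

text \<open>\<open>T\<close> is bounded here by a multiple of the integral of \<open>F\<close>, so
  where it exceeds \<alpha> that multiple over \<alpha> is at least 1. The region lies in a ball,
  whose finite volume completes the estimate.\<close>

lemma exp_sublevel_integral_central:
  fixes T F :: "real^'n \<Rightarrow> ennreal"
  assumes C: "C \<ge> 0" and \<alpha>: "\<alpha> > 0" and X: "\<And>x. R x < 1 \<Longrightarrow> norm x \<le> X" "X > 0"
    and [measurable]: "T \<in> borel_measurable borel"
    and T: "\<And>x. R x < 1 \<Longrightarrow> T x \<le> ennreal C * (\<integral>\<^sup>+u. F u \<partial>lborel)"
  shows "(\<integral>\<^sup>+x. indicator {x. R x < 1 \<and> ennreal \<alpha> < T x} x * ennreal (exp (- R x)) \<partial>lborel)
    \<le> ennreal (unit_ball_vol CARD('n) * X ^ CARD('n) * C / \<alpha>) * (\<integral>\<^sup>+u. F u \<partial>lborel)"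
proof -
  let ?I = "\<integral>\<^sup>+u. F u \<partial>lborel"
  have cb: "cball (0 :: real^'n) X \<in> sets lborel" by (simp only: sets_lborel borel_closed[OF closed_cball])
  have "(\<integral>\<^sup>+x. indicator {x. R x < 1 \<and> ennreal \<alpha> < T x} x * ennreal (exp (- R x)) \<partial>lborel)
      \<le> (\<integral>\<^sup>+x. (ennreal (C / \<alpha>) * ?I) * indicator (cball (0 :: real^'n) X) x \<partial>lborel)"
  proof (rule nn_integral_mono)
    fix x :: "real^'n"
    show "indicator {x. R x < 1 \<and> ennreal \<alpha> < T x} x * ennreal (exp (- R x))
        \<le> (ennreal (C / \<alpha>) * ?I) * indicator (cball 0 X) x"
    proof (cases "R x < 1 \<and> ennreal \<alpha> < T x")
      case True
      have "ennreal (exp (- R x)) \<le> 1" using R_nonneg[of x] by simp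
      also have "1 = ennreal (1 / \<alpha>) * ennreal \<alpha>" using \<alpha> by (simp flip: ennreal_mult)
      also have "\<dots> \<le> ennreal (1 / \<alpha>) * (ennreal C * ?I)"
        using True T[of x] by (intro mult_left_mono) (auto intro: order_trans less_imp_le)
      also have "\<dots> = ennreal (C / \<alpha>) * ?I"
        using C \<alpha> by (simp add: mult.assoc[symmetric] flip: ennreal_mult)
      finally show ?thesis using True X(1)[of x] by simp
    qed simp
  qed
  also have "\<dots> = (ennreal (C / \<alpha>) * ?I) * ennreal (unit_ball_vol CARD('n) * X ^ CARD('n))"
    using X(2) by (simp add: nn_integral_cmult_indicator[OF cb] emeasure_cball)
  also have "\<dots> = ennreal (unit_ball_vol CARD('n) * X ^ CARD('n) * C / \<alpha>) * ?I"
  proof -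
    have "unit_ball_vol CARD('n) * X ^ CARD('n) * C / \<alpha> = (C / \<alpha>) * (unit_ball_vol CARD('n) * X ^ CARD('n))"
      by simp
    then have "ennreal (unit_ball_vol CARD('n) * X ^ CARD('n) * C / \<alpha>)
        = ennreal (C / \<alpha>) * ennreal (unit_ball_vol CARD('n) * X ^ CARD('n))"
      using X(2) C \<alpha> by (simp only:) (rule ennreal_mult, auto)
    then show ?thesis by (simp only: mult_ac)
  qed
  finally show ?thesis .
qed

text \<open>The supremum over \<open>t\<close> enters through its upper bounds \<open>y\<close>: the
  constant bound is inserted for \<open>y\<close> in the central region and the flow average on the
  shells.\<close>

theorem weak_type_global_kernel:
  assumes b: "b > 0" and \<delta>: "\<delta> > 0" and A: "A > 0"
  obtains C where "C > 0"
    "\<And>\<K> F \<alpha>. (\<lambda>(x, u). \<K> x u) \<in> borel_measurable (borel \<Otimes>\<^sub>M borel) \<Longrightarrow> F \<in> borel_measurable borel \<Longrightarrow>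
      (\<integral>\<^sup>+u. F u \<partial>lborel) < \<infinity> \<Longrightarrow> \<alpha> > 0 \<Longrightarrow>
      (\<And>x u. norm (x - u) < \<delta> / (1 + norm x) \<Longrightarrow> \<K> x u = 0) \<Longrightarrow>
      (\<And>x u y. (\<And>t. 0 < t \<Longrightarrow> t \<le> 1 \<Longrightarrow> ennreal (heat_factor b t x u) \<le> y) \<Longrightarrow>
         \<K> x u \<le> ennreal (A * exp (R x)) * y) \<Longrightarrow>
      (\<integral>\<^sup>+x. indicator {x. ennreal \<alpha> < (\<integral>\<^sup>+u. \<K> x u * F u \<partial>lborel)} x * ennreal (exp (- R x)) \<partial>lborel)
        \<le> ennreal (C / \<alpha>) * (\<integral>\<^sup>+u. F u \<partial>lborel)"
proof -
  obtain A1 A2 c C1 where c: "A1 > 0" "A2 > 0" "c > 0" "C1 > 0" and avg: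
    "\<And>k x u t. x \<in> shell k \<Longrightarrow> norm (x - u) \<ge> \<delta> / (1 + norm x) \<Longrightarrow> 0 < t \<Longrightarrow> t \<le> 1 \<Longrightarrow>
       ennreal (heat_factor b t x u) \<le> ennreal C1 * (\<integral>\<^sup>+s. dyadic_kernel A1 A2 c k (D s *v x) u \<partial>lborel)"
    by (rule heat_factor_le_flow_average[OF b \<delta>]) blast
  obtain t0 where t0: "t0 \<ge> 0"
    "\<And>k x s. x \<in> shell k \<Longrightarrow> norm (D s *v x) \<in> {A1 * 2 ^ k..A2 * 2 ^ k} \<Longrightarrow> \<bar>s\<bar> \<le> t0"
    by (rule flow_time_bounded[OF c(1,2)]) blast
  obtain N where N: "N \<ge> 1" "\<And>s x. \<bar>s\<bar> \<le> t0 \<Longrightarrow> norm x \<le> N * norm (D s *v x)"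
    by (rule flow_bounded[of t0]) blast
  obtain W where W: "W > 0"
    "\<And>u :: real^'n. (\<Sum>k. ennreal (1 / 4 ^ k) * (\<integral>\<^sup>+z. dyadic_kernel A1 A2 c k z u \<partial>lborel)) \<le> ennreal W"
    by (rule sum_dyadic_kernel_integral[OF c(1-3)]) blast
  obtain X1 X where X: "X > 0" "\<And>x. R x < 1 \<Longrightarrow> norm x \<le> X"
    by (rule shell_norm) blast
  have \<delta>': "\<delta> / (1 + X) > 0" using \<delta> X by simp
  \<comment> \<open>Needed at \<open>L = 1\<close> for the central region, where
    \<open>norm x \<le> X\<close>.\<close>
  obtain C2 where C2: "C2 > 0" "\<And>L x u t. L \<ge> 1 \<Longrightarrow> norm x \<le> X * L \<Longrightarrow> norm (x - u) \<ge> \<delta> / (1 + X) / L \<Longrightarrow>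
    0 < t \<Longrightarrow> t \<le> 1 \<Longrightarrow> heat_factor b t x u \<le> C2 * L ^ CARD('n)"
    by (rule heat_factor_off_diagonal[OF b \<delta>' X(1)]) blast
  \<comment> \<open>\<open>Ca\<close> collects the contribution of all shells, \<open>Cb\<close>
    that of the central region; there \<open>exp (R x) \<le> exp 1\<close>.\<close>
  define Ca where "Ca = N ^ CARD('n) * (A * C1) / a * W"
  define Cb where "Cb = unit_ball_vol CARD('n) * X ^ CARD('n) * (A * exp 1 * C2)"
  have Ca: "Ca > 0" using N(1) A c pos W by (simp add: Ca_def)
  have Cb: "Cb > 0" using X A C2 by (simp add: Cb_def)
  show ?thesis
  proof (rule that[of "Cb + Ca"])
    show "Cb + Ca > 0" using Ca Cb by simp
    fix \<K> :: "real^'n \<Rightarrow> real^'n \<Rightarrow> ennreal" and F :: "real^'n \<Rightarrow> ennreal" and \<alpha> :: real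
    assume mK [measurable]: "(\<lambda>(x, u). \<K> x u) \<in> borel_measurable (borel \<Otimes>\<^sub>M borel)"
      and mF [measurable]: "F \<in> borel_measurable borel"
      and F: "(\<integral>\<^sup>+u. F u \<partial>lborel) < \<infinity>" and \<alpha>: "\<alpha> > 0"
      and diag: "\<And>x u. norm (x - u) < \<delta> / (1 + norm x) \<Longrightarrow> \<K> x u = 0"
      and dom: "\<And>x u y. (\<And>t. 0 < t \<Longrightarrow> t \<le> 1 \<Longrightarrow> ennreal (heat_factor b t x u) \<le> y) \<Longrightarrow>
         \<K> x u \<le> ennreal (A * exp (R x)) * y"
    define T where "T x = (\<integral>\<^sup>+u. \<K> x u * F u \<partial>lborel)" for x
    have [measurable]: "T \<in> borel_measurable borel" unfolding T_def[abs_def] by measurable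
    let ?I = "\<integral>\<^sup>+u. F u \<partial>lborel"
    define E0 where "E0 = {x. R x < 1 \<and> ennreal \<alpha> < T x}"
    define E where "E k = {x \<in> shell k. ennreal \<alpha> < T x}" for k
    have [measurable]: "E0 \<in> sets borel" "E k \<in> sets borel" for k
      unfolding E0_def E_def shell_def by measurable
    have "T x \<le> ennreal (A * exp 1 * C2) * ?I" if x: "R x < 1" for x
    proof -
      have "T x \<le> (\<integral>\<^sup>+u. ennreal (A * exp 1 * C2) * F u \<partial>lborel)"
        unfolding T_def
      proof (intro nn_integral_mono mult_right_mono)
        fix u
        show "\<K> x u \<le> ennreal (A * exp 1 * C2)"
        proof (cases "norm (x - u) < \<delta> / (1 + norm x)")
          case False
          have "\<delta> / (1 + X) \<le> \<delta> / (1 + norm x)"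
            using X(2)[OF x] \<delta> X(1) by (intro divide_left_mono mult_pos_pos add_pos_nonneg) auto
          then have "ennreal (heat_factor b t x u) \<le> ennreal C2" if "0 < t" "t \<le> 1" for t
            using C2(2)[of 1 x u t] X(2)[OF x] False that by (intro ennreal_leI) simp
          then have "\<K> x u \<le> ennreal (A * exp (R x)) * ennreal C2" by (rule dom)
          also have "\<dots> = ennreal (A * exp (R x) * C2)" using A C2(1) by (simp flip: ennreal_mult)
          also have "\<dots> \<le> ennreal (A * exp 1 * C2)"
            using A C2(1) x by (intro ennreal_leI mult_right_mono mult_left_mono) auto
          finally show ?thesis .
        qed (simp add: diag)
      qed simp
      then show ?thesis by (simp add: nn_integral_cmult)
    qed
    then have "(\<integral>\<^sup>+x. indicator E0 x * ennreal (exp (- R x)) \<partial>lborel)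
        \<le> ennreal (unit_ball_vol CARD('n) * X ^ CARD('n) * (A * exp 1 * C2) / \<alpha>) * ?I"
      unfolding E0_def using A C2 \<alpha> X by (intro exp_sublevel_integral_central) auto
    then have central: "(\<integral>\<^sup>+x. indicator E0 x * ennreal (exp (- R x)) \<partial>lborel) \<le> ennreal (Cb / \<alpha>) * ?I"
      by (simp only: Cb_def)
    have shells: "(\<integral>\<^sup>+x. indicator (E k) x * ennreal (exp (- R x)) \<partial>lborel)
      \<le> ennreal (N ^ CARD('n) * (A * C1) / (\<alpha> * a)) *
        (\<integral>\<^sup>+u. (ennreal (1 / 4 ^ k) * (\<integral>\<^sup>+z. dyadic_kernel A1 A2 c k z u \<partial>lborel)) * F u \<partial>lborel)" for k
      unfolding E_def
    proof (rule exp_sublevel_integral_shell[OF mF _ F c(1,2) N t0])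
      fix x assume x: "x \<in> shell k"
      have "T x \<le> (\<integral>\<^sup>+u. ennreal (A * C1 * exp (R x)) * ((\<integral>\<^sup>+s. dyadic_kernel A1 A2 c k (D s *v x) u \<partial>lborel) * F u) \<partial>lborel)"
        unfolding T_def
      proof (rule nn_integral_mono)
        fix u
        have "\<K> x u \<le> ennreal (A * C1 * exp (R x)) * (\<integral>\<^sup>+s. dyadic_kernel A1 A2 c k (D s *v x) u \<partial>lborel)"
        proof (cases "norm (x - u) < \<delta> / (1 + norm x)")
          case False
          then have "\<K> x u \<le> ennreal (A * exp (R x)) * (ennreal C1 * (\<integral>\<^sup>+s. dyadic_kernel A1 A2 c k (D s *v x) u \<partial>lborel))"
            using x by (intro dom avg) auto
          also have "\<dots> = ennreal (A * exp (R x) * C1) * (\<integral>\<^sup>+s. dyadic_kernel A1 A2 c k (D s *v x) u \<partial>lborel)"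
            using A c(4) by (simp add: mult.assoc[symmetric] flip: ennreal_mult)
          finally show ?thesis by (simp only: mult_ac)
        qed (simp add: diag)
        then show "\<K> x u * F u
            \<le> ennreal (A * C1 * exp (R x)) * ((\<integral>\<^sup>+s. dyadic_kernel A1 A2 c k (D s *v x) u \<partial>lborel) * F u)"
          by (simp only: mult.assoc[symmetric] mult_right_mono zero_le)
      qed
      then show "T x \<le> ennreal (A * C1 * exp (R x)) *
          (\<integral>\<^sup>+u. (\<integral>\<^sup>+s. dyadic_kernel A1 A2 c k (D s *v x) u \<partial>lborel) * F u \<partial>lborel)"
        by (subst (asm) nn_integral_cmult) measurable
    qed (use A c \<alpha> in auto)
    have "(\<integral>\<^sup>+x. indicator {x. ennreal \<alpha> < T x} x * ennreal (exp (- R x)) \<partial>lborel)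
        \<le> (\<integral>\<^sup>+x. indicator E0 x * ennreal (exp (- R x)) + (\<Sum>k. indicator (E k) x * ennreal (exp (- R x))) \<partial>lborel)"
    proof (rule nn_integral_mono)
      fix x
      show "indicator {x. ennreal \<alpha> < T x} x * ennreal (exp (- R x))
          \<le> indicator E0 x * ennreal (exp (- R x)) + (\<Sum>k. indicator (E k) x * ennreal (exp (- R x)))"
      proof (cases "ennreal \<alpha> < T x")
        case True
        show ?thesis
        proof (cases "R x < 1")
          case False
          then obtain k where "4 ^ k \<le> R x" "R x < 4 ^ Suc k" using exists_power_shell[of "R x" 4] by (auto simp: not_less)
          then have "x \<in> E k" using True by (simp add: E_def shell_def)
          then have "ennreal (exp (- R x)) \<le> (\<Sum>k. indicator (E k) x * ennreal (exp (- R x)))"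
            using ennreal_le_suminf[of "\<lambda>k. indicator (E k) x * ennreal (exp (- R x))" k] by simp
          then show ?thesis using True by (simp add: add_increasing)
        qed (use True in \<open>simp add: E0_def\<close>)
      qed simp
    qed
    also have "\<dots> = (\<integral>\<^sup>+x. indicator E0 x * ennreal (exp (- R x)) \<partial>lborel)
        + (\<Sum>k. \<integral>\<^sup>+x. indicator (E k) x * ennreal (exp (- R x)) \<partial>lborel)"
      by (subst nn_integral_add; (subst nn_integral_suminf)?; measurable)
    also have "\<dots> \<le> ennreal (Cb / \<alpha>) * ?I + ennreal (Ca / \<alpha>) * ?I"
    proof (rule add_mono[OF central])
      let ?w = "\<lambda>k u. ennreal (1 / 4 ^ k) * (\<integral>\<^sup>+z. dyadic_kernel A1 A2 c k z u \<partial>lborel)"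
      let ?c = "ennreal (N ^ CARD('n) * (A * C1) / (\<alpha> * a))"
      have "(\<Sum>k. \<integral>\<^sup>+x. indicator (E k) x * ennreal (exp (- R x)) \<partial>lborel) \<le> (\<Sum>k. ?c * (\<integral>\<^sup>+u. ?w k u * F u \<partial>lborel))"
        by (rule suminf_le[OF shells]) auto
      also have "\<dots> = ?c * (\<integral>\<^sup>+u. (\<Sum>k. ?w k u * F u) \<partial>lborel)"
      proof -
        have m: "(\<lambda>u. ?w k u * F u) \<in> borel_measurable lborel" for k by measurable
        show ?thesis by (simp only: nn_integral_suminf[OF m] ennreal_suminf_cmult)
      qed
      also have "\<dots> \<le> ?c * (\<integral>\<^sup>+u. ennreal W * F u \<partial>lborel)"
        by (intro mult_left_mono nn_integral_mono) (simp_all only: ennreal_suminf_multc mult_right_mono W(2) zero_le)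
      also have "\<dots> = (?c * ennreal W) * ?I" by (simp add: nn_integral_cmult mult.assoc)
      also have "?c * ennreal W = ennreal (Ca / \<alpha>)"
      proof -
        have "Ca / \<alpha> = N ^ CARD('n) * (A * C1) / (\<alpha> * a) * W" by (simp add: Ca_def)
        then show ?thesis using N(1) A c \<alpha> pos W(1) by (simp only:) (rule ennreal_mult[symmetric], auto)
      qed
      finally show "(\<Sum>k. \<integral>\<^sup>+x. indicator (E k) x * ennreal (exp (- R x)) \<partial>lborel) \<le> ennreal (Ca / \<alpha>) * ?I" .
    qed
    also have "\<dots> = ennreal ((Cb + Ca) / \<alpha>) * ?I"
      using Ca Cb \<alpha> by (simp add: add_divide_distrib distrib_right)
    finally show "(\<integral>\<^sup>+x. indicator {x. ennreal \<alpha> < (\<integral>\<^sup>+u. \<K> x u * F u \<partial>lborel)} x * ennreal (exp (- R x)) \<partial>lborel)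
        \<le> ennreal ((Cb + Ca) / \<alpha>) * ?I"
      by (simp only: T_def)
  qed
qed

end

text \<open>The index set may be uncountable, as for the times in \<open>{0<..1}\<close>; a supremum
  of continuous functions is lower semicontinuous, so its strict superlevel sets are open.\<close>

lemma borel_measurable_SUP_lsc:
  fixes f :: "'i \<Rightarrow> 'a::topological_space \<Rightarrow> ennreal"
  assumes "\<And>i. i \<in> I \<Longrightarrow> continuous_on UNIV (f i)"
  shows "(\<lambda>x. SUP i\<in>I. f i x) \<in> borel_measurable borel"
proof (rule borel_measurableI_greater)
  fix y
  have "{x \<in> space borel. y < (SUP i\<in>I. f i x)} = (\<Union>i\<in>I. {x. y < f i x})"
    by (auto simp: less_SUP_iff)
  moreover have "open (\<Union>i\<in>I. {x. y < f i x})"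
    using assms by (intro open_UN ballI open_Collect_less continuous_on_const)
  ultimately show "{x \<in> space borel. y < (SUP i\<in>I. f i x)} \<in> sets borel" by simp
qed

section \<open>Application to the Mehler kernel\<close>

context stable_pair
begin

lemma exists_expanding_flow:
  obtains a lo hi M where "expanding_flow (Dt Q B) (quad_R Q B) a lo hi M"
proof -
  obtain M where M: "M > 0" "\<And>t x. \<bar>t\<bar> \<le> 1 \<Longrightarrow> norm (Dt Q B t *v x - x) \<le> M * \<bar>t\<bar> * norm x"
    using Dt_lipschitz by blast
  obtain a where a: "a > 0" "\<And>h x. h \<ge> 0 \<Longrightarrow> (1 + a * h) * quad_R Q B x \<le> quad_R Q B (Dt Q B h *v x)"
    using quad_R_growth by blast
  obtain lo hi where R: "lo > 0" "hi > 0" "\<And>x. lo * (norm x)\<^sup>2 \<le> quad_R Q B x"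
    "\<And>x. quad_R Q B x \<le> hi * (norm x)\<^sup>2"
    using quad_R_bounds by blast
  have "expanding_flow (Dt Q B) (quad_R Q B) a lo hi M"
    by unfold_locales
      (simp_all add: Dt_0 Dt_add continuous_on_Dt continuous_on_quad_R M a R)
  then show ?thesis by (rule that)
qed

lemma continuous_on_mehler_kernel:
  "continuous_on UNIV (\<lambda>p. mehler_kernel Q B t (fst p) (snd p))"
  unfolding mehler_kernel_def
  by (intro continuous_intros continuous_on_compose2[OF continuous_on_quad_R[of UNIV]]
      bounded_linear.continuous_on[OF matrix_vector_mul_bounded_linear]) auto

lemma borel_measurable_SUP_mehler_kernel:
  "(\<lambda>p. SUP t\<in>{0<..1}. ennreal (mehler_kernel Q B t (fst p) (snd p))) \<in> borel_measurable borel"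
  by (intro borel_measurable_SUP_lsc continuous_on_ennreal continuous_on_mehler_kernel)

end

theorem theorem10p1:
  fixes Q B :: "real^'n^'n"
    and c :: "nat \<Rightarrow> real^'n"
    and \<rho> rt :: "nat \<Rightarrow> real^'n \<Rightarrow> real"
  assumes "pos_def_matrix Q"
    and "\<forall>z. complex_eigenvalue B z \<longrightarrow> Re z < 0"
    and "c 0 = 0"
    and "maximal_ball_centres c"
    and "localizing_functions c \<rho> rt"
  shows "weak_type_1_1 (gamma_inf Q B) (S0_glob Q B (eta \<rho> rt))"
proof -
  interpret stable_pair Q B using assms(1,2) by unfold_locales
  interpret localization c \<rho> rt using assms(3-5) by unfold_locales
  obtain a lo hi M where "expanding_flow (Dt Q B) (quad_R Q B) a lo hi M"
    by (rule exists_expanding_flow)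
  then interpret flow: expanding_flow "Dt Q B" "quad_R Q B" a lo hi M .
  obtain C0 b where C0: "C0 > 0" "b > 0" "\<And>t x u. 0 < t \<Longrightarrow> t \<le> 1 \<Longrightarrow>
      mehler_kernel Q B t x u \<le> C0 * exp (quad_R Q B x) * flow.heat_factor b t x u"
    unfolding flow.heat_factor_def by (rule mehler_kernel_bound) blast
  have "(1 / 6 :: real) > 0" by simp
  then obtain C where C: "C > 0" and weak:
    "\<And>\<K> F \<alpha>. (\<lambda>(x, u). \<K> x u) \<in> borel_measurable (borel \<Otimes>\<^sub>M borel) \<Longrightarrow> F \<in> borel_measurable borel \<Longrightarrow>
      (\<integral>\<^sup>+u. F u \<partial>lborel) < \<infinity> \<Longrightarrow> \<alpha> > 0 \<Longrightarrow>
      (\<And>x u. norm (x - u) < 1 / 6 / (1 + norm x) \<Longrightarrow> \<K> x u = 0) \<Longrightarrow>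
      (\<And>x u y. (\<And>t. 0 < t \<Longrightarrow> t \<le> 1 \<Longrightarrow> ennreal (flow.heat_factor b t x u) \<le> y) \<Longrightarrow>
         \<K> x u \<le> ennreal (C0 * exp (quad_R Q B x)) * y) \<Longrightarrow>
      (\<integral>\<^sup>+x. indicator {x. ennreal \<alpha> < (\<integral>\<^sup>+u. \<K> x u * F u \<partial>lborel)} x * ennreal (exp (- quad_R Q B x)) \<partial>lborel)
        \<le> ennreal (C / \<alpha>) * (\<integral>\<^sup>+u. F u \<partial>lborel)"
    by (rule flow.weak_type_global_kernel[OF C0(2) _ C0(1)]) blast
  define d where "d = (2 * pi) powr (- real CARD('n) / 2) * det (Qinf Q B) powr (- 1 / 2)"
  have d: "d \<ge> 0" by (simp add: d_def)
  define w where "w x = ennreal (d * exp (- quad_R Q B x))" for x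
  have [measurable]: "w \<in> borel_measurable borel" unfolding w_def[abs_def] by measurable
  have gamma: "gamma_inf Q B = density lborel w"
    by (simp add: gamma_inf_def w_def[abs_def] d_def)
  define \<K> where "\<K> x u = (SUP t\<in>{0<..1}. ennreal (mehler_kernel Q B t x u)) * ennreal (1 - eta \<rho> rt x u)"
    for x u :: "real^'n"
  have mK: "(\<lambda>(x, u). \<K> x u) \<in> borel_measurable (borel \<Otimes>\<^sub>M borel)"
  proof -
    have [measurable]: "(\<lambda>p. SUP t\<in>{0<..1}. ennreal (mehler_kernel Q B t (fst p) (snd p)))
        \<in> borel_measurable (borel \<Otimes>\<^sub>M borel)"
      using borel_measurable_SUP_mehler_kernel by (simp only: borel_prod)
    have [measurable]: "(\<lambda>p. eta \<rho> rt (fst p) (snd p)) \<in> borel_measurable (borel \<Otimes>\<^sub>M borel)"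
      using borel_measurable_eta by (simp only: case_prod_beta')
    show ?thesis unfolding \<K>_def case_prod_beta' by measurable
  qed
  \<comment> \<open>Here \<open>1 - eta \<rho> rt x u\<close> is 0, and the product is 0 even if the
    supremum is infinite.\<close>
  have diag: "\<K> x u = 0" if "norm (x - u) < 1 / 6 / (1 + norm x)" for x u
    using eta_eq_1[of x u] that by (simp add: \<K>_def)
  have dom: "\<K> x u \<le> ennreal (C0 * exp (quad_R Q B x)) * y"
    if y: "\<And>t. 0 < t \<Longrightarrow> t \<le> 1 \<Longrightarrow> ennreal (flow.heat_factor b t x u) \<le> y" for x u y
  proof -
    have "ennreal (mehler_kernel Q B t x u) \<le> ennreal (C0 * exp (quad_R Q B x)) * y" if t: "t \<in> {0<..1}" for t
    proof -
      have "ennreal (mehler_kernel Q B t x u) \<le> ennreal (C0 * exp (quad_R Q B x) * flow.heat_factor b t x u)"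
        using C0(3)[of t x u] t by (intro ennreal_leI) auto
      also have "\<dots> = ennreal (C0 * exp (quad_R Q B x)) * ennreal (flow.heat_factor b t x u)"
        using C0(1) by (intro ennreal_mult') auto
      also have "\<dots> \<le> ennreal (C0 * exp (quad_R Q B x)) * y"
        using y[of t] t by (intro mult_left_mono) auto
      finally show ?thesis .
    qed
    then have "\<K> x u \<le> (ennreal (C0 * exp (quad_R Q B x)) * y) * 1"
      unfolding \<K>_def using eta_nonneg[of x u] by (intro mult_mono SUP_least) auto
    then show ?thesis by simp
  qed
  show ?thesis
    unfolding weak_type_1_1_def
  proof (intro exI[of _ "d * C"] allI impI)
    fix f :: "real^'n \<Rightarrow> real" and \<alpha> :: real
    assume f: "integrable (gamma_inf Q B) f" and \<alpha>: "\<alpha> > 0"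
    have mf [measurable]: "f \<in> borel_measurable borel"
      using borel_measurable_integrable[OF f] by (simp add: gamma)
    \<comment> \<open>The density of the invariant measure is moved into \<open>F\<close>, so the
      Lebesgue integral of \<open>F\<close> is the norm of \<open>f\<close>. The Gaussian weight in
      \<open>x\<close> is what remains in the level set estimate, and the constant \<open>d\<close>
      in it passes into the final constant.\<close>
    define F where "F u = w u * ennreal \<bar>f u\<bar>" for u
    have mF [measurable]: "F \<in> borel_measurable borel" unfolding F_def[abs_def] by measurable
    have IF: "(\<integral>\<^sup>+u. F u \<partial>lborel) = ennreal (LINT u|gamma_inf Q B. \<bar>f u\<bar>)"
    proof -
      have "(\<integral>\<^sup>+u. F u \<partial>lborel) = (\<integral>\<^sup>+u. ennreal \<bar>f u\<bar> \<partial>gamma_inf Q B)"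
        by (simp add: gamma F_def nn_integral_density)
      also have "\<dots> = ennreal (LINT u|gamma_inf Q B. \<bar>f u\<bar>)"
        using f by (intro nn_integral_eq_integral) auto
      finally show ?thesis .
    qed
    note [measurable] = mK
    have S0: "S0_glob Q B (eta \<rho> rt) f x = (\<integral>\<^sup>+u. \<K> x u * F u \<partial>lborel)" for x
      unfolding S0_glob_def gamma \<K>_def[symmetric]
      by (subst nn_integral_density) (measurable, simp add: F_def mult_ac)
    define E where "E = {x. ennreal \<alpha> < (\<integral>\<^sup>+u. \<K> x u * F u \<partial>lborel)}"
    have E: "{x \<in> space (gamma_inf Q B). ennreal \<alpha> < S0_glob Q B (eta \<rho> rt) f x} = E"
      by (simp add: E_def S0 gamma)
    have mE [measurable]: "E \<in> sets borel" unfolding E_def by measurable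
    have "emeasure (gamma_inf Q B) E = (\<integral>\<^sup>+x. ennreal d * (indicator E x * ennreal (exp (- quad_R Q B x))) \<partial>lborel)"
      unfolding gamma using d
      by (subst emeasure_density) (auto simp: w_def ennreal_mult mult_ac intro!: nn_integral_cong)
    also have "\<dots> = ennreal d * (\<integral>\<^sup>+x. indicator E x * ennreal (exp (- quad_R Q B x)) \<partial>lborel)"
      by (rule nn_integral_cmult) measurable
    also have "\<dots> \<le> ennreal d * (ennreal (C / \<alpha>) * (\<integral>\<^sup>+u. F u \<partial>lborel))"
      unfolding E_def by (intro mult_left_mono weak mK mF \<alpha> diag dom) (simp_all add: IF)
    also have "\<dots> = ennreal (d * C / \<alpha> * (LINT u|gamma_inf Q B. \<bar>f u\<bar>))"
    proof -
      have "(LINT u|gamma_inf Q B. \<bar>f u\<bar>) \<ge> 0" by simp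
      then show ?thesis using d C \<alpha> by (simp add: IF mult.assoc flip: ennreal_mult)
    qed
    finally show "{x \<in> space (gamma_inf Q B). ennreal \<alpha> < S0_glob Q B (eta \<rho> rt) f x} \<in> sets (gamma_inf Q B) \<and>
        emeasure (gamma_inf Q B) {x \<in> space (gamma_inf Q B). ennreal \<alpha> < S0_glob Q B (eta \<rho> rt) f x}
          \<le> ennreal (d * C / \<alpha> * (LINT u|gamma_inf Q B. \<bar>f u\<bar>))"
      unfolding E using mE by (simp add: gamma)
  qed
qed

end
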